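(* Let $\mathcal{M}$ be a von Neumann algebra of operators on a complex Hilbert space $H$ and let $\varphi$ be a faithful normal state on $\mathcal{M}$. Let $D_\varphi\subseteq H$ be the lineal of $\varphi$, and let $L_1(\varphi)$ be the space of sesquilinear forms on $D_\varphi$ integrable with respect to $\varphi$. For a sesquilinear form $a$ defined on $D_\varphi$, the following conditions are equivalent: (i) $a\in L_1(\varphi)$; (ii) for any representation $\varphi=\sum_{i\in I}\langle\,\cdot\, f_i,f_i\rangle$ with $f_i\in H$ ($i \in I$), the series $\sum_{i\in I}a(f_i,f_i)$ converges absolutely, and its sum does not depend on the choice of such a representation of $\varphi$.
   Context: $\langle\cdot,\cdot\rangle$ denotes the scalar product of $H$. $\mathcal{M}^+$ is the set of positive elements of $\mathcal{M}$ and $\mathcal{M}^{\mathrm{sa}}$ the set of self-adjoint elements of $\mathcal{M}$. Representation of $\varphi$: writing $\varphi=\sum_{i\in I}\langle\,\cdot\, f_i,f_i\rangle$ means that $I$ is an index set, $f_i\in H$ for $i\in I$, and $\varphi(x)=\sum_{i\in I}\langle x f_i,f_i\rangle$ for all $x\in\mathcal{M}^+$. Lineal of $\varphi$: the linear subspace of $H$ $$D_\varphi=\{f\in H : \exists\lambda>0\ \forall x\in\mathcal{M}^+\ (\langle xf,f\rangle\le\lambda\varphi(x))\}.$$ If $\varphi=\sum_{i\in I}\langle\,\cdot\, f_i,f_i\rangle$, then $f_i\in D_\varphi$ for every $i\in I$, so the values $a(f_i,f_i)$ make sense. A sesquilinear form on $D_\varphi$ is a map $a:D_\varphi\times D_\varphi\to\mathbb{C}$,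 linear in the first and conjugate-linear in the second argument (the same convention as for $\langle\cdot,\cdot\rangle$); no boundedness or continuity is assumed. It is hermitian if $a(f,g)=\overline{a(g,f)}$ for all $f,g\in D_\varphi$. Integrable forms: the formula $$\|x\|_\varphi=\inf\{\varphi(x_1+x_2): x=x_1-x_2,\ x_1,x_2\in\mathcal{M}^+\}$$ defines a norm on $\mathcal{M}^{\mathrm{sa}}$ (since $\varphi$ is a state, every element of $\mathcal{M}^+$ has finite $\varphi$-value). $L_1(\varphi)^{\mathrm{sa}}$ denotes the completion of $(\mathcal{M}^{\mathrm{sa}},\|\cdot\|_\varphi)$. An element $\widetilde{x}$ of this completion determined by a $\|\cdot\|_\varphi$-Cauchy sequence $(x_n)$ in $\mathcal{M}^{\mathrm{sa}}$ is identified with the hermitian sesquilinear form on $D_\varphi$ $$a_{\widetilde{x}}(f,g)=\lim_{n}\langle x_nf,g\rangle,\qquad f,g\in D_\varphi.$$ This limit exists and depends only on $\widetilde{x}$, and the map $\widetilde{x}\mapsto a_{\widetilde{x}}$ is injective. Thus a hermitian sesquilinear form $a$ on $D_\varphi$ belongs to $L_1(\varphi)^{\mathrm{sa}}$ if and only if there is a $\|\cdot\|_\varphi$-Cauchy sequence $(x_n)$ in $\mathcal{M}^{\mathrm{sa}}$ such that $a(f,g)=\lim_n\langle x_nf,g\rangle$ for all $f,g\in D_\varphi$. The space $L_1(\varphi)$ is the complexification of $L_1(\varphi)^{\mathrm{sa}}$; as a set of sesquilinear forms on $D_\varphi$ it consists of all $a_1+\mathrm{i}\,a_2$ with $a_1,a_2\in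 L_1(\varphi)^{\mathrm{sa}}$. *)

theory Defs
  imports "HOL-Analysis.Analysis" "HOL-Library.Infinite_Typeclass"
begin

text \<open>
  Complex Hilbert spaces. The underlying real Hilbert space is the one with inner product
  \<open>Re (cinner x y)\<close>, so that norm, topology and bounded linear maps are those of the library.
  \<open>cinner\<close> is linear in the first and conjugate-linear in the second argument.
\<close>

class complex_vector = real_vector +
  fixes scaleC :: "complex \<Rightarrow> 'a \<Rightarrow> 'a" (infixr \<open>*\<^sub>C\<close> 75)
  assumes scaleC_add_right: "c *\<^sub>C (x + y) = c *\<^sub>C x + c *\<^sub>C y"
    and scaleC_add_left: "(c + d) *\<^sub>C x = c *\<^sub>C x + d *\<^sub>C x"
    and scaleC_scaleC: "c *\<^sub>C d *\<^sub>C x = (c * d) *\<^sub>C x"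
    and scaleC_of_real: "complex_of_real r *\<^sub>C x = r *\<^sub>R x"

class complex_inner = complex_vector + real_inner +
  fixes cinner :: "'a \<Rightarrow> 'a \<Rightarrow> complex"
  assumes cinner_add_left: "cinner (x + y) z = cinner x z + cinner y z"
    and cinner_scaleC_left: "cinner (c *\<^sub>C x) y = c * cinner x y"
    and cinner_commute: "cinner x y = cnj (cinner y x)"
    and inner_eq_Re_cinner: "inner x y = Re (cinner x y)"

class chilbert_space = complex_inner + banach

lemma norm_scaleC: "norm (c *\<^sub>C x) = cmod c * norm (x :: 'a::complex_inner)"
proof -
  have real: "Im (cinner x x) = 0"
    using cinner_commute[of x x] by (metis Reals_cnj_iff complex_is_Real_iff)
  have "cinner (c *\<^sub>C x) (c *\<^sub>C x) = c * cnj c * cinner x x"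
    by (metis cinner_commute cinner_scaleC_left complex_cnj_mult mult.assoc)
  then have "inner (c *\<^sub>C x) (c *\<^sub>C x) = (cmod c)\<^sup>2 * inner x x"
    using real by (simp add: inner_eq_Re_cinner flip: complex_norm_square)
  then show ?thesis
    by (simp add: norm_eq_sqrt_inner real_sqrt_mult)
qed

lemma bounded_linear_scaleC: "bounded_linear (\<lambda>x :: 'a::complex_inner. c *\<^sub>C x)"
proof (rule bounded_linear_intro[where K = "cmod c"])
  fix r and x :: 'a
  show "c *\<^sub>C r *\<^sub>R x = r *\<^sub>R c *\<^sub>C x"
    by (metis scaleC_of_real scaleC_scaleC mult.commute)
qed (simp_all add: scaleC_add_right norm_scaleC mult.commute)

instantiation blinfun :: (real_normed_vector, complex_inner) complex_vector
begin

definition scaleC_blinfun :: "complex \<Rightarrow> 'a \<Rightarrow>\<^sub>L 'b \<Rightarrow> 'a \<Rightarrow>\<^sub>L 'b" where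
  "scaleC_blinfun c x = Blinfun (\<lambda>f. c *\<^sub>C blinfun_apply x f)"

lemma blinfun_apply_scaleC: "blinfun_apply (c *\<^sub>C x) f = c *\<^sub>C blinfun_apply x f"
  for x :: "'a \<Rightarrow>\<^sub>L 'b"
proof -
  have "bounded_linear (\<lambda>f. c *\<^sub>C blinfun_apply x f)"
    by (rule bounded_linear_compose[OF bounded_linear_scaleC blinfun.bounded_linear_right])
  then show ?thesis
    by (simp add: scaleC_blinfun_def bounded_linear_Blinfun_apply)
qed

instance
  by standard
    (auto intro!: blinfun_eqI simp: blinfun_apply_scaleC blinfun.add_left blinfun.scaleR_left
      scaleC_add_right scaleC_add_left scaleC_scaleC scaleC_of_real)

end


text \<open>
  \<open>'h \<Rightarrow>\<^sub>L 'h\<close> is the type of bounded real-linear operators on \<open>'h\<close>; the algebra $B(H)$ is the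
  following set.
\<close>

definition cbounded_ops :: "('h::chilbert_space \<Rightarrow>\<^sub>L 'h) set" where
  "cbounded_ops = {x. \<forall>c f. blinfun_apply x (c *\<^sub>C f) = c *\<^sub>C blinfun_apply x f}"

definition is_adjoint :: "('h::chilbert_space \<Rightarrow>\<^sub>L 'h) \<Rightarrow> ('h \<Rightarrow>\<^sub>L 'h) \<Rightarrow> bool" where
  "is_adjoint x y \<longleftrightarrow>
    (\<forall>f g. cinner (blinfun_apply x f) g = cinner f (blinfun_apply y g))"

definition commutant :: "('h::chilbert_space \<Rightarrow>\<^sub>L 'h) set \<Rightarrow> ('h \<Rightarrow>\<^sub>L 'h) set" where
  "commutant S = {y \<in> cbounded_ops. \<forall>x\<in>S. x o\<^sub>L y = y o\<^sub>L x}"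

text \<open>
  A commutant is always a unital complex subalgebra of $B(H)$, so the subalgebra axioms need not
  be listed in addition to \<open>M'' = M\<close>.
\<close>

definition von_neumann_algebra :: "('h::chilbert_space \<Rightarrow>\<^sub>L 'h) set \<Rightarrow> bool" where
  "von_neumann_algebra M \<longleftrightarrow>
    M \<subseteq> cbounded_ops \<and>
    (\<forall>x\<in>M. \<exists>y\<in>M. is_adjoint x y) \<and>
    commutant (commutant M) = M"

definition sa_part :: "('h::chilbert_space \<Rightarrow>\<^sub>L 'h) set \<Rightarrow> ('h \<Rightarrow>\<^sub>L 'h) set" where
  "sa_part M = {x \<in> M. is_adjoint x x}"

definition pos_part :: "('h::chilbert_space \<Rightarrow>\<^sub>L 'h) set \<Rightarrow> ('h \<Rightarrow>\<^sub>L 'h) set" where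
  "pos_part M = {x \<in> M. \<forall>f. cinner (blinfun_apply x f) f \<in> \<real>\<^sub>\<ge>\<^sub>0}"

text \<open>Functionals on \<open>M\<close> are total functions; only their values on \<open>M\<close> matter.\<close>

definition state_on ::
    "('h::chilbert_space \<Rightarrow>\<^sub>L 'h) set \<Rightarrow> ('h \<Rightarrow>\<^sub>L 'h \<Rightarrow> complex) \<Rightarrow> bool" where
  "state_on M \<phi> \<longleftrightarrow>
    (\<forall>x\<in>M. \<forall>y\<in>M. \<phi> (x + y) = \<phi> x + \<phi> y) \<and>
    (\<forall>c. \<forall>x\<in>M. \<phi> (c *\<^sub>C x) = c * \<phi> x) \<and>
    (\<forall>x\<in>pos_part M. \<phi> x \<in> \<real>\<^sub>\<ge>\<^sub>0) \<and>
    \<phi> id_blinfun = 1"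

definition faithful_on ::
    "('h::chilbert_space \<Rightarrow>\<^sub>L 'h) set \<Rightarrow> ('h \<Rightarrow>\<^sub>L 'h \<Rightarrow> complex) \<Rightarrow> bool" where
  "faithful_on M \<phi> \<longleftrightarrow> (\<forall>x\<in>pos_part M. \<phi> x = 0 \<longrightarrow> x = 0)"

definition is_lub_in ::
    "('h::chilbert_space \<Rightarrow>\<^sub>L 'h) set \<Rightarrow> ('h \<Rightarrow>\<^sub>L 'h) set \<Rightarrow> 'h \<Rightarrow>\<^sub>L 'h \<Rightarrow> bool" where
  "is_lub_in M A s \<longleftrightarrow>
    s \<in> sa_part M \<and>
    (\<forall>x\<in>A. s - x \<in> pos_part M) \<and>
    (\<forall>u\<in>sa_part M. (\<forall>x\<in>A. u - x \<in> pos_part M) \<longrightarrow> u - s \<in> pos_part M)"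

text \<open>
  Normality is order continuity: $\varphi(\sup x_\alpha) = \sup \varphi(x_\alpha)$ for every bounded
  increasing net in the positive cone. Such a net enters only through its range, an
  upward directed set.
\<close>

definition normal_on ::
    "('h::chilbert_space \<Rightarrow>\<^sub>L 'h) set \<Rightarrow> ('h \<Rightarrow>\<^sub>L 'h \<Rightarrow> complex) \<Rightarrow> bool" where
  "normal_on M \<phi> \<longleftrightarrow>
    (\<forall>A s. A \<subseteq> pos_part M \<longrightarrow> A \<noteq> {} \<longrightarrow>
      (\<forall>x\<in>A. \<forall>y\<in>A. \<exists>z\<in>A. z - x \<in> pos_part M \<and> z - y \<in> pos_part M) \<longrightarrow>
      is_lub_in M A s \<longrightarrow>
      Re (\<phi> s) = (SUP x\<in>A. Re (\<phi> x)))"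

text \<open>
  Index sets are the subsets of a type \<open>'i\<close>, to be taken as an arbitrary infinite type when
  quantifying over all representations of a normal state. No representation is lost that way: in
  each one $\sum_i \|f_i\|^2 = \varphi(1) = 1$, so all but countably many $f_i$ vanish, and
  representations over two types become representations over the sum type. A finite type would
  not do, since a normal state need not be a finite sum of vector functionals.
\<close>

definition represents ::
    "('h::chilbert_space \<Rightarrow>\<^sub>L 'h) set \<Rightarrow> ('h \<Rightarrow>\<^sub>L 'h \<Rightarrow> complex) \<Rightarrow> 'i set \<Rightarrow> ('i \<Rightarrow> 'h) \<Rightarrow> bool" where
  "represents M \<phi> I f \<longleftrightarrow>
    (\<forall>x\<in>pos_part M. ((\<lambda>i. cinner (blinfun_apply x (f i)) (f i)) has_sum \<phi> x) I)"

definition lineal ::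
    "('h::chilbert_space \<Rightarrow>\<^sub>L 'h) set \<Rightarrow> ('h \<Rightarrow>\<^sub>L 'h \<Rightarrow> complex) \<Rightarrow> 'h set" where
  "lineal M \<phi> = {f. \<exists>l>0. \<forall>x\<in>pos_part M.
    Re (cinner (blinfun_apply x f) f) \<le> l * Re (\<phi> x)}"

text \<open>
  Forms on a subspace \<open>D\<close> are total functions; two of them are the same form if they agree on
  \<open>D\<close>.
\<close>

definition sesquilinear_on :: "'h::chilbert_space set \<Rightarrow> ('h \<Rightarrow> 'h \<Rightarrow> complex) \<Rightarrow> bool" where
  "sesquilinear_on D a \<longleftrightarrow>
    (\<forall>f\<in>D. \<forall>g\<in>D. \<forall>h\<in>D. a (f + g) h = a f h + a g h) \<and>
    (\<forall>c. \<forall>f\<in>D. \<forall>h\<in>D. a (c *\<^sub>C f) h = c * a f h) \<and>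
    (\<forall>f\<in>D. \<forall>g\<in>D. \<forall>h\<in>D. a f (g + h) = a f g + a f h) \<and>
    (\<forall>c. \<forall>f\<in>D. \<forall>g\<in>D. a f (c *\<^sub>C g) = cnj c * a f g)"

definition hermitian_on :: "'h::chilbert_space set \<Rightarrow> ('h \<Rightarrow> 'h \<Rightarrow> complex) \<Rightarrow> bool" where
  "hermitian_on D a \<longleftrightarrow> (\<forall>f\<in>D. \<forall>g\<in>D. a f g = cnj (a g f))"

definition phi_norm ::
    "('h::chilbert_space \<Rightarrow>\<^sub>L 'h) set \<Rightarrow> ('h \<Rightarrow>\<^sub>L 'h \<Rightarrow> complex) \<Rightarrow> 'h \<Rightarrow>\<^sub>L 'h \<Rightarrow> real" where
  "phi_norm M \<phi> x =
    Inf {Re (\<phi> (x1 + x2)) | x1 x2. x1 \<in> pos_part M \<and> x2 \<in> pos_part M \<and> x = x1 - x2}"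

definition phi_Cauchy ::
    "('h::chilbert_space \<Rightarrow>\<^sub>L 'h) set \<Rightarrow> ('h \<Rightarrow>\<^sub>L 'h \<Rightarrow> complex) \<Rightarrow> (nat \<Rightarrow> 'h \<Rightarrow>\<^sub>L 'h) \<Rightarrow> bool" where
  "phi_Cauchy M \<phi> x \<longleftrightarrow>
    (\<forall>e>0. \<exists>N. \<forall>m\<ge>N. \<forall>n\<ge>N. phi_norm M \<phi> (x m - x n) < e)"

text \<open>
  The completion of the self-adjoint part is realised as forms: the class of a Cauchy sequence
  \<open>x\<close> is the form $\lim_n \langle x_n f, g\rangle$.
\<close>

definition L1_sa ::
    "('h::chilbert_space \<Rightarrow>\<^sub>L 'h) set \<Rightarrow> ('h \<Rightarrow>\<^sub>L 'h \<Rightarrow> complex) \<Rightarrow> ('h \<Rightarrow> 'h \<Rightarrow> complex) set" where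
  "L1_sa M \<phi> = {a.
    sesquilinear_on (lineal M \<phi>) a \<and> hermitian_on (lineal M \<phi>) a \<and>
    (\<exists>x. (\<forall>n. x n \<in> sa_part M) \<and> phi_Cauchy M \<phi> x \<and>
      (\<forall>f\<in>lineal M \<phi>. \<forall>g\<in>lineal M \<phi>.
        (\<lambda>n. cinner (blinfun_apply (x n) f) g) \<longlonglongrightarrow> a f g))}"

definition L1 ::
    "('h::chilbert_space \<Rightarrow>\<^sub>L 'h) set \<Rightarrow> ('h \<Rightarrow>\<^sub>L 'h \<Rightarrow> complex) \<Rightarrow> ('h \<Rightarrow> 'h \<Rightarrow> complex) set" where
  "L1 M \<phi> = {a. sesquilinear_on (lineal M \<phi>) a \<and>
    (\<exists>a1\<in>L1_sa M \<phi>. \<exists>a2\<in>L1_sa M \<phi>.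
      \<forall>f\<in>lineal M \<phi>. \<forall>g\<in>lineal M \<phi>. a f g = a1 f g + \<i> * a2 f g)}"

end

theory Submission
  imports Defs
begin

text \<open>
  The complex structure plays no role in the operator arguments, which take place in real Hilbert spaces.

  For (i) implies (ii), a decomposition \<open>x = x1 - x2\<close> bounds $\sum_i |\langle x f_i, f_i\rangle|$ by
  $\varphi(x_1 + x_2)$, so a Cauchy sequence for the norm of $\varphi$ makes the sequences
  $(\langle x_n f_i, f_i\rangle)_i$ converge in $\ell_1$.

  For (ii) implies (i), represent $\varphi$ by a vector \<open>cyc\<close> in $\ell_2(H)$. Functionals dominated by
  $\varphi$ are the $x \mapsto \langle x y\, cyc, cyc\rangle$ with \<open>y \<ge> 0\<close> in the commutant, and every one of them is
  again a sum of vector functionals. By (ii), $\sum_i a(f_i, f_i)$ only depends on the functional represented, hence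
  it defines a linear functional \<open>psi\<close> on the commutant, which is continuous along increasing sequences. A gliding hump argument
  shows that \<open>psi\<close> is strongly continuous on the unit ball. Minimising $\frac{C}{2} \|y\, cyc\|^2 - \psi(y)$
  over this ball for large \<open>C\<close> approximates \<open>psi\<close>, uniformly on the ball, by functionals
  $y \mapsto \langle y\, cyc, x\, cyc\rangle$ with self-adjoint \<open>x\<close> in the algebra. The norm of $\varphi$ is dual
  to the unit ball of the commutant, so these \<open>x\<close> form the required Cauchy sequence.
\<close>

section \<open>Operators on real Hilbert spaces\<close>

text \<open>The obstacle is that (ii) bounds nothing. It makes \<open>psi\<close> additive and
  continuous along increasing sequences, but gives neither positivity nor boundedness, so no Riesz
  argument applies at once. In the scalar case the remedy is the theorem that a finite signed
  measure vanishing on null sets is absolutely continuous in the epsilon-delta sense; the gliding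
  hump is a noncommutative form of it. There the small operators \<open>y n\<close> have no disjoint
  supports and do not commute, so the humps are cut out by differences of operators
  \<open>S N\<close>, against which the \<open>y n\<close> become summable. Resolvents of positive
  operators, squares, and one lemma on minimising a quadratic functional over a convex set take the
  place of spectral projections, polar decompositions and positive parts. The passage to l2(H) turns
  the state into a single vector functional. The relevant commutant is that of the amplified algebra
  on the cyclic subspace of \<open>cyc\<close>: there an operator of the commutant that kills
  \<open>cyc\<close> vanishes.\<close>

lemmas bl_simps = blinfun.bilinear_simps inner_add_left inner_add_right inner_diff_left inner_diff_right
  inner_minus_left inner_minus_right

section \<open>Convex minimisation, Riesz representation and adjoints\<close>

lemma lim_ge: "X \<longlonglongrightarrow> x \<Longrightarrow> (\<And>n. a \<le> X n) \<Longrightarrow> a \<le> x" for a x :: real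
  by (rule LIMSEQ_le_const) auto

lemma lim_le: "X \<longlonglongrightarrow> x \<Longrightarrow> (\<And>n. X n \<le> a) \<Longrightarrow> x \<le> a" for a x :: real
  by (rule LIMSEQ_le_const2) auto

text \<open>The functional minimised is \<open>J y = ||v y||^2 / 2 - L y\<close>. \<open>Y\<close>
  need not be closed and \<open>v\<close>, \<open>L\<close> carry no topology, so the infimum need
  not be attained; but the parallelogram identity makes \<open>v (y n)\<close> Cauchy along a
  minimising sequence, and then \<open>L (y n)\<close> converges too. The conclusion is the
  first-order condition at the limit. It serves for Riesz representation, for approximating
  \<open>psi\<close>, and with \<open>L = 0\<close> for nearest points.\<close>

lemma convex_minimization:
  fixes v :: "'b::real_vector \<Rightarrow> 'a::{real_inner,banach}" and L :: "'b \<Rightarrow> real"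
  assumes ne: "Y \<noteq> {}" and Y: "convex Y"
    and v: "\<And>y z t. y \<in> Y \<Longrightarrow> z \<in> Y \<Longrightarrow> 0 \<le> t \<Longrightarrow> t \<le> 1 \<Longrightarrow>
      v ((1 - t) *\<^sub>R y + t *\<^sub>R z) = (1 - t) *\<^sub>R v y + t *\<^sub>R v z"
    and L: "\<And>y z t. y \<in> Y \<Longrightarrow> z \<in> Y \<Longrightarrow> 0 \<le> t \<Longrightarrow> t \<le> 1 \<Longrightarrow>
      L ((1 - t) *\<^sub>R y + t *\<^sub>R z) = (1 - t) * L y + t * L z"
    and bd: "\<And>y. y \<in> Y \<Longrightarrow> L y \<le> K + K' * norm (v y)"
  obtains p l y where "\<And>n::nat. y n \<in> Y" "(\<lambda>n. v (y n)) \<longlonglongrightarrow> p" "(\<lambda>n. L (y n)) \<longlonglongrightarrow> l"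
    "\<And>z. z \<in> Y \<Longrightarrow> L z - inner p (v z) \<le> l - (norm p)\<^sup>2"
proof -
  define J where "J y = (norm (v y))\<^sup>2 / 2 - L y" for y
  have Jlow: "J y \<ge> - K - K'\<^sup>2 / 2" if "y \<in> Y" for y
  proof -
    have "(norm (v y) - K')\<^sup>2 \<ge> 0" by simp
    then show ?thesis using bd[OF that] unfolding J_def
      by (simp add: power2_eq_square algebra_simps)
  qed
  define m where "m = Inf (J ` Y)"
  have bdd: "bdd_below (J ` Y)" using Jlow by (intro bdd_belowI2) auto
  have mle: "m \<le> J y" if "y \<in> Y" for y unfolding m_def using bdd that by (rule cINF_lower)
  have "\<exists>y. y \<in> Y \<and> J y < m + 1 / real (Suc n)" for n
    using cInf_lessD[of "J ` Y" "m + 1 / real (Suc n)"] ne unfolding m_def[symmetric] by auto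
  then obtain y where yY: "\<And>n. y n \<in> Y" and yJ: "\<And>n. J (y n) < m + 1 / real (Suc n)" by metis
  have Jlim: "(\<lambda>n. J (y n)) \<longlonglongrightarrow> m"
  proof (rule tendsto_sandwich[of "\<lambda>n. m" _ _ "\<lambda>n. m + 1 / real (Suc n)"])
    have "(\<lambda>n. m + 1 / real (Suc n)) \<longlonglongrightarrow> m + 0"
      by (intro tendsto_add tendsto_const LIMSEQ_Suc[OF lim_1_over_n])
    then show "(\<lambda>n. m + 1 / real (Suc n)) \<longlonglongrightarrow> m" by simp
  qed (use mle[OF yY] less_imp_le[OF yJ] in \<open>simp_all del: of_nat_Suc\<close>)
  have Jt: "J ((1-t) *\<^sub>R y + t *\<^sub>R z) = J y + t * (inner (v y) (v z - v y) - (L z - L y)) + t\<^sup>2 / 2 * (norm (v z - v y))\<^sup>2"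
    if "y \<in> Y" "z \<in> Y" "0 \<le> t" "t \<le> 1" for y z t
    unfolding J_def v[OF that] L[OF that] power2_norm_eq_inner
    by (simp add: inner_add_left inner_add_right inner_diff_left inner_diff_right inner_commute
      power2_eq_square algebra_simps add_divide_distrib diff_divide_distrib)
  have inY: "(1-t) *\<^sub>R y + t *\<^sub>R z \<in> Y" if "y \<in> Y" "z \<in> Y" "0 \<le> t" "t \<le> 1" for y z t
    using Y that by (simp add: convex_alt)
  \<comment> \<open>Compares \<open>J\<close> at \<open>y\<close>, at \<open>z\<close> and at their
    midpoint, whose value is at least \<open>m\<close>.\<close>
  have par: "(norm (v z - v y))\<^sup>2 \<le> 4 * ((J y - m) + (J z - m))" if "y \<in> Y" "z \<in> Y" for y z
  proof -
    have "J z = J y + 1 * (inner (v y) (v z - v y) - (L z - L y)) + 1\<^sup>2 / 2 * (norm (v z - v y))\<^sup>2"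
      using Jt[OF that, of 1] by simp
    moreover have "J ((1-1/2) *\<^sub>R y + (1/2) *\<^sub>R z) = J y + (1/2) * (inner (v y) (v z - v y) - (L z - L y)) + (1/2)\<^sup>2 / 2 * (norm (v z - v y))\<^sup>2"
      using that by (intro Jt) auto
    moreover have "m \<le> J ((1-1/2) *\<^sub>R y + (1/2) *\<^sub>R z)" using that by (intro mle inY) auto
    ultimately show ?thesis by (simp add: power2_eq_square algebra_simps)
  qed
  have "Cauchy (\<lambda>n. v (y n))"
  proof (rule metric_CauchyI)
    fix e :: real assume e: "e > 0"
    then have "0 < e\<^sup>2 / 8" by simp
    then have "\<forall>\<^sub>F n in sequentially. J (y n) < m + e\<^sup>2 / 8"
      using order_tendstoD(2)[OF Jlim, of "m + e\<^sup>2 / 8"] by simp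
    then obtain N where N: "\<And>n. n \<ge> N \<Longrightarrow> J (y n) < m + e\<^sup>2 / 8"
      by (auto simp: eventually_sequentially)
    have "dist (v (y i)) (v (y j)) < e" if "i \<ge> N" "j \<ge> N" for i j
    proof -
      have "(norm (v (y i) - v (y j)))\<^sup>2 < e\<^sup>2"
        using par[OF yY yY, of j i] N[OF that(1)] N[OF that(2)] by (simp add: field_simps norm_minus_commute)
      then show ?thesis using e by (simp add: dist_norm power2_less_imp_less)
    qed
    then show "\<exists>M. \<forall>m\<ge>M. \<forall>n\<ge>M. dist (v (y m)) (v (y n)) < e" by blast
  qed
  then obtain p where p: "(\<lambda>n. v (y n)) \<longlonglongrightarrow> p" using Cauchy_convergent_iff convergent_def by blast
  define l where "l = (norm p)\<^sup>2 / 2 - m"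
  have Lp: "(\<lambda>n. L (y n)) \<longlonglongrightarrow> l"
  proof -
    have "(\<lambda>n. (norm (v (y n)))\<^sup>2 / 2 - J (y n)) \<longlonglongrightarrow> l" unfolding l_def
      by (intro tendsto_intros p Jlim) auto
    then show ?thesis by (simp add: J_def)
  qed
  have "L z - inner p (v z) \<le> l - (norm p)\<^sup>2" if z: "z \<in> Y" for z
  proof (rule ccontr)
    assume neg: "\<not> ?thesis"
    define A where "A = inner p (v z - p) - (L z - l)"
    have A: "A < 0" using neg unfolding A_def by (simp add: inner_diff_right power2_norm_eq_inner)
    have key: "0 \<le> t * A + t\<^sup>2 / 2 * (norm (v z - p))\<^sup>2" if t: "0 \<le> t" "t \<le> 1" for t
    proof -
      have "(\<lambda>n. J (y n) + t * (inner (v (y n)) (v z - v (y n)) - (L z - L (y n))) + t\<^sup>2 / 2 * (norm (v z - v (y n)))\<^sup>2)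
        \<longlonglongrightarrow> m + t * A + t\<^sup>2 / 2 * (norm (v z - p))\<^sup>2"
        unfolding A_def by (intro tendsto_intros p Jlim Lp)
      moreover have "m \<le> J (y n) + t * (inner (v (y n)) (v z - v (y n)) - (L z - L (y n))) + t\<^sup>2 / 2 * (norm (v z - v (y n)))\<^sup>2" for n
        using mle[OF inY[OF yY z t]] Jt[OF yY z t] by simp
      ultimately have "m \<le> m + t * A + t\<^sup>2 / 2 * (norm (v z - p))\<^sup>2"
        by (rule lim_ge)
      then show ?thesis by simp
    qed
    \<comment> \<open>\<open>t = - A / B\<close> lies in (0, 1], and since \<open>B\<close> exceeds
      \<open>||v z - p||^2\<close>, \<open>key\<close> would give
      \<open>0 <= A + t / 2 * B = A / 2 < 0\<close>.\<close>
    define B where "B = (norm (v z - p))\<^sup>2 + 1 - A"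
    define t where "t = - A / B"
    have B: "B > 0" "- A \<le> B" using A unfolding B_def by (smt (verit) zero_le_power2)+
    have t: "0 < t" "t \<le> 1" using A B unfolding t_def by (auto simp: divide_simps)
    have "0 \<le> t * (A + t / 2 * (norm (v z - p))\<^sup>2)" using key[of t] t by (simp add: power2_eq_square algebra_simps)
    then have "0 \<le> A + t / 2 * (norm (v z - p))\<^sup>2" using t by (simp add: zero_le_mult_iff)
    also have "\<dots> \<le> A + t / 2 * B" using t A unfolding B_def by (intro add_left_mono mult_left_mono) auto
    also have "t / 2 * B = - A / 2" using B unfolding t_def by simp
    finally show False using A by simp
  qed
  with that[OF yY p Lp] show ?thesis by blast
qed

text \<open>By the bound, \<open>L\<close> factors through \<open>v\<close> and is bounded on the
  image, which need not be closed. On a subspace the first-order condition bounds a linear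
  expression from above, so that expression vanishes.\<close>

lemma riesz_on_image:
  fixes v :: "'b::real_vector \<Rightarrow> 'a::{real_inner,banach}" and L :: "'b \<Rightarrow> real"
  assumes Y: "subspace Y"
    and v: "\<And>y z. y \<in> Y \<Longrightarrow> z \<in> Y \<Longrightarrow> v (y + z) = v y + v z" "\<And>r y. y \<in> Y \<Longrightarrow> v (r *\<^sub>R y) = r *\<^sub>R v y"
    and L: "\<And>y z. y \<in> Y \<Longrightarrow> z \<in> Y \<Longrightarrow> L (y + z) = L y + L z" "\<And>r y. y \<in> Y \<Longrightarrow> L (r *\<^sub>R y) = r * L y"
    and bd: "\<And>y. y \<in> Y \<Longrightarrow> \<bar>L y\<bar> \<le> K * norm (v y)"
  obtains p where "p \<in> closure (v ` Y)" "\<And>y. y \<in> Y \<Longrightarrow> inner (v y) p = L y"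
proof -
  obtain p l y where y: "\<And>n::nat. y n \<in> Y" "(\<lambda>n. v (y n)) \<longlonglongrightarrow> p"
    and le: "\<And>z. z \<in> Y \<Longrightarrow> L z - inner p (v z) \<le> l - (norm p)\<^sup>2"
  proof (rule convex_minimization[of Y v L 0 K])
    show "Y \<noteq> {}" using Y subspace_0 by blast
    show "convex Y" using Y by (rule subspace_imp_convex)
    show "L y \<le> 0 + K * norm (v y)" if "y \<in> Y" for y using bd[OF that] by simp
  qed (use Y v L in \<open>auto simp: subspace_scale\<close>)
  have "L z = inner p (v z)" if z: "z \<in> Y" for z
  proof (rule ccontr)
    assume ne: "L z \<noteq> inner p (v z)"
    define d where "d = L z - inner p (v z)"
    have rr: "r * d \<le> l - (norm p)\<^sup>2" for r
      using le[of "r *\<^sub>R z"] z Y v L by (simp add: subspace_scale d_def algebra_simps)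
    show False using rr[of "(l - (norm p)\<^sup>2 + 1) / d"] ne by (simp add: d_def)
  qed
  moreover have "p \<in> closure (v ` Y)" unfolding closure_sequential using y by (intro exI[of _ "\<lambda>n. v (y n)"]) auto
  ultimately show ?thesis using that by (metis inner_commute)
qed

lemma adjoint_exists:
  fixes T :: "'a::{real_inner,banach} \<Rightarrow>\<^sub>L 'b::{real_inner,banach}"
  obtains S :: "'b \<Rightarrow>\<^sub>L 'a" where "\<And>f g. inner (T f) g = inner f (S g)" "norm S \<le> norm T"
proof -
  have "\<exists>p. \<forall>f. inner f p = inner (T f) g" for g
  proof (rule riesz_on_image[of UNIV "\<lambda>f. f" "\<lambda>f. inner (T f) g" "norm T * norm g"])
    show "\<bar>inner (T f) g\<bar> \<le> norm T * norm g * norm f" for f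
      using Cauchy_Schwarz_ineq2[of "T f" g] mult_right_mono[OF norm_blinfun[of T f] norm_ge_zero[of g]]
      by (simp add: algebra_simps)
  qed (auto simp: bl_simps)
  then obtain S where S: "\<And>f g. inner f (S g) = inner (T f) g" by metis
  have n: "norm (S g) \<le> norm g * norm T" for g
  proof -
    have "norm (S g) * norm (S g) = inner (T (S g)) g" using S[of "S g" g] by (simp add: power2_norm_eq_inner flip: power2_eq_square)
    also have "\<dots> \<le> norm (T (S g)) * norm g" by (rule norm_cauchy_schwarz)
    also have "\<dots> \<le> norm T * norm (S g) * norm g" by (intro mult_right_mono norm_blinfun) auto
    finally have "norm (S g) * norm (S g) \<le> norm (S g) * (norm g * norm T)" by (simp add: ac_simps)
    then show ?thesis by (cases "S g = 0") auto
  qed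
  have bl: "bounded_linear S"
  proof (rule bounded_linear_intro[where K="norm T"])
    show "S (x + y) = S x + S y" for x y
      by (metis (no_types, lifting) S inner_add_right vector_eq_ldot)
    show "S (r *\<^sub>R x) = r *\<^sub>R S x" for r x
      by (metis (no_types, lifting) S inner_scaleR_right vector_eq_ldot)
  qed (rule n)
  show ?thesis
  proof (rule that[of "Blinfun S"])
    show "norm (Blinfun S) \<le> norm T" using n bl by (intro norm_blinfun_bound) (auto simp: bounded_linear_Blinfun_apply mult.commute)
  qed (use bl S in \<open>auto simp: bounded_linear_Blinfun_apply\<close>)
qed

section \<open>Symmetric and positive operators\<close>

definition symm :: "('a::real_inner \<Rightarrow>\<^sub>L 'a) \<Rightarrow> bool" where
  "symm x \<longleftrightarrow> (\<forall>f g. inner (x f) g = inner f (x g))"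

text \<open>On a real Hilbert space a nonnegative quadratic form does not force symmetry, so
  symmetry is part of the notion.\<close>

definition psd :: "('a::real_inner \<Rightarrow>\<^sub>L 'a) \<Rightarrow> bool" where
  "psd x \<longleftrightarrow> symm x \<and> (\<forall>f. 0 \<le> inner (x f) f)"

lemma psdD: "psd x \<Longrightarrow> symm x" "psd x \<Longrightarrow> 0 \<le> inner (x f) f"
  and symmD: "symm x \<Longrightarrow> inner (x f) g = inner f (x g)"
  by (auto simp: psd_def symm_def)

lemma psdI: "symm x \<Longrightarrow> (\<And>f. 0 \<le> inner (x f) f) \<Longrightarrow> psd x"
  by (auto simp: psd_def)

lemma symm_intros [intro, simp]:
  "symm 0" "symm id_blinfun" "symm x \<Longrightarrow> symm y \<Longrightarrow> symm (x + y)" "symm x \<Longrightarrow> symm y \<Longrightarrow> symm (x - y)"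
  "symm x \<Longrightarrow> symm (r *\<^sub>R x)" "symm x \<Longrightarrow> symm (- x)"
  by (auto simp: symm_def bl_simps)

lemma psd_intros [intro, simp]:
  "psd 0" "psd id_blinfun" "psd x \<Longrightarrow> psd y \<Longrightarrow> psd (x + y)" "psd x \<Longrightarrow> r \<ge> 0 \<Longrightarrow> psd (r *\<^sub>R x)"
  by (auto simp: psd_def bl_simps)

lemma symm_conj:
  fixes x :: "'a::real_inner \<Rightarrow>\<^sub>L 'a" and v :: "'b::real_inner \<Rightarrow>\<^sub>L 'a"
  shows "symm x \<Longrightarrow> (\<And>f g. inner (v f) g = inner f (blinfun_apply v' g)) \<Longrightarrow> symm (v' o\<^sub>L x o\<^sub>L v)"
  by (simp add: symm_def) (metis inner_commute)

lemma psd_conj: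
  fixes x :: "'a::real_inner \<Rightarrow>\<^sub>L 'a" and v :: "'b::real_inner \<Rightarrow>\<^sub>L 'a"
  shows "psd x \<Longrightarrow> (\<And>f g. inner (v f) g = inner f (blinfun_apply v' g)) \<Longrightarrow> psd (v' o\<^sub>L x o\<^sub>L v)"
  unfolding psd_def using symm_conj[of x v v'] by simp (metis inner_commute)

lemma psd_square:
  fixes v :: "'b::real_inner \<Rightarrow>\<^sub>L 'a::real_inner"
  shows "(\<And>f g. inner (v f) g = inner f (blinfun_apply v' g)) \<Longrightarrow> psd (v' o\<^sub>L v)"
  unfolding psd_def symm_def by simp (metis inner_commute inner_ge_zero)

lemma psd_sum: "(\<And>i. i \<in> F \<Longrightarrow> psd (w i)) \<Longrightarrow> psd (sum w F)"
  by (induction F rule: infinite_finite_induct) auto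

lemma symm_limit:
  assumes "\<And>n. symm (X n)" "\<And>f. (\<lambda>n. blinfun_apply (X n) f) \<longlonglongrightarrow> blinfun_apply x f"
  shows "symm x"
  unfolding symm_def
proof (intro allI)
  fix f g
  have "(\<lambda>n. inner (X n f) g) \<longlonglongrightarrow> inner (x f) g" "(\<lambda>n. inner f (X n g)) \<longlonglongrightarrow> inner f (x g)"
    by (intro tendsto_inner assms(2) tendsto_const)+
  moreover have "(\<lambda>n. inner (X n f) g) = (\<lambda>n. inner f (X n g))" using assms(1) by (auto simp: symm_def)
  ultimately show "inner (x f) g = inner f (x g)" by (metis LIMSEQ_unique)
qed

lemma psd_limit:
  assumes "\<And>n. psd (X n)" "\<And>f. (\<lambda>n. blinfun_apply (X n) f) \<longlonglongrightarrow> blinfun_apply x f"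
  shows "psd x"
  unfolding psd_def
proof (intro conjI allI)
  show "symm x" by (rule symm_limit[OF psdD(1)[OF assms(1)] assms(2)])
  fix f
  have "(\<lambda>n. inner (X n f) f) \<longlonglongrightarrow> inner (x f) f"
    by (intro tendsto_inner assms(2) tendsto_const)
  then show "0 \<le> inner (x f) f" by (rule lim_ge) (rule psdD(2)[OF assms(1)])
qed

text \<open>The scalar core of the Cauchy-Schwarz inequalities for \<open>psd\<close> operators and
  for \<open>pfun\<close> functionals. The sign of \<open>C\<close> is not given: a large
  \<open>t\<close> excludes \<open>C < 0\<close>, and \<open>C = 0\<close> forces
  \<open>B = 0\<close>.\<close>

lemma discriminant_bound:
  fixes A B C :: real
  assumes "\<And>t. 0 \<le> A + 2 * t * B + t\<^sup>2 * C"
  shows "B\<^sup>2 \<le> A * C"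
proof (cases "C = 0")
  case True
  have "B = 0"
  proof (rule ccontr)
    assume "B \<noteq> 0"
    then show False using assms[of "- (A + 1) / (2 * B)"] assms[of 0] True by (simp add: field_simps)
  qed
  then show ?thesis using True by simp
next
  case False
  have "C \<ge> 0"
  proof (rule ccontr)
    assume "\<not> C \<ge> 0"
    then have C: "C < 0" by simp
    have A: "A \<ge> 0" using assms[of 0] by simp
    define t where "t = 1 + A / - C"
    have "0 \<le> (A + 2 * t * B + t\<^sup>2 * C) + (A + 2 * (-t) * B + (-t)\<^sup>2 * C)" using assms[of t] assms[of "-t"] by linarith
    then have "0 \<le> 2 * (A + t\<^sup>2 * C)" by (simp add: power2_eq_square algebra_simps)
    then have *: "0 \<le> A + t\<^sup>2 * C" by simp
    have t1: "t \<ge> 1" using A C unfolding t_def by (auto intro!: divide_nonneg_neg simp: divide_nonpos_neg divide_nonneg_neg)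
    have "t\<^sup>2 \<ge> t" using t1 by (simp add: power2_eq_square)
    then have "t\<^sup>2 * C \<le> t * C" using C by (intro mult_right_mono_neg) auto
    also have "\<dots> = C - A" using C by (simp add: t_def field_simps)
    finally show False using * C by simp
  qed
  then have C: "C > 0" using False by simp
  have "0 \<le> C * (A + 2 * (- B / C) * B + (- B / C)\<^sup>2 * C)" using assms[of "- B / C"] C by (intro mult_nonneg_nonneg) auto
  then show ?thesis using C by (simp add: power2_eq_square field_simps)
qed

lemma psd_cauchy_schwarz:
  assumes "psd x" shows "(inner (x f) g)\<^sup>2 \<le> inner (x f) f * inner (x g) g"
proof (rule discriminant_bound)
  fix t
  have "0 \<le> inner (x (f + t *\<^sub>R g)) (f + t *\<^sub>R g)" using assms by (simp add: psd_def)
  also have "\<dots> = inner (x f) f + 2 * t * inner (x f) g + t\<^sup>2 * inner (x g) g"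
    using psdD(1)[OF assms] symmD[of x g f] by (simp add: bl_simps power2_eq_square algebra_simps inner_commute)
  finally show "0 \<le> inner (x f) f + 2 * t * inner (x f) g + t\<^sup>2 * inner (x g) g" .
qed

text \<open>Cauchy-Schwarz for the form of \<open>x\<close> with \<open>g = x f\<close>; in operator
  terms, \<open>0 <= x <= c\<close> gives \<open>x^2 <= c x\<close>. It turns convergence of
  quadratic forms into strong convergence.\<close>

lemma psd_norm_square:
  assumes x: "psd x" and c: "\<And>f. inner (x f) f \<le> c * (norm f)\<^sup>2"
  shows "(norm (x f))\<^sup>2 \<le> c * inner (x f) f"
proof (cases "x f = 0")
  case False
  have "((norm (x f))\<^sup>2)\<^sup>2 \<le> inner (x f) f * inner (x (x f)) (x f)"
    using psd_cauchy_schwarz[OF x, of f "x f"] by (simp add: power2_norm_eq_inner)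
  also have "\<dots> \<le> inner (x f) f * (c * (norm (x f))\<^sup>2)" using x c by (intro mult_left_mono) (auto simp: psd_def)
  finally show ?thesis using False by (simp add: power2_eq_square ac_simps)
qed simp

lemma inner_blinfun_le: "inner (blinfun_apply x f) f \<le> norm x * (norm f)\<^sup>2" "\<bar>inner (blinfun_apply x f) f\<bar> \<le> norm x * (norm f)\<^sup>2"
proof -
  have "\<bar>inner (x f) f\<bar> \<le> norm (x f) * norm f" by (rule Cauchy_Schwarz_ineq2)
  also have "\<dots> \<le> norm x * norm f * norm f" by (intro mult_right_mono norm_blinfun) auto
  finally show "\<bar>inner (x f) f\<bar> \<le> norm x * (norm f)\<^sup>2" by (simp add: power2_eq_square ac_simps)
  then show "inner (x f) f \<le> norm x * (norm f)\<^sup>2" by linarith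
qed

text \<open>The resulting decomposition \<open>x = (||x|| + x) - ||x||\<close> serves throughout in
  place of positive and negative parts.\<close>

lemma psd_norm_minus:
  assumes "symm x"
  shows "psd (norm x *\<^sub>R id_blinfun - x)" "psd (norm x *\<^sub>R id_blinfun + x)"
proof -
  have *: "- (norm x * inner f f) \<le> inner (x f) f" "inner (x f) f \<le> norm x * inner f f" for f
    using inner_blinfun_le(2)[of x f] unfolding power2_norm_eq_inner by linarith+
  have "0 \<le> inner ((norm x *\<^sub>R id_blinfun - x) f) f" for f using *(2)[of f] by (simp add: bl_simps)
  then show "psd (norm x *\<^sub>R id_blinfun - x)" using assms by (intro psdI symm_intros)
  have "0 \<le> inner ((norm x *\<^sub>R id_blinfun + x) f) f" for f using *(1)[of f] by (simp add: bl_simps)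
  then show "psd (norm x *\<^sub>R id_blinfun + x)" using assms by (intro psdI symm_intros)
qed

lemma psd_norm_le:
  assumes x: "psd x" and c: "\<And>f. inner (x f) f \<le> c * (norm f)\<^sup>2" "0 \<le> c"
  shows "norm (x f) \<le> c * norm f"
proof -
  have "(norm (x f))\<^sup>2 \<le> c * (c * (norm f)\<^sup>2)"
    using psd_norm_square[OF x c(1), of f] mult_left_mono[OF c(1)[of f] c(2)] by linarith
  then have "(norm (x f))\<^sup>2 \<le> (c * norm f)\<^sup>2" by (simp add: power2_eq_square ac_simps)
  then show ?thesis using c(2) by (simp add: power2_le_iff_abs_le)
qed

lemma psd_le_one:
  assumes "psd x" "psd (id_blinfun - x)"
  shows "(norm (x f))\<^sup>2 \<le> inner (x f) f" "norm (x f) \<le> norm f"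
proof -
  have *: "inner (x f) f \<le> 1 * (norm f)\<^sup>2" for f
    using psdD(2)[OF assms(2), of f] by (simp add: bl_simps power2_norm_eq_inner)
  show "(norm (x f))\<^sup>2 \<le> inner (x f) f" using psd_norm_square[OF assms(1) *] by simp
  show "norm (x f) \<le> norm f" using psd_norm_le[OF assms(1) *] by simp
qed

lemma psd_eq_0: assumes "psd x" "\<And>f. inner (x f) f \<le> 0" shows "x = 0"
  using psd_norm_square[OF assms(1), of 0] assms(2) by (intro blinfun_eqI) auto

section \<open>Strong limits and monotone convergence of operators\<close>

lemma pointwise_limit_blinfun:
  fixes X :: "nat \<Rightarrow> 'a::real_normed_vector \<Rightarrow>\<^sub>L 'b::banach"
  assumes c: "\<And>f. Cauchy (\<lambda>n. X n f)" and B: "\<And>n f. norm (X n f) \<le> B * norm f"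
  shows "\<exists>x :: 'a \<Rightarrow>\<^sub>L 'b. \<forall>f. (\<lambda>n. X n f) \<longlonglongrightarrow> x f"
proof -
  define g where "g f = lim (\<lambda>n. X n f)" for f
  have g: "(\<lambda>n. X n f) \<longlonglongrightarrow> g f" for f
    unfolding g_def using c[of f] by (simp add: Cauchy_convergent_iff convergent_LIMSEQ_iff)
  have "bounded_linear g"
  proof (rule bounded_linear_intro[where K=B])
    fix f h r
    have "(\<lambda>n. X n f + X n h) \<longlonglongrightarrow> g f + g h" by (intro tendsto_add g)
    moreover have "(\<lambda>n. X n f + X n h) \<longlonglongrightarrow> g (f + h)" using g[of "f+h"] by (simp add: blinfun.add_right)
    ultimately show "g (f + h) = g f + g h" using LIMSEQ_unique by blast
    have "(\<lambda>n. r *\<^sub>R X n f) \<longlonglongrightarrow> r *\<^sub>R g f" by (intro tendsto_intros g)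
    moreover have "(\<lambda>n. r *\<^sub>R X n f) \<longlonglongrightarrow> g (r *\<^sub>R f)" using g[of "r *\<^sub>R f"] by (simp add: blinfun.scaleR_right)
    ultimately show "g (r *\<^sub>R f) = r *\<^sub>R g f" using LIMSEQ_unique by blast
    show "norm (g f) \<le> norm f * B"
      using tendsto_norm[OF g] B by (intro LIMSEQ_le_const2[of "\<lambda>n. norm (X n f)"]) (auto simp: mult.commute)
  qed
  then have "(\<lambda>n. X n f) \<longlonglongrightarrow> Blinfun g f" for f using g by (simp add: bounded_linear_Blinfun_apply)
  then show ?thesis by blast
qed

lemma psd_increasing:
  assumes "\<And>n. psd (X (Suc n) - X n)" "m \<le> n" shows "psd (X n - X m)"
  using assms(2)
proof (induction n rule: dec_induct)
  case (step n)
  have "X (Suc n) - X m = (X (Suc n) - X n) + (X n - X m)" by simp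
  then show ?case using step assms(1) by (metis psd_intros(3))
qed simp

lemma psd_increasing_limit:
  assumes inc: "\<And>n. psd (X (Suc n) - X n)" and lim: "\<And>f. (\<lambda>n. blinfun_apply (X n) f) \<longlonglongrightarrow> blinfun_apply z f"
  shows "psd (z - X n)"
proof (rule psd_limit[of "\<lambda>m. X (m + n) - X n"])
  show "psd (X (m + n) - X n)" for m by (rule psd_increasing[of X, OF inc]) simp
  show "(\<lambda>m. (X (m + n) - X n) f) \<longlonglongrightarrow> (z - X n) f" for f
    unfolding blinfun.diff_left by (intro tendsto_diff tendsto_const LIMSEQ_ignore_initial_segment[OF lim])
qed

text \<open>For \<open>m <= n\<close> the difference \<open>D = X n - X m\<close> satisfies
  \<open>0 <= D <= C\<close>, so \<open>||D f||^2 <= C <D f, f>\<close>; the bounded monotone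
  sequence \<open><X n f, f>\<close> converges, hence \<open>X n f\<close> is Cauchy.\<close>

lemma monotone_convergence_op:
  fixes X :: "nat \<Rightarrow> 'a::{real_inner,banach} \<Rightarrow>\<^sub>L 'a"
  assumes s: "\<And>n. symm (X n)" and inc: "\<And>n. psd (X (Suc n) - X n)"
    and c: "\<And>n f. inner (X n f) f \<le> c * (norm f)\<^sup>2"
  obtains x where "\<And>f. (\<lambda>n. X n f) \<longlonglongrightarrow> blinfun_apply x f" "symm x"
    "\<And>n. psd (x - X n)" "\<And>f. inner (x f) f \<le> c * (norm f)\<^sup>2"
proof -
  define C where "C = \<bar>c\<bar> + norm (X 0)"
  have inc': "psd (X n - X m)" if "m \<le> n" for m n using psd_increasing[of X, OF inc that] .
  have low: "inner (X n f) f \<ge> - norm (X 0) * (norm f)\<^sup>2" for n f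
    using psdD(2)[OF inc'[of 0 n], of f] inner_blinfun_le(2)[of "X 0" f] by (simp add: bl_simps)
  have CB: "inner ((X n - X m) f) f \<le> C * (norm f)\<^sup>2" for n m f
  proof -
    have "c * (norm f)\<^sup>2 \<le> \<bar>c\<bar> * (norm f)\<^sup>2" by (intro mult_right_mono) auto
    then show ?thesis using low[of f m] c[of n f] by (simp add: bl_simps C_def algebra_simps)
  qed
  have C0: "C \<ge> 0" by (simp add: C_def)
  have nb: "(norm (X n f - X m f))\<^sup>2 \<le> C * (inner (X n f) f - inner (X m f) f)" if "m \<le> n" for m n f
    using psd_norm_square[OF inc'[OF that] CB, of f] by (simp add: bl_simps)
  have bnd: "norm (X n f) \<le> (C + norm (X 0)) * norm f" for n f
  proof -
    have "norm (X n f - X 0 f) \<le> C * norm f" using psd_norm_le[OF inc'[of 0 n] CB C0, of f] by (simp add: bl_simps)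
    moreover have "norm (X n f) \<le> norm (X n f - X 0 f) + norm (X 0 f)" by (metis diff_add_cancel norm_triangle_ineq)
    ultimately show ?thesis using norm_blinfun[of "X 0" f] by (simp add: algebra_simps)
  qed
  have cau: "Cauchy (\<lambda>n. X n f)" for f
  proof -
    have "incseq (\<lambda>n. inner (X n f) f)"
      using psdD(2)[OF inc] by (intro incseq_SucI) (simp add: bl_simps)
    then have "Cauchy (\<lambda>n. inner (X n f) f)"
      using c[of _ f] by (metis incseq_convergent LIMSEQ_imp_Cauchy)
    show ?thesis
    proof (rule metric_CauchyI)
      fix e :: real assume e: "e > 0"
      then have "e\<^sup>2 / (C + 1) > 0" using C0 by simp
      then obtain N where N: "\<And>m n. m \<ge> N \<Longrightarrow> n \<ge> N \<Longrightarrow> \<bar>inner (X n f) f - inner (X m f) f\<bar> < e\<^sup>2 / (C + 1)"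
        using metric_CauchyD[OF \<open>Cauchy (\<lambda>n. inner (X n f) f)\<close>] by (metis dist_real_def)
      have *: "norm (X n f - X m f) < e" if "m \<ge> N" "m \<le> n" for m n
      proof -
        have "C * (inner (X n f) f - inner (X m f) f) \<le> C * (e\<^sup>2 / (C + 1))"
          using N[of m n] that C0 by (intro mult_left_mono) auto
        also have "\<dots> < e\<^sup>2" using C0 e by (simp add: field_simps)
        finally have "(norm (X n f - X m f))\<^sup>2 < e\<^sup>2" using nb[OF that(2), of f] by linarith
        then show ?thesis using e by (simp add: power2_less_imp_less)
      qed
      have "dist (X m f) (X n f) < e" if "m \<ge> N" "n \<ge> N" for m n
        using *[of m n] *[of n m] that by (cases "m \<le> n") (auto simp: dist_norm norm_minus_commute)
      then show "\<exists>M. \<forall>m\<ge>M. \<forall>n\<ge>M. dist (X m f) (X n f) < e" by blast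
    qed
  qed
  obtain x where x: "\<And>f. (\<lambda>n. X n f) \<longlonglongrightarrow> blinfun_apply x f" using pointwise_limit_blinfun[of X, OF cau bnd] by metis
  have "psd (x - X n)" for n by (rule psd_increasing_limit[of X, OF inc x])
  moreover have "inner (x f) f \<le> c * (norm f)\<^sup>2" for f
    by (rule LIMSEQ_le_const2[of "\<lambda>n. inner (X n f) f"]) (use c in \<open>auto intro!: tendsto_inner x\<close>)
  ultimately show ?thesis using that[of x] x symm_limit[OF s x] by blast
qed

text \<open>The product of two commuting positive operators is positive: normalise \<open>x \<le> 1\<close> and
  put $x_0 = x$, $x_{k+1} = x_k - x_k^2$. Then all $0 \le x_k \le 1$, and $x = \sum_k x_k^2$ strongly.\<close>

lemma psd_commuting_product:
  fixes x z :: "'a::{real_inner,banach} \<Rightarrow>\<^sub>L 'a"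
  assumes x: "psd x" and z: "psd z" and com: "x o\<^sub>L z = z o\<^sub>L x"
  shows "0 \<le> inner (x (z f)) f"
proof -
  have main: "0 \<le> inner (x (z f)) f" if x: "psd x" and x1: "psd (id_blinfun - x)" and com: "x o\<^sub>L z = z o\<^sub>L x"
    for x
  proof -
    define X where "X = rec_nat x (\<lambda>_ y. y - (y o\<^sub>L y))"
    have X0: "X 0 = x" and XS: "X (Suc n) = X n - (X n o\<^sub>L X n)" for n by (auto simp: X_def)
    have X: "psd (X n) \<and> psd (id_blinfun - X n) \<and> (\<forall>f. X n (z f) = z (X n f))" for n
    proof (induction n)
      case 0
      then show ?case using x x1 com by (metis X0 blinfun_apply_blinfun_compose)
    next
      case (Suc n)
      let ?x = "X n" let ?y = "id_blinfun - X n"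
      have "symm ?x" "symm ?y" using Suc by (auto simp: psd_def)
      then have sx: "\<And>f g. inner (?x f) g = inner f (?x g)" and sy: "\<And>f g. inner (?y f) g = inner f (?y g)"
        unfolding symm_def by blast+
      have "psd ((?x o\<^sub>L ?y) o\<^sub>L ?x)" "psd ((?y o\<^sub>L ?x) o\<^sub>L ?y)" "psd (?x o\<^sub>L ?x)"
        using Suc psd_conj[OF _ sx] psd_conj[OF _ sy] psd_square[OF sx] by blast+
      \<comment> \<open>\<open>x - x^2 = x (1 - x) x + (1 - x) x (1 - x)\<close> and
        \<open>1 - (x - x^2) = (1 - x) + x^2\<close> keep the sequence between 0 and 1.\<close>
      moreover have "X (Suc n) = ((?x o\<^sub>L ?y) o\<^sub>L ?x) + ((?y o\<^sub>L ?x) o\<^sub>L ?y)"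
        by (intro blinfun_eqI) (simp add: XS bl_simps algebra_simps)
      moreover have "id_blinfun - X (Suc n) = ?y + (?x o\<^sub>L ?x)"
        by (intro blinfun_eqI) (simp add: XS bl_simps algebra_simps)
      moreover have "X (Suc n) (z f) = z (X (Suc n) f)" for f
        using Suc by (simp add: XS bl_simps)
      ultimately show ?case using Suc psd_intros(3) by (metis (no_types, lifting))
    qed
    have sum: "(\<Sum>k<n. X k (X k f)) = x f - X n f" for n f
      by (induction n) (simp_all add: X0 XS bl_simps)
    have lim: "(\<lambda>n. X n f) \<longlonglongrightarrow> 0" for f
    proof -
      have "(\<Sum>k<n. (norm (X k f))\<^sup>2) \<le> inner (x f) f" for n
      proof -
        have "(\<Sum>k<n. (norm (X k f))\<^sup>2) = inner (\<Sum>k<n. X k (X k f)) f"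
          unfolding inner_sum_left using X by (intro sum.cong) (auto simp: power2_norm_eq_inner psd_def symm_def)
        also have "\<dots> \<le> inner (x f) f" unfolding sum using X by (simp add: bl_simps psd_def)
        finally show ?thesis .
      qed
      then have "summable (\<lambda>k. (norm (X k f))\<^sup>2)" by (intro summableI_nonneg_bounded) auto
      then have "(\<lambda>k. (norm (X k f))\<^sup>2) \<longlonglongrightarrow> 0" by (rule summable_LIMSEQ_zero)
      then have "(\<lambda>k. norm (X k f)) \<longlonglongrightarrow> 0" using tendsto_real_sqrt[of "\<lambda>k. (norm (X k f))\<^sup>2" 0] by simp
      then show ?thesis by (rule tendsto_norm_zero_cancel)
    qed
    have "(\<lambda>n. inner (x (z f) - X n (z f)) f) \<longlonglongrightarrow> inner (x (z f) - 0) f"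
      by (intro tendsto_intros lim)
    moreover have "0 \<le> inner (x (z f) - X n (z f)) f" for n
    proof -
      have "inner (x (z f) - X n (z f)) f = (\<Sum>k<n. inner (z (X k f)) (X k f))"
        unfolding sum[symmetric] inner_sum_left using X by (intro sum.cong) (metis psd_def symm_def refl)+
      also have "\<dots> \<ge> 0" using z by (intro sum_nonneg) (auto simp: psd_def)
      finally show ?thesis .
    qed
    ultimately have "0 \<le> inner (x (z f) - 0) f" by (rule lim_ge)
    then show ?thesis by simp
  qed
  define c where "c = norm x + 1"
  have c: "c > 0" unfolding c_def by (smt (verit) norm_ge_zero)
  have "0 \<le> inner (((1/c) *\<^sub>R x) (z f)) f"
  proof (rule main)
    have "id_blinfun - (1/c) *\<^sub>R x = (1/c) *\<^sub>R ((norm x *\<^sub>R id_blinfun - x) + id_blinfun)"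
      using c by (intro blinfun_eqI) (simp add: bl_simps c_def field_simps flip: scaleR_add_left scaleR_add_right)
    then show "psd (id_blinfun - (1/c) *\<^sub>R x)" using psd_norm_minus[OF psdD(1)[OF x]] c by simp
    have "x (z f) = z (x f)" for f using com by (metis blinfun_apply_blinfun_compose)
    then show "((1/c) *\<^sub>R x) o\<^sub>L z = z o\<^sub>L ((1/c) *\<^sub>R x)" by (intro blinfun_eqI) (simp add: bl_simps)
  qed (use x c in auto)
  then show ?thesis using c by (simp add: bl_simps zero_le_divide_iff)
qed

section \<open>Resolvents of positive operators\<close>

lemma resolvent_equation:
  fixes Y :: "'a::{real_inner,banach} \<Rightarrow>\<^sub>L 'a"
  assumes Y: "psd Y" and S: "closed S" "subspace S" "\<And>f. f \<in> S \<Longrightarrow> Y f \<in> S" and f: "f \<in> S"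
  shows "\<exists>g\<in>S. g + Y g = f"
proof -
  define c where "c = norm Y"
  have c: "c \<ge> 0" by (simp add: c_def)
  define T where "T = c *\<^sub>R id_blinfun - Y"
  have T: "psd T" unfolding T_def c_def using Y by (intro psd_norm_minus psdD)
  have Tc: "norm (T g) \<le> c * norm g" for g
  proof (rule psd_norm_le[OF T _ c])
    show "inner (T g) g \<le> c * (norm g)\<^sup>2" for g
      using psdD(2)[OF Y, of g] by (simp add: T_def bl_simps power2_norm_eq_inner)
  qed
  \<comment> \<open>\<open>g + Y g = f\<close> is the fixed point equation of \<open>F\<close>.
    Since \<open>0 <= c - Y <= c\<close>, \<open>F\<close> contracts with factor
    \<open>c / (1 + c)\<close> for every size of \<open>Y\<close>. It maps \<open>S\<close> to
    itself, so resolvents respect closed invariant subspaces.\<close>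
  define F where "F g = (1 / (1 + c)) *\<^sub>R (f + T g)" for g
  have "\<exists>!g\<in>S. F g = g"
  proof (rule Banach_fix)
    show "complete S" using S(1) by (simp add: complete_eq_closed)
    show "S \<noteq> {}" using f by auto
    show "0 \<le> c / (1 + c)" "c / (1 + c) < 1" using c by auto
    show "F ` S \<subseteq> S" using S f by (auto simp: F_def T_def bl_simps intro!: subspace_scale subspace_add subspace_diff)
    show "dist (F x) (F y) \<le> c / (1 + c) * dist x y" if "x \<in> S" "y \<in> S" for x y
    proof -
      have "F x - F y = (1 / (1 + c)) *\<^sub>R T (x - y)" by (simp add: F_def bl_simps scaleR_diff_right[symmetric])
      then have "norm (F x - F y) = (1 / (1 + c)) * norm (T (x - y))" using c by simp
      also have "\<dots> \<le> (1 / (1 + c)) * (c * norm (x - y))" using c Tc by (intro mult_left_mono) auto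
      finally show ?thesis by (simp add: dist_norm)
    qed
  qed
  then obtain g where g: "g \<in> S" "F g = g" by blast
  have "(1 + c) *\<^sub>R g = (1 + c) *\<^sub>R F g" using g(2) by simp
  also have "\<dots> = f + T g" using c by (simp add: F_def)
  finally have "(1 + c) *\<^sub>R g = f + T g" .
  then have "g + Y g = f" by (simp add: T_def bl_simps algebra_simps)
  then show ?thesis using g by blast
qed

lemma resolvent_unique:
  assumes "psd Y" "g + Y g = h + Y h" shows "g = h"
proof -
  have "(g - h) + Y (g - h) = 0" using assms(2) by (simp add: bl_simps algebra_simps)
  then have "inner (g - h) (g - h) + inner (Y (g - h)) (g - h) = 0" by (metis inner_add_left inner_zero_left)
  then have "inner (g - h) (g - h) = 0" using psdD(2)[OF assms(1), of "g - h"] by (smt (verit) inner_ge_zero)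
  then show ?thesis by simp
qed

lemma resolvent:
  fixes Y :: "'a::{real_inner,banach} \<Rightarrow>\<^sub>L 'a"
  assumes Y: "psd Y"
  obtains s where "psd s" "psd (id_blinfun - s)" "\<And>f. s f + Y (s f) = f" "\<And>f. s (f + Y f) = f"
proof -
  have "\<exists>g. g + Y g = f" for f using resolvent_equation[OF Y, of UNIV f] by auto
  then obtain s where s: "\<And>f. s f + Y (s f) = f" by metis
  have u: "s f = g" if "g + Y g = f" for f g using resolvent_unique[OF Y] s that by metis
  have nb: "norm (s f) \<le> norm f * 1" for f
  proof -
    have "(norm (s f))\<^sup>2 \<le> inner (s f + Y (s f)) (s f)" using psdD(2)[OF Y, of "s f"] by (simp add: bl_simps power2_norm_eq_inner)
    also have "\<dots> \<le> norm f * norm (s f)" unfolding s by (rule norm_cauchy_schwarz)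
    finally show ?thesis by (cases "s f = 0") (auto simp: power2_eq_square)
  qed
  have bl: "bounded_linear s"
  proof (rule bounded_linear_intro[OF _ _ nb])
    show "s (x + y) = s x + s y" for x y
      by (rule u) (use s[of x] s[of y] in \<open>simp add: bl_simps algebra_simps\<close>)
    show "s (r *\<^sub>R x) = r *\<^sub>R s x" for r x
      by (rule u) (use s[of x] in \<open>simp add: bl_simps flip: scaleR_add_right\<close>)
  qed
  define S where "S = Blinfun s"
  have S: "blinfun_apply S = s" using bl by (simp add: S_def bounded_linear_Blinfun_apply)
  have sy: "inner (s f) g = inner f (s g)" for f g
  proof -
    have "inner (s f) g = inner (s f) (s g + Y (s g))" by (simp add: s)
    also have "\<dots> = inner (s f + Y (s f)) (s g)" using symmD[OF psdD(1)[OF Y]] by (simp add: bl_simps)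
    finally show ?thesis by (simp add: s)
  qed
  have ps: "psd S" unfolding psd_def symm_def S
  proof (intro conjI allI sy)
    fix f
    have "inner (s f) (s f + Y (s f)) = inner (s f) (s f) + inner (Y (s f)) (s f)" by (simp add: bl_simps inner_commute)
    then show "0 \<le> inner (s f) f" using psdD(2)[OF Y, of "s f"] by (simp add: s)
  qed
  have le: "inner (s f) f \<le> 1 * (norm f)\<^sup>2" for f
    using norm_cauchy_schwarz[of "s f" f] mult_right_mono[OF nb[of f] norm_ge_zero[of f]] by (simp add: power2_eq_square)
  have "psd (id_blinfun - S)" using ps le unfolding psd_def by (auto simp: bl_simps S power2_norm_eq_inner)
  moreover have "S (f + Y f) = f" for f unfolding S by (rule u) simp
  ultimately show ?thesis using that[of S] ps s by (simp add: S)
qed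

section \<open>Countably additive functionals on an operator algebra\<close>

lemmas op_tendsto = bounded_linear.tendsto[OF blinfun.bounded_linear_right]

lemma lim_close: "X \<longlonglongrightarrow> x \<Longrightarrow> 0 < e \<Longrightarrow> \<exists>m. \<forall>n\<ge>m. \<bar>X n - x\<bar> < e" for x :: real
  by (simp add: LIMSEQ_iff)

text \<open>Expand \<open><(1 + Y)(g - h), g - h> >= 0\<close> for \<open>g = s f\<close>,
  \<open>h = s' f\<close>, and replace \<open>Y\<close> by the larger \<open>Y'\<close> in the last
  term. \<open>Y\<close> and \<open>Y'\<close> may fail to commute.\<close>

lemma resolvent_antimono:
  fixes Y :: "'a::{real_inner,banach} \<Rightarrow>\<^sub>L 'a"
  assumes Y: "psd Y" and YY: "psd (Y' - Y)"
    and s: "\<And>f. s f + Y (s f) = f" and s': "\<And>f. s' f + Y' (s' f) = f"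
  shows "inner (s' f) f \<le> inner (s f) f"
proof -
  define g where "g = s f" define h where "h = s' f"
  have g: "f = g + Y g" and h: "f = h + Y' h" using s s' by (simp_all add: g_def h_def)
  have sY: "inner (Y g) h = inner g (Y h)" using Y by (simp add: psd_def symm_def)
  have "0 \<le> inner (g - h) (g - h) + inner (Y (g - h)) (g - h)" using psdD(2)[OF Y] by simp
  also have "\<dots> = inner (g + Y g) g - 2 * inner (g + Y g) h + inner (h + Y h) h"
    using sY by (simp add: bl_simps inner_commute)
  finally have "2 * inner f h \<le> inner f g + inner (h + Y h) h" by (simp flip: g)
  moreover have "inner (h + Y h) h \<le> inner (h + Y' h) h" using psdD(2)[OF YY, of h] by (simp add: bl_simps)
  ultimately have "2 * inner f h \<le> inner f g + inner f h" by (simp flip: h)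
  then show ?thesis by (simp add: g_def h_def inner_commute)
qed

text \<open>Functional calculus would read \<open>t / (1 + t)^2 <= 1\<close> and
  \<open>t / (1 + t) <= t\<close>. The first bounds sums compressed by cutoffs, the second shows
  that a resolvent is close to 1 on vectors where \<open>Y\<close> is small.\<close>

lemma resolvent_bounds:
  fixes Y :: "'a::{real_inner,banach} \<Rightarrow>\<^sub>L 'a"
  assumes Y: "psd Y" and s: "psd s" "\<And>f. s f + Y (s f) = f" "\<And>f. s (f + Y f) = f"
  shows "inner (Y (s f)) (s f) \<le> (norm f)\<^sup>2" "inner (f - s f) f \<le> inner (Y f) f"
proof -
  have Yg: "Y (s f) = f - s f" using s(2)[of f] by (simp add: algebra_simps)
  have "0 \<le> inner (s f) (s f) + inner (f - s f) (f - s f)" by simp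
  moreover have "0 \<le> inner (Y (s f)) (s f)" using Y by (simp add: psd_def)
  ultimately show "inner (Y (s f)) (s f) \<le> (norm f)\<^sup>2"
    unfolding Yg by (simp add: bl_simps power2_norm_eq_inner inner_commute)
  have com: "s (Y f) = Y (s f)" using s(2)[of f] s(3)[of f] by (metis add_left_imp_eq blinfun.add_right)
  have "0 \<le> inner (s (Y f)) (Y f)" using s(1) by (simp add: psd_def)
  also have "\<dots> = inner (Y (s (Y f))) f" using Y by (simp add: psd_def symm_def)
  also have "Y (s (Y f)) = Y f - (f - s f)" using s(2)[of "Y f"] by (simp add: com Yg algebra_simps)
  finally show "inner (f - s f) f \<le> inner (Y f) f" by (simp add: bl_simps)
qed

text \<open>Abstracts the commutant acting on the state vector. \<open>sep\<close> weakens the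
  notion of a separating vector to vanishing on the orbit of \<open>Om\<close>. \<open>psi\<close>
  is linear on symmetric elements, depends only on \<open>x Om\<close> and is continuous along
  increasing sequences; it plays the part of a signed measure that vanishes on null sets.\<close>

locale operator_state =
  fixes A :: "('k::{real_inner,banach} \<Rightarrow>\<^sub>L 'k) set" and Om :: 'k and psi :: "('k \<Rightarrow>\<^sub>L 'k) \<Rightarrow> real"
  assumes A_id: "id_blinfun \<in> A"
    and A_add: "x \<in> A \<Longrightarrow> y \<in> A \<Longrightarrow> x + y \<in> A"
    and A_scale: "x \<in> A \<Longrightarrow> r *\<^sub>R x \<in> A"
    and A_comp: "x \<in> A \<Longrightarrow> y \<in> A \<Longrightarrow> x o\<^sub>L y \<in> A"
    and A_lim: "(\<And>n. X n \<in> A) \<Longrightarrow> (\<And>f. (\<lambda>n. blinfun_apply (X n) f) \<longlonglongrightarrow> blinfun_apply z f) \<Longrightarrow> z \<in> A"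
    and A_res: "y \<in> A \<Longrightarrow> psd y \<Longrightarrow> (\<And>f. blinfun_apply s f + y (s f) = f) \<Longrightarrow> s \<in> A"
    and sep: "y \<in> A \<Longrightarrow> x \<in> A \<Longrightarrow> y Om = 0 \<Longrightarrow> y (x Om) = 0"
    and norm_Om: "norm Om \<le> 1"
    and psi_add: "x \<in> A \<Longrightarrow> symm x \<Longrightarrow> y \<in> A \<Longrightarrow> symm y \<Longrightarrow> psi (x + y) = psi x + psi y"
    and psi_scale: "x \<in> A \<Longrightarrow> symm x \<Longrightarrow> psi (r *\<^sub>R x) = r * psi x"
    and psi_zero: "x \<in> A \<Longrightarrow> symm x \<Longrightarrow> x Om = 0 \<Longrightarrow> psi x = 0"
    and psi_mono: "(\<And>n. X n \<in> A) \<Longrightarrow> (\<And>n. symm (X n)) \<Longrightarrow> (\<And>n. psd (X (Suc n) - X n)) \<Longrightarrow> z \<in> A \<Longrightarrow>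
      (\<And>f. (\<lambda>n. blinfun_apply (X n) f) \<longlonglongrightarrow> blinfun_apply z f) \<Longrightarrow> (\<lambda>n. psi (X n)) \<longlonglongrightarrow> psi z"
begin

lemma A_minus: "x \<in> A \<Longrightarrow> - x \<in> A"
  using A_scale[of x "-1"] by simp

lemma A_diff: "x \<in> A \<Longrightarrow> y \<in> A \<Longrightarrow> x - y \<in> A"
  using A_add[of x "- y"] A_minus by simp

lemma A_0: "0 \<in> A"
  using A_scale[OF A_id, of 0] by simp

lemma A_sum: "(\<And>i. i \<in> F \<Longrightarrow> w i \<in> A) \<Longrightarrow> sum w F \<in> A"
  by (induction F rule: infinite_finite_induct) (auto simp: A_0 A_add)

lemmas A_intros = A_id A_add A_scale A_comp A_minus A_diff

lemma psi_diff: "x \<in> A \<Longrightarrow> symm x \<Longrightarrow> y \<in> A \<Longrightarrow> symm y \<Longrightarrow> psi (x - y) = psi x - psi y"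
  using psi_add[of x "(-1) *\<^sub>R y"] psi_scale[of y "-1"] A_scale[of y "-1"] symm_intros(5)[of y "-1"] by simp

lemma psi_eq: "x \<in> A \<Longrightarrow> symm x \<Longrightarrow> y \<in> A \<Longrightarrow> symm y \<Longrightarrow> x Om = y Om \<Longrightarrow> psi x = psi y"
  using psi_diff[of x y] psi_zero[of "x - y"] by (simp add: A_diff bl_simps)

text \<open>Countable additivity: the partial sums increase to a limit in \<open>A\<close>, so the
  values of \<open>psi\<close> on them converge and the increments tend to 0. Both humps end in this
  lemma.\<close>

lemma psi_tendsto_0:
  assumes w: "\<And>k. w k \<in> A" "\<And>k. psd (w k)" and C: "\<And>m f. (\<Sum>k<m. inner (w k f) f) \<le> C * (norm f)\<^sup>2"
  shows "(\<lambda>k. psi (w k)) \<longlonglongrightarrow> 0"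
proof -
  define X where "X m = (\<Sum>k<m. w k)" for m :: nat
  have XA: "X m \<in> A" "psd (X m)" for m unfolding X_def using w by (auto intro!: A_sum psd_sum)
  have inc: "psd (X (Suc m) - X m)" for m using w by (simp add: X_def)
  have bd: "inner (X m f) f \<le> C * (norm f)\<^sup>2" for m f
    using C[where m=m and f=f] by (simp add: X_def blinfun.sum_left inner_sum_left)
  obtain x where x: "\<And>f. (\<lambda>n. X n f) \<longlonglongrightarrow> blinfun_apply x f"
    using monotone_convergence_op[of X C, OF psdD(1)[OF XA(2)] inc bd] by metis
  have "(\<lambda>n. psi (X n)) \<longlonglongrightarrow> psi x" by (rule psi_mono[OF XA(1) psdD(1)[OF XA(2)] inc A_lim[OF XA(1) x] x])
  then have "(\<lambda>n. psi (X (Suc n)) - psi (X n)) \<longlonglongrightarrow> psi x - psi x" by (intro tendsto_diff LIMSEQ_Suc)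
  moreover have "psi (X (Suc n)) - psi (X n) = psi (w n)" for n
    using psi_diff[OF XA(1) psdD(1)[OF XA(2)] XA(1) psdD(1)[OF XA(2)], of "Suc n" n] by (simp add: X_def)
  ultimately show ?thesis by simp
qed

end

section \<open>The gliding hump along a sequence of operators that is small at
  \<open>Om\<close>\<close>

locale hump = operator_state A Om psi
  for A :: "('k::{real_inner,banach} \<Rightarrow>\<^sub>L 'k) set" and Om psi +
  fixes y :: "nat \<Rightarrow> 'k \<Rightarrow>\<^sub>L 'k"
  assumes yA: "y n \<in> A" and y0: "psd (y n)" and y1: "psd (id_blinfun - y n)"
    and yOm: "inner (y n Om) Om \<le> (1/2) ^ n"
begin

text \<open>\<open>S N\<close> is the strong limit of $(1 + \sum_{N \le n < K} y_n)^{-1}$. It makes the tail of \<open>y\<close> summable,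
  which the \<open>y n\<close> themselves need not be.\<close>

lemma cutoffs:
  obtains S T where "\<And>N. S N \<in> A" "\<And>N. psd (S N)" "\<And>N. psd (id_blinfun - S N)"
    "\<And>M N. M \<le> N \<Longrightarrow> psd (S N - S M)" "T \<in> A" "symm T"
    "\<And>f. (\<lambda>N. blinfun_apply (S N) f) \<longlonglongrightarrow> blinfun_apply T f" "T Om = Om"
    "\<And>F N f. finite F \<Longrightarrow> F \<subseteq> {N..} \<Longrightarrow> (\<Sum>n\<in>F. inner (y n (S N f)) (S N f)) \<le> (norm f)\<^sup>2"
proof -
  define Y where "Y N K = (\<Sum>n\<in>{N..<K}. y n)" for N K
  have YA: "Y N K \<in> A" and Yp: "psd (Y N K)" for N K
    unfolding Y_def using yA y0 by (auto intro: A_sum psd_sum)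
  have "\<exists>s. psd s \<and> psd (id_blinfun - s) \<and> (\<forall>f. s f + Y N K (s f) = f) \<and> (\<forall>f. s (f + Y N K f) = f)" for N K
    using resolvent[OF Yp[of N K]] by metis
  then obtain s where s: "\<And>N K. psd (s N K)" "\<And>N K. psd (id_blinfun - s N K)"
    "\<And>N K f. s N K f + Y N K (s N K f) = f" "\<And>N K f. s N K (f + Y N K f) = f" by metis
  have sA: "s N K \<in> A" for N K using A_res[OF YA Yp s(3)] .
  have Ydiff: "psd (Y N' K' - Y N K)" if "N' \<le> N" "K \<le> K'" for N K N' K'
  proof -
    have "Y N' K' - Y N K = (\<Sum>n\<in>{N'..<K'} - {N..<K}. y n)"
      unfolding Y_def using that by (intro sum_diff[symmetric]) auto
    then show ?thesis using y0 by (simp add: psd_sum)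
  qed
  have anti: "psd (s N K - s N' K')" if "N' \<le> N" "K \<le> K'" for N K N' K'
    using resolvent_antimono[of "Y N K" "Y N' K'", OF Yp Ydiff[OF that] s(3) s(3)] s(1)
    by (intro psdI symm_intros) (auto simp: bl_simps psd_def)
  have "\<exists>z. (\<forall>f. (\<lambda>K. s N K f) \<longlonglongrightarrow> blinfun_apply z f)" for N
  proof -
    \<comment> \<open>The resolvents decrease in \<open>K\<close>, so monotone convergence is
      applied to their negatives.\<close>
    define X where "X K = - s N K" for K
    have "\<exists>z. \<forall>f. (\<lambda>K. X K f) \<longlonglongrightarrow> blinfun_apply z f"
    proof (rule monotone_convergence_op[of X 0])
      show "symm (X K)" for K using s(1) by (simp add: X_def psd_def)
      show "psd (X (Suc K) - X K)" for K using anti[of N N K "Suc K"] by (simp add: X_def)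
      show "inner (X K f) f \<le> 0 * (norm f)\<^sup>2" for K f using s(1) by (simp add: X_def bl_simps psd_def)
    qed blast
    then obtain z where z: "\<And>f. (\<lambda>K. X K f) \<longlonglongrightarrow> blinfun_apply z f" by blast
    have "(\<lambda>K. s N K f) \<longlonglongrightarrow> (- z) f" for f
      using tendsto_minus[OF z[of f]] by (simp add: X_def bl_simps)
    then show ?thesis by blast
  qed
  then obtain S where S: "\<And>N f. (\<lambda>K. s N K f) \<longlonglongrightarrow> blinfun_apply (S N) f" by metis
  have SA: "S N \<in> A" for N using A_lim[OF sA S] .
  have Sp: "psd (S N)" for N using psd_limit[of "s N", OF s(1) S] .
  have S1: "psd (id_blinfun - S N)" for N
    by (rule psd_limit[of "\<lambda>K. id_blinfun - s N K", OF s(2)])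
      (unfold blinfun.diff_left, intro tendsto_diff tendsto_const S)
  have Sinc: "psd (S N - S M)" if "M \<le> N" for M N
    by (rule psd_limit[of "\<lambda>K. s N K - s M K", OF anti[OF that order_refl]])
      (unfold blinfun.diff_left, intro tendsto_diff S)
  have "inner (S N f) f \<le> 1 * (norm f)\<^sup>2" for N f
    using psdD(2)[OF S1[of N], of f] by (simp add: bl_simps power2_norm_eq_inner)
  then obtain T where T: "\<And>f. (\<lambda>N. S N f) \<longlonglongrightarrow> blinfun_apply T f" "symm T"
    using monotone_convergence_op[of S 1, OF psdD(1)[OF Sp] Sinc] by (metis lessI less_imp_le)
  have TA: "T \<in> A" using A_lim[OF SA T(1)] .
  have T1: "psd (id_blinfun - T)"
    by (rule psd_limit[of "\<lambda>K. id_blinfun - S K", OF S1])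
      (unfold blinfun.diff_left, intro tendsto_diff tendsto_const T)
  \<comment> \<open>The second resolvent bound and the tail of the geometric series; the estimate is
    uniform in \<open>K\<close> and survives the limit.\<close>
  have sOm: "inner (Om - s N K Om) Om \<le> 2 * (1/2) ^ N" for N K
  proof -
    have "inner (Om - s N K Om) Om \<le> inner (Y N K Om) Om"
      using resolvent_bounds(2)[OF Yp s(1) s(3) s(4)] .
    also have "\<dots> = (\<Sum>n\<in>{N..<K}. inner (y n Om) Om)" by (simp add: Y_def blinfun.sum_left inner_sum_left)
    also have "\<dots> \<le> (\<Sum>n\<in>{N..<K}. (1/2) ^ n)" by (intro sum_mono yOm)
    also have "\<dots> \<le> 2 * (1/2) ^ N"
    proof (cases "N \<le> K")
      case True
      then have "(\<Sum>n\<in>{N..<K}. (1/2::real) ^ n) = 2 * (1/2)^N - 2 * (1/2) ^ K"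
        by (induction K rule: dec_induct) (auto simp: sum.atLeastLessThan_Suc)
      then show ?thesis by simp
    qed simp
    finally show ?thesis .
  qed
  have SOm: "inner (Om - S N Om) Om \<le> 2 * (1/2) ^ N" for N
  proof (rule lim_le[OF _ sOm])
    show "(\<lambda>K. inner (Om - s N K Om) Om) \<longlonglongrightarrow> inner (Om - S N Om) Om"
      by (intro tendsto_inner tendsto_diff tendsto_const S)
  qed
  have "(\<lambda>N. 2 * (1/2::real) ^ N) \<longlonglongrightarrow> 2 * 0" by (intro tendsto_mult tendsto_const LIMSEQ_realpow_zero) auto
  moreover have "(\<lambda>N. inner (Om - S N Om) Om) \<longlonglongrightarrow> inner (Om - T Om) Om"
    by (intro tendsto_inner tendsto_diff tendsto_const T)
  ultimately have TOm: "inner (Om - T Om) Om \<le> 2 * 0" using SOm by (meson LIMSEQ_le)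
  \<comment> \<open>\<open>0 <= 1 - T <= 1\<close>, and the form of \<open>1 - T\<close> vanishes at
    \<open>Om\<close>, which forces \<open>(1 - T) Om = 0\<close>. Elsewhere \<open>T\<close> may
    differ from the identity.\<close>
  have "inner ((id_blinfun - T) f) f \<le> 1 * (norm f)\<^sup>2" for f
  proof -
    have "0 \<le> inner (T f) f" by (rule lim_ge[OF tendsto_inner[OF T(1) tendsto_const]]) (rule psdD(2)[OF Sp])
    then show ?thesis by (simp add: bl_simps power2_norm_eq_inner)
  qed
  then have "(norm ((id_blinfun - T) Om))\<^sup>2 \<le> 1 * inner ((id_blinfun - T) Om) Om" by (rule psd_norm_square[OF T1])
  also have "\<dots> \<le> 0" using TOm by (simp add: bl_simps)
  finally have "(norm ((id_blinfun - T) Om))\<^sup>2 \<le> 0" .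
  then have T_Om: "T Om = Om" by (simp add: bl_simps)
  \<comment> \<open>The first resolvent bound holds for the approximants \<open>s N (K + J)\<close>,
    whose index exceeds all of \<open>F\<close>; it passes to the limit because \<open>F\<close> is
    finite.\<close>
  have "(\<Sum>n\<in>F. inner (y n (S N f)) (S N f)) \<le> (norm f)\<^sup>2" if F: "finite F" "F \<subseteq> {N..}" for F N f
  proof -
    obtain J where J: "\<And>n. n \<in> F \<Longrightarrow> n < J" using F(1) by (metis finite_nat_iff_bounded lessThan_iff subsetD)
    have bd: "(\<Sum>n\<in>F. inner (y n (s N (K + J) f)) (s N (K + J) f)) \<le> (norm f)\<^sup>2" for K
    proof -
      let ?g = "s N (K + J) f"
      have "F \<subseteq> {N..<K + J}" using F J by fastforce
      then have "(\<Sum>n\<in>F. inner (y n ?g) ?g) \<le> (\<Sum>n\<in>{N..<K + J}. inner (y n ?g) ?g)"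
        using y0 by (intro sum_mono2) (auto simp: psd_def)
      also have "\<dots> = inner (Y N (K+J) ?g) ?g" by (simp add: Y_def blinfun.sum_left inner_sum_left)
      also have "\<dots> \<le> (norm f)\<^sup>2" by (rule resolvent_bounds(1)[OF Yp s(1) s(3) s(4)])
      finally show ?thesis .
    qed
    have "(\<lambda>K. \<Sum>n\<in>F. inner (y n (s N (K + J) f)) (s N (K + J) f)) \<longlonglongrightarrow> (\<Sum>n\<in>F. inner (y n (S N f)) (S N f))"
      by (intro tendsto_sum tendsto_inner op_tendsto LIMSEQ_ignore_initial_segment[OF S])
    then show ?thesis by (rule lim_le) (rule bd)
  qed
  from that[of S T, OF SA Sp S1 Sinc TA T(2) T(1) T_Om this] show ?thesis .
qed

text \<open>The linearity of \<open>psi\<close> is known on symmetric operators only, so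
  \<open>c y d\<close> is symmetrised. This makes \<open>beta n\<close> a real symmetric bilinear
  form on symmetric elements.\<close>

definition beta :: "nat \<Rightarrow> ('k \<Rightarrow>\<^sub>L 'k) \<Rightarrow> ('k \<Rightarrow>\<^sub>L 'k) \<Rightarrow> real" where
  "beta n c d = psi (((c o\<^sub>L y n) o\<^sub>L d) + ((d o\<^sub>L y n) o\<^sub>L c))"

lemma symm_y: "symm (y n)"
  using y0 by (rule psdD)

lemma beta_arg:
  assumes "c \<in> A" "symm c" "d \<in> A" "symm d"
  shows "((c o\<^sub>L y n) o\<^sub>L d) + ((d o\<^sub>L y n) o\<^sub>L c) \<in> A" "symm (((c o\<^sub>L y n) o\<^sub>L d) + ((d o\<^sub>L y n) o\<^sub>L c))"
  using assms yA symm_y[of n] by (auto intro!: A_intros simp: symm_def bl_simps)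

lemma beta_commute: "beta n c d = beta n d c"
  by (simp add: beta_def add.commute)

lemma beta_diff:
  assumes "c \<in> A" "symm c" "c' \<in> A" "symm c'" "d \<in> A" "symm d"
  shows "beta n (c - c') d = beta n c d - beta n c' d" "beta n d (c - c') = beta n d c - beta n d c'"
proof -
  have "(((c - c') o\<^sub>L y n) o\<^sub>L d) + ((d o\<^sub>L y n) o\<^sub>L (c - c'))
    = (((c o\<^sub>L y n) o\<^sub>L d) + ((d o\<^sub>L y n) o\<^sub>L c)) - (((c' o\<^sub>L y n) o\<^sub>L d) + ((d o\<^sub>L y n) o\<^sub>L c'))"
    by (intro blinfun_eqI) (simp add: bl_simps)
  then show "beta n (c - c') d = beta n c d - beta n c' d"
    unfolding beta_def using assms by (simp add: psi_diff beta_arg)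
  then show "beta n d (c - c') = beta n d c - beta n d c'" by (simp add: beta_commute)
qed

text \<open>Polarisation writes twice the argument of \<open>beta\<close> as
  \<open>(c + d) y (c + d) - (c - d) y (c - d)\<close>. By the parallelogram identity both families
  have bounded partial sums, and \<open>psi_tendsto_0\<close> applies to each.\<close>

lemma beta_tendsto_0:
  assumes c: "\<And>k. c k \<in> A" "\<And>k. symm (c k)" "\<And>m f. (\<Sum>k<m. inner (y (i k) (c k f)) (c k f)) \<le> C * (norm f)\<^sup>2"
    and d: "\<And>k. d k \<in> A" "\<And>k. symm (d k)" "\<And>m f. (\<Sum>k<m. inner (y (i k) (d k f)) (d k f)) \<le> D * (norm f)\<^sup>2"
  shows "(\<lambda>k. beta (i k) (c k) (d k)) \<longlonglongrightarrow> 0"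
proof -
  \<comment> \<open>\<open>r = 1\<close> and \<open>r = -1\<close> give the two squares; adding the
    nonnegative form at \<open>c - r d\<close> to that at \<open>c + r d\<close> yields the
    bound.\<close>
  have *: "(\<lambda>k. psi ((e k o\<^sub>L y (i k)) o\<^sub>L e k)) \<longlonglongrightarrow> 0"
    if e: "\<And>k. e k \<in> A" "\<And>k. symm (e k)" "\<And>k f. e k f = c k f + r *\<^sub>R d k f" and r: "r\<^sup>2 = 1" for e and r :: real
  proof (rule psi_tendsto_0)
    show "(e k o\<^sub>L y (i k)) o\<^sub>L e k \<in> A" for k using e yA by (intro A_intros)
    show "psd ((e k o\<^sub>L y (i k)) o\<^sub>L e k)" for k using e(2) by (intro psd_conj y0) (auto simp: symm_def)
    fix m f
    have le: "inner (((e k o\<^sub>L y (i k)) o\<^sub>L e k) f) f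
      \<le> 2 * inner (y (i k) (c k f)) (c k f) + 2 * inner (y (i k) (d k f)) (d k f)" for k
    proof -
      let ?y = "y (i k)" and ?c = "c k f" and ?d = "d k f"
      have "inner (((e k o\<^sub>L ?y) o\<^sub>L e k) f) f = inner (?y (e k f)) (e k f)"
        using e(2) by (simp add: symm_def)
      also have "\<dots> + inner (?y (?c - r *\<^sub>R ?d)) (?c - r *\<^sub>R ?d)
        = 2 * inner (?y ?c) ?c + 2 * (r\<^sup>2 * inner (?y ?d) ?d)" unfolding e(3)
        by (simp add: bl_simps power2_eq_square algebra_simps)
      also have "r\<^sup>2 * inner (?y ?d) ?d = inner (?y ?d) ?d" using r by simp
      finally show ?thesis using psdD(2)[OF y0[of "i k"], of "?c - r *\<^sub>R ?d"] by linarith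
    qed
    have "(\<Sum>k<m. inner (((e k o\<^sub>L y (i k)) o\<^sub>L e k) f) f)
      \<le> (\<Sum>k<m. 2 * inner (y (i k) (c k f)) (c k f) + 2 * inner (y (i k) (d k f)) (d k f))"
      by (intro sum_mono le)
    also have "\<dots> = 2 * (\<Sum>k<m. inner (y (i k) (c k f)) (c k f)) + 2 * (\<Sum>k<m. inner (y (i k) (d k f)) (d k f))"
      by (simp add: sum.distrib sum_distrib_left)
    also have "\<dots> \<le> 2 * (C * (norm f)\<^sup>2) + 2 * (D * (norm f)\<^sup>2)" using c(3)[where m=m and f=f] d(3)[where m=m and f=f] by linarith
    finally show "(\<Sum>k<m. inner (((e k o\<^sub>L y (i k)) o\<^sub>L e k) f) f) \<le> (2 * C + 2 * D) * (norm f)\<^sup>2"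
      by (simp add: algebra_simps)
  qed
  define p where "p k = c k + d k" for k
  define q where "q k = c k - d k" for k
  have pq: "p k \<in> A" "symm (p k)" "q k \<in> A" "symm (q k)" for k
    using c d by (auto simp: p_def q_def intro: A_intros)
  have lim: "(\<lambda>k. (1/2) * (psi ((p k o\<^sub>L y (i k)) o\<^sub>L p k) - psi ((q k o\<^sub>L y (i k)) o\<^sub>L q k))) \<longlonglongrightarrow> (1/2) * (0 - 0)"
    using *[of p 1] *[of q "-1"] pq by (intro tendsto_mult tendsto_const tendsto_diff) (auto simp: p_def q_def bl_simps)
  have A: "(p k o\<^sub>L y (i k)) o\<^sub>L p k \<in> A" "symm ((p k o\<^sub>L y (i k)) o\<^sub>L p k)"
    "(q k o\<^sub>L y (i k)) o\<^sub>L q k \<in> A" "symm ((q k o\<^sub>L y (i k)) o\<^sub>L q k)" for k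
    using pq[of k] yA symm_y[of "i k"] by (auto intro!: A_intros simp: symm_def)
  have "beta (i k) (c k) (d k) = (1/2) * (psi ((p k o\<^sub>L y (i k)) o\<^sub>L p k) - psi ((q k o\<^sub>L y (i k)) o\<^sub>L q k))" for k
  proof -
    let ?B = "((c k o\<^sub>L y (i k)) o\<^sub>L d k) + ((d k o\<^sub>L y (i k)) o\<^sub>L c k)"
    have "?B + ?B = ((p k o\<^sub>L y (i k)) o\<^sub>L p k) - ((q k o\<^sub>L y (i k)) o\<^sub>L q k)"
      by (intro blinfun_eqI) (simp add: bl_simps p_def q_def)
    then have "psi (?B + ?B) = psi ((p k o\<^sub>L y (i k)) o\<^sub>L p k) - psi ((q k o\<^sub>L y (i k)) o\<^sub>L q k)"
      using A[of k] by (simp add: psi_diff)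
    moreover have "psi (?B + ?B) = psi ?B + psi ?B" using c d by (intro psi_add beta_arg)
    ultimately show ?thesis by (simp add: beta_def)
  qed
  then have "(\<lambda>k. beta (i k) (c k) (d k)) = (\<lambda>k. (1/2) * (psi ((p k o\<^sub>L y (i k)) o\<^sub>L p k) - psi ((q k o\<^sub>L y (i k)) o\<^sub>L q k)))"
    by blast
  then show ?thesis using lim by (metis diff_self mult_zero_right)
qed

text \<open>\<open>v' (S N) v\<close> increases to \<open>v' T v\<close>. As
  \<open>T Om = Om\<close>, \<open>sep\<close> gives \<open>T (v Om) = v Om\<close>, and
  \<open>psi\<close> sees an operator only through its value at \<open>Om\<close>; hence
  \<open>T\<close> disappears from the limit.\<close>

lemma psi_conj_tendsto:
  assumes S: "\<And>N. S N \<in> A" "\<And>N. psd (S N)" "\<And>M N. M \<le> N \<Longrightarrow> psd (S N - S M)" "T \<in> A" "symm T"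
    "\<And>f. (\<lambda>N. blinfun_apply (S N) f) \<longlonglongrightarrow> blinfun_apply T f" "T Om = Om"
    and v: "v \<in> A" "v' \<in> A" "\<And>f g. inner (v f) g = inner f (blinfun_apply v' g)"
  shows "(\<lambda>N. psi ((v' o\<^sub>L S N) o\<^sub>L v)) \<longlonglongrightarrow> psi (v' o\<^sub>L v)"
proof -
  have "(\<lambda>N. psi ((v' o\<^sub>L S N) o\<^sub>L v)) \<longlonglongrightarrow> psi ((v' o\<^sub>L T) o\<^sub>L v)"
  proof (rule psi_mono)
    show "psd (((v' o\<^sub>L S (Suc N)) o\<^sub>L v) - ((v' o\<^sub>L S N) o\<^sub>L v))" for N
    proof -
      have "((v' o\<^sub>L S (Suc N)) o\<^sub>L v) - ((v' o\<^sub>L S N) o\<^sub>L v) = (v' o\<^sub>L (S (Suc N) - S N)) o\<^sub>L v"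
        by (intro blinfun_eqI) (simp add: bl_simps)
      then show ?thesis using psd_conj[OF S(3)[of N "Suc N"] v(3)] by simp
    qed
    show "symm ((v' o\<^sub>L S N) o\<^sub>L v)" for N using S(2) v(3) by (intro symm_conj) (auto simp: psd_def)
    show "(\<lambda>N. blinfun_apply ((v' o\<^sub>L S N) o\<^sub>L v) f) \<longlonglongrightarrow> blinfun_apply ((v' o\<^sub>L T) o\<^sub>L v) f" for f
      by (simp, intro op_tendsto S(6))
  qed (use S v in \<open>auto intro: A_intros\<close>)
  moreover have "psi ((v' o\<^sub>L T) o\<^sub>L v) = psi (v' o\<^sub>L v)"
  proof (rule psi_eq)
    have "T (v Om) = v Om" using sep[of "id_blinfun - T" v] S v by (simp add: A_intros bl_simps)
    then show "((v' o\<^sub>L T) o\<^sub>L v) Om = (v' o\<^sub>L v) Om" by simp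
    show "symm ((v' o\<^sub>L T) o\<^sub>L v)" using S(5) v(3) by (intro symm_conj)
    show "symm (v' o\<^sub>L v)" using v(3) by (intro psdD(1) psd_square)
  qed (use S v in \<open>auto intro: A_intros\<close>)
  ultimately show ?thesis by simp
qed

text \<open>With \<open>p = 1 + y c\<close> and \<open>q = 1 - y c\<close>,
  \<open>p' s p - q' s q\<close> is twice the argument of \<open>beta n s c\<close>. So
  \<open>S N\<close> enters through conjugations, where monotone convergence applies.\<close>

lemma beta_cutoff_tendsto:
  assumes S: "\<And>N. S N \<in> A" "\<And>N. psd (S N)" "\<And>M N. M \<le> N \<Longrightarrow> psd (S N - S M)" "T \<in> A" "symm T"
    "\<And>f. (\<lambda>N. blinfun_apply (S N) f) \<longlonglongrightarrow> blinfun_apply T f" "T Om = Om"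
    and c: "c \<in> A" "symm c"
  shows "(\<lambda>N. beta n (S N) c) \<longlonglongrightarrow> beta n id_blinfun c"
proof -
  define p where "p = id_blinfun + (y n o\<^sub>L c)"
  define p' where "p' = id_blinfun + (c o\<^sub>L y n)"
  define q where "q = id_blinfun - (y n o\<^sub>L c)"
  define q' where "q' = id_blinfun - (c o\<^sub>L y n)"
  have A: "p \<in> A" "p' \<in> A" "q \<in> A" "q' \<in> A" using c yA by (auto simp: p_def p'_def q_def q'_def intro!: A_intros)
  have adj: "inner (p f) g = inner f (p' g)" "inner (q f) g = inner f (q' g)" for f g
    using c symm_y[of n] by (simp_all add: p_def p'_def q_def q'_def symm_def bl_simps)
  have ap: "beta n s c = (1/2) * (psi ((p' o\<^sub>L s) o\<^sub>L p) - psi ((q' o\<^sub>L s) o\<^sub>L q))" if s: "s \<in> A" "symm s" for s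
  proof -
    let ?B = "((s o\<^sub>L y n) o\<^sub>L c) + ((c o\<^sub>L y n) o\<^sub>L s)"
    have "?B + ?B = ((p' o\<^sub>L s) o\<^sub>L p) - ((q' o\<^sub>L s) o\<^sub>L q)"
      by (intro blinfun_eqI) (simp add: bl_simps p_def q_def p'_def q'_def)
    moreover have "symm ((p' o\<^sub>L s) o\<^sub>L p)" "symm ((q' o\<^sub>L s) o\<^sub>L q)"
      by (rule symm_conj[OF s(2)], rule adj)+
    ultimately have "psi (?B + ?B) = psi ((p' o\<^sub>L s) o\<^sub>L p) - psi ((q' o\<^sub>L s) o\<^sub>L q)"
      using A s by (simp add: psi_diff A_intros)
    moreover have "psi (?B + ?B) = psi ?B + psi ?B" using c s by (intro psi_add beta_arg)
    ultimately show ?thesis by (simp add: beta_def)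
  qed
  have lim: "(\<lambda>N. (1/2) * (psi ((p' o\<^sub>L S N) o\<^sub>L p) - psi ((q' o\<^sub>L S N) o\<^sub>L q))) \<longlonglongrightarrow> (1/2) * (psi (p' o\<^sub>L p) - psi (q' o\<^sub>L q))"
    by (intro tendsto_mult tendsto_const tendsto_diff psi_conj_tendsto[OF S] A adj)
  have ids: "(p' o\<^sub>L id_blinfun) = p'" "(q' o\<^sub>L id_blinfun) = q'" by (auto intro!: blinfun_eqI)
  have "beta n id_blinfun c = (1/2) * (psi ((p' o\<^sub>L id_blinfun) o\<^sub>L p) - psi ((q' o\<^sub>L id_blinfun) o\<^sub>L q))"
    by (intro ap A_id symm_intros)
  then show ?thesis using lim unfolding ap[OF S(1) psdD(1)[OF S(2)]] ids by (simp only:)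
qed

text \<open>Gliding hump: differences \<open>S N' - S N\<close> along an increasing sequence of indices sum up to at most 1, so
  countable additivity forces \<open>beta\<close> to vanish on them. On the other hand they look more and more like \<open>1 - S N\<close>, and
  \<open>beta n 1 1 = 2 psi (y n)\<close>. The mixed terms \<open>beta n 1 (S N)\<close> are not controlled by summability; a first
  gliding hump with one of the two arguments fixed removes them.\<close>

lemma psi_not_bounded_below:
  assumes e: "e > 0" and big: "\<And>n. \<bar>psi (y n)\<bar> > e" shows False
proof -
  obtain S T where SA: "\<And>N. S N \<in> A" and Sp: "\<And>N. psd (S N)" and S1: "\<And>N. psd (id_blinfun - S N)"
    and Sinc: "\<And>M N. M \<le> N \<Longrightarrow> psd (S N - S M)" and T: "T \<in> A" "symm T"
      "\<And>f. (\<lambda>N. blinfun_apply (S N) f) \<longlonglongrightarrow> blinfun_apply T f" "T Om = Om"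
    and Sy: "\<And>F N f. finite F \<Longrightarrow> F \<subseteq> {N..} \<Longrightarrow> (\<Sum>n\<in>F. inner (y n (S N f)) (S N f)) \<le> (norm f)\<^sup>2"
    by (rule cutoffs) (assumption | rule that)+
  note Ss = psdD(1)[OF Sp]
  have Sy': "(\<Sum>k<m. inner (y (i k) (S N f)) (S N f)) \<le> 1 * (norm f)\<^sup>2"
    if "inj i" "\<And>k. N \<le> i k" for i N and f :: 'k and m :: nat
    using Sy[of "i ` {..<m}" N f] that by (auto simp: sum.reindex inj_def inj_on_def)
  have conv: "(\<lambda>N. beta n (S N) c) \<longlonglongrightarrow> beta n id_blinfun c" if "c \<in> A" "symm c" for n c
    using beta_cutoff_tendsto[OF SA Sp Sinc T that] .
  \<comment> \<open>Both cutoffs are summable against \<open>y k\<close> from index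
    \<open>max N N'\<close> on, hence the shift.\<close>
  have diag: "(\<lambda>n. beta n (S N) (S N')) \<longlonglongrightarrow> 0" for N N'
  proof -
    have "(\<lambda>k. beta (k + max N N') (S N) (S N')) \<longlonglongrightarrow> 0"
      using SA Ss by (intro beta_tendsto_0[where C=1 and D=1] Sy') (auto simp: inj_def)
    then show ?thesis by (rule LIMSEQ_offset)
  qed
  \<comment> \<open>The indices \<open>i k\<close> are arbitrary here: \<open>y <= 1\<close> and
    \<open>d^2 <= d\<close> reduce the sum to increments of \<open><S f, f>\<close>, which
    telescope. \<open>d k\<close> may be any operator between 0 and the increment.\<close>
  have tele: "(\<Sum>k<m. inner (y (i k) (d k f)) (d k f)) \<le> 1 * (norm f)\<^sup>2"
    if N: "\<And>k. N k \<le> N (Suc k)" and d: "\<And>k. psd (d k)" "\<And>k. psd (S (N (Suc k)) - S (N k) - d k)" for N i d m f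
  proof -
    have le: "inner (y (i k) (d k f)) (d k f) \<le> inner (S (N (Suc k)) f) f - inner (S (N k) f) f" for k
    proof -
      have "inner (y (i k) (d k f)) (d k f) \<le> (norm (d k f))\<^sup>2"
        using psdD(2)[OF y1, of "i k" "d k f"] by (simp add: bl_simps power2_norm_eq_inner)
      also have "\<dots> \<le> inner (d k f) f"
      proof (rule psd_le_one(1)[OF d(1)])
        have "id_blinfun - d k = (id_blinfun - S (N (Suc k))) + (S (N k) + (S (N (Suc k)) - S (N k) - d k))" by simp
        then show "psd (id_blinfun - d k)" using S1 Sp d(2) psd_intros(3) by metis
      qed
      also have "\<dots> \<le> inner (S (N (Suc k)) f) f - inner (S (N k) f) f"
        using psdD(2)[OF d(2), of k f] by (simp add: bl_simps)
      finally show ?thesis .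
    qed
    have "(\<Sum>k<m. inner (y (i k) (d k f)) (d k f)) \<le> (\<Sum>k<m. inner (S (N (Suc k)) f) f - inner (S (N k) f) f)"
      by (intro sum_mono le)
    also have "\<dots> = inner (S (N m) f) f - inner (S (N 0) f) f" by (rule sum_lessThan_telescope)
    also have "\<dots> \<le> (norm f)\<^sup>2"
      using psdD(2)[OF Sp, of "N 0" f] psdD(2)[OF S1, of "N m" f] by (simp add: bl_simps power2_norm_eq_inner)
    finally show ?thesis by simp
  qed
  have cross: "(\<lambda>n. beta n id_blinfun (S N0)) \<longlonglongrightarrow> 0" for N0
  proof (rule ccontr)
    assume "\<not> ?thesis"
    then obtain r where r: "r > 0" "\<And>m. \<exists>n\<ge>m. r \<le> \<bar>beta n id_blinfun (S N0)\<bar>"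
      unfolding LIMSEQ_def by (auto simp: not_less)
    \<comment> \<open>A state pairs an index of \<open>y\<close> with a cutoff index. Strict growth
      of the first lets \<open>Sy'\<close> apply to \<open>S N0\<close>, growth of the second makes
      the differences telescope.\<close>
    define Q where "Q x x' \<longleftrightarrow> fst x < fst x' \<and> snd x \<le> snd x' \<and> N0 \<le> fst x' \<and>
      r / 4 < \<bar>beta (fst x') (S (snd x') - S (snd x)) (S N0)\<bar>" for x x' :: "nat \<times> nat"
    have "\<exists>x'. Q x x'" for x
    proof -
      obtain m where m: "\<And>n. n \<ge> m \<Longrightarrow> \<bar>beta n (S (snd x)) (S N0)\<bar> < r / 4"
        using lim_close[OF diag, of "r/4"] r(1) by force
      obtain n where n: "n \<ge> max m (max N0 (Suc (fst x)))" "r \<le> \<bar>beta n id_blinfun (S N0)\<bar>" using r(2) by blast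
      obtain K where K: "\<And>N. N \<ge> K \<Longrightarrow> \<bar>beta n (S N) (S N0) - beta n id_blinfun (S N0)\<bar> < r / 4"
        using lim_close[OF conv[OF SA Ss], of "r/4"] r(1) by force
      define N where "N = max K (snd x)"
      \<comment> \<open>At least \<open>r / 2\<close> survives: replacing 1 by \<open>S N\<close>
        costs less than \<open>r / 4\<close>, and so does the term at the old cutoff.\<close>
      have "r / 4 < \<bar>beta n (S N) (S N0) - beta n (S (snd x)) (S N0)\<bar>"
      proof -
        have "\<bar>beta n (S (snd x)) (S N0)\<bar> < r / 4" using m[of n] n by simp
        moreover have "\<bar>beta n (S N) (S N0) - beta n id_blinfun (S N0)\<bar> < r / 4" using K[of N] by (simp add: N_def)
        ultimately show ?thesis using n(2) r(1) by linarith
      qed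
      then have "Q x (n, N)" using n by (auto simp: Q_def N_def beta_diff SA Ss)
      then show ?thesis by blast
    qed
    then have "\<exists>x. \<forall>k. Q (x k) (x (Suc k))"
      using dependent_nat_choice[of "\<lambda>_ _. True" "\<lambda>_. Q"] by blast
    then obtain x where x: "\<And>k. Q (x k) (x (Suc k))" by blast
    define i where "i k = fst (x (Suc k))" for k
    define N where "N k = snd (x k)" for k
    have i: "strict_mono i" using x by (auto simp: strict_mono_Suc_iff i_def Q_def)
    have i0: "N0 \<le> i k" for k using x[of k] by (simp add: i_def Q_def)
    have N: "N k \<le> N (Suc k)" for k using x[of k] by (simp add: N_def Q_def)
    have lim: "(\<lambda>k. beta (i k) (S (N (Suc k)) - S (N k)) (S N0)) \<longlonglongrightarrow> 0"
    proof (rule beta_tendsto_0)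
      show "(\<Sum>k<m. inner (y (i k) ((S (N (Suc k)) - S (N k)) f)) ((S (N (Suc k)) - S (N k)) f)) \<le> 1 * (norm f)\<^sup>2" for m f
        using N Sinc[OF N] by (intro tele[of N]) auto
      show "(\<Sum>k<m. inner (y (i k) (S N0 f)) (S N0 f)) \<le> 1 * (norm f)\<^sup>2" for m f
        using i i0 by (intro Sy' strict_mono_imp_inj_on) auto
    qed (use SA Ss in \<open>auto intro: A_diff\<close>)
    obtain k where "\<forall>n\<ge>k. \<bar>beta (i n) (S (N (Suc n)) - S (N n)) (S N0) - 0\<bar> < r / 4"
      using lim_close[OF lim, of "r/4"] r(1) by auto
    then have "\<bar>beta (i k) (S (N (Suc k)) - S (N k)) (S N0)\<bar> < r / 4" by simp
    then show False using x[of k] by (simp add: Q_def i_def N_def)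
  qed
  \<comment> \<open>The second hump needs two later cutoffs. \<open>N''\<close> is chosen after
    \<open>N'\<close>, because replacing \<open>S N''\<close> by 1 in \<open>beta\<close> is
    possible only with the other argument fixed.\<close>
  define Q where "Q N x \<longleftrightarrow> (case x of (n, N', N'') \<Rightarrow> N \<le> N' \<and> N' \<le> N'' \<and> e / 4 < \<bar>beta n (S N' - S N) (S N'' - S N)\<bar>)"
    for N and x :: "nat \<times> nat \<times> nat"
  have "\<exists>x. Q N x" for N
  proof -
    obtain m where m: "\<And>n. n \<ge> m \<Longrightarrow> \<bar>beta n (S N) (S N)\<bar> < e / 4"
      using lim_close[OF diag, of "e/4"] e by force
    obtain m' where m': "\<And>n. n \<ge> m' \<Longrightarrow> \<bar>beta n id_blinfun (S N)\<bar> < e / 4"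
      using lim_close[OF cross, of "e/4"] e by force
    define n where "n = max m m'"
    have one: "\<bar>beta n id_blinfun id_blinfun\<bar> > 2 * e"
    proof -
      have "((id_blinfun o\<^sub>L y n) o\<^sub>L id_blinfun) + ((id_blinfun o\<^sub>L y n) o\<^sub>L id_blinfun) = 2 *\<^sub>R y n"
        by (intro blinfun_eqI) (simp add: bl_simps flip: scaleR_2)
      then show ?thesis using big[of n] by (simp add: beta_def psi_scale yA symm_y)
    qed
    obtain K where K: "\<And>N'. N' \<ge> K \<Longrightarrow> \<bar>beta n (S N') id_blinfun - beta n id_blinfun id_blinfun\<bar> < e / 4"
      using lim_close[OF conv[OF A_id symm_intros(2)], of "e/4"] e by force
    obtain K' where K': "\<And>N'. N' \<ge> K' \<Longrightarrow> \<bar>beta n (S N') (S N) - beta n id_blinfun (S N)\<bar> < e / 4"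
      using lim_close[OF conv[OF SA Ss], of "e/4"] e by force
    define N' where "N' = max K (max K' N)"
    obtain L where L: "\<And>N''. N'' \<ge> L \<Longrightarrow> \<bar>beta n (S N'') (S N') - beta n id_blinfun (S N')\<bar> < e / 4"
      using lim_close[OF conv[OF SA Ss], of "e/4"] e by force
    obtain L' where L': "\<And>N''. N'' \<ge> L' \<Longrightarrow> \<bar>beta n (S N'') (S N) - beta n id_blinfun (S N)\<bar> < e / 4"
      using lim_close[OF conv[OF SA Ss], of "e/4"] e by force
    define N'' where "N'' = max L (max L' N')"
    \<comment> \<open>As \<open>beta n 1 1 = 2 psi (y n)\<close> exceeds \<open>2 e\<close> in
      modulus and the expansion loses seven errors below \<open>e / 4\<close>, more than
      \<open>e / 4\<close> remains.\<close>
    have ex: "beta n (S N' - S N) (S N'' - S N) = beta n (S N'') (S N') - beta n (S N') (S N) - beta n (S N'') (S N) + beta n (S N) (S N)"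
      by (simp add: beta_diff SA Ss A_diff beta_commute)
    have "\<bar>beta n (S N) (S N) - 0\<bar> < e / 4" using m[of n] by (simp add: n_def)
    moreover have "\<bar>beta n id_blinfun (S N) - 0\<bar> < e / 4" using m'[of n] by (simp add: n_def)
    moreover have "\<bar>beta n (S N') id_blinfun - beta n id_blinfun id_blinfun\<bar> < e / 4" using K[of N'] by (simp add: N'_def)
    moreover have "\<bar>beta n (S N') (S N) - beta n id_blinfun (S N)\<bar> < e / 4" using K'[of N'] by (simp add: N'_def)
    moreover have "\<bar>beta n (S N'') (S N') - beta n (S N') id_blinfun\<bar> < e / 4"
      using L[of N''] by (simp add: N''_def beta_commute[of n id_blinfun])
    moreover have "\<bar>beta n (S N'') (S N) - beta n id_blinfun (S N)\<bar> < e / 4" using L'[of N''] by (simp add: N''_def)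
    ultimately have "e / 4 < \<bar>beta n (S N' - S N) (S N'' - S N)\<bar>"
      unfolding ex using one by linarith
    moreover have "N \<le> N'" by (simp add: N'_def)
    moreover have "N' \<le> N''" by (simp add: N''_def)
    ultimately have "Q N (n, N', N'')" unfolding Q_def prod.case by blast
    then show ?thesis by blast
  qed
  then have "\<exists>h. \<forall>N. Q N (h N)" by (intro choice) blast
  then obtain h where h: "\<And>N. Q N (h N)" by blast
  \<comment> \<open>Each round starts from the last cutoff of the previous one. The indices
    \<open>i k\<close> may repeat, since both families are controlled by
    \<open>tele\<close>.\<close>
  define N where "N = rec_nat 0 (\<lambda>_ N. snd (snd (h N)))"
  have NS: "N (Suc k) = snd (snd (h (N k)))" for k by (simp add: N_def)
  define i where "i k = fst (h (N k))" for k
  define N' where "N' k = fst (snd (h (N k)))" for k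
  have hk: "N k \<le> N' k" "N' k \<le> N (Suc k)" "e / 4 < \<bar>beta (i k) (S (N' k) - S (N k)) (S (N (Suc k)) - S (N k))\<bar>" for k
    using h[of "N k"] by (auto simp: Q_def NS N'_def i_def split: prod.splits)
  have NN: "N k \<le> N (Suc k)" for k using hk[of k] by linarith
  have lim: "(\<lambda>k. beta (i k) (S (N' k) - S (N k)) (S (N (Suc k)) - S (N k))) \<longlonglongrightarrow> 0"
  proof (rule beta_tendsto_0)
    show "(\<Sum>k<m. inner (y (i k) ((S (N (Suc k)) - S (N k)) f)) ((S (N (Suc k)) - S (N k)) f)) \<le> 1 * (norm f)\<^sup>2" for m f
      using NN Sinc[OF NN] by (intro tele[of N]) auto
    show "(\<Sum>k<m. inner (y (i k) ((S (N' k) - S (N k)) f)) ((S (N' k) - S (N k)) f)) \<le> 1 * (norm f)\<^sup>2" for m f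
      using NN Sinc[OF hk(1)] Sinc[OF hk(2)] by (intro tele[of N]) auto
  qed (use SA Ss in \<open>auto intro: A_diff\<close>)
  obtain k where "\<forall>n\<ge>k. \<bar>beta (i n) (S (N' n) - S (N n)) (S (N (Suc n)) - S (N n)) - 0\<bar> < e / 4"
    using lim_close[OF lim, of "e/4"] e by auto
  then have "\<bar>beta (i k) (S (N' k) - S (N k)) (S (N (Suc k)) - S (N k))\<bar> < e / 4" by simp
  then show False using hk(3)[of k] by linarith
qed

end

section \<open>Continuity of \<open>psi\<close> on the unit ball and its approximation by
  vectors\<close>

context operator_state
begin

text \<open>Counterexamples for \<open>d = 2^-n\<close> would form a sequence that the gliding hump
  excludes.\<close>

lemma psi_continuous_pos:
  assumes e: "e > 0"
  shows "\<exists>d>0. \<forall>y\<in>A. psd y \<longrightarrow> psd (id_blinfun - y) \<longrightarrow> inner (y Om) Om \<le> d \<longrightarrow> \<bar>psi y\<bar> \<le> e"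
proof (rule ccontr)
  assume neg: "\<not> ?thesis"
  have "\<exists>y\<in>A. psd y \<and> psd (id_blinfun - y) \<and> inner (y Om) Om \<le> (1/2)^n \<and> \<bar>psi y\<bar> > e" for n :: nat
  proof -
    have "(1/2::real)^n > 0" by simp
    then show ?thesis using neg by (meson not_le)
  qed
  then obtain y where y: "\<And>n. y n \<in> A" "\<And>n. psd (y n)" "\<And>n. psd (id_blinfun - y n)"
    "\<And>n. inner (y n Om) Om \<le> (1/2)^n" "\<And>n. \<bar>psi (y n)\<bar> > e" by metis
  interpret hump A Om psi y by unfold_locales (use y in auto)
  show False using psi_not_bounded_below[OF e y(5)] .
qed

text \<open>The operator \<open>z\<close> plays the role of $|y|$: for $|t| \le 1$ one has
  $|t| \le l + t^2 / (t^2 + l^2)$.\<close>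

lemma rational_absolute_value:
  assumes y: "y \<in> A" "symm y" "psd (id_blinfun - y)" "psd (id_blinfun + y)" and l: "l > 0"
  obtains z where "z \<in> A" "psd z" "psd (id_blinfun - z)" "psd (z + l *\<^sub>R id_blinfun + y)"
    "\<And>f. inner (z f) f \<le> (norm (y f))\<^sup>2 / l\<^sup>2"
proof -
  define Y where "Y = (1 / l\<^sup>2) *\<^sub>R (y o\<^sub>L y)"
  have ys: "inner (y f) g = inner f (y g)" for f g using y(2) by (simp add: symm_def)
  have Y: "psd Y" unfolding Y_def using ys by (intro psd_intros psd_square) auto
  obtain s where s: "psd s" "psd (id_blinfun - s)" "\<And>f. s f + Y (s f) = f" "\<And>f. s (f + Y f) = f"
    using resolvent[OF Y] by metis
  have sA: "s \<in> A" by (rule A_res[OF _ Y s(3)]) (use y in \<open>auto simp: Y_def intro: A_intros\<close>)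
  define z where "z = id_blinfun - s"
  have "0 \<le> inner ((z + l *\<^sub>R id_blinfun + y) f) f" for f
  proof -
    \<comment> \<open>Substituting \<open>f = (1 + y^2 / l^2) g\<close> turns the claim into an
      inequality between inner products of \<open>g\<close>, \<open>y g\<close>,
      \<open>y^2 g\<close> and \<open>y^3 g\<close>, which are then grouped into nonnegative
      terms.\<close>
    define g where "g = s f" define h where "h = y g" define k where "k = y h"
    define \<mu> where "\<mu> = 1 / l\<^sup>2"
    have \<mu>: "\<mu> > 0" "l * \<mu> = 1 / l" using l by (auto simp: \<mu>_def power2_eq_square)
    have f: "f = g + \<mu> *\<^sub>R k" using s(3)[of f] by (simp add: g_def h_def k_def Y_def \<mu>_def bl_simps)
    have "f - g = \<mu> *\<^sub>R k" by (subst f) simp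
    then have zf: "z f = \<mu> *\<^sub>R k" by (simp add: z_def bl_simps g_def)
    have yf: "y f = h + \<mu> *\<^sub>R y k" using f by (simp add: bl_simps h_def)
    have i1: "inner k g = inner h h" "inner g k = inner h h" "inner (y k) g = inner h k" "inner g (y k) = inner h k"
      using ys by (simp_all add: h_def k_def inner_commute) (metis inner_commute ys)+
    have p: "0 \<le> inner h h + inner h k" "0 \<le> inner k k + inner (y k) k"
      using psdD(2)[OF y(4), of h] psdD(2)[OF y(4), of k] by (simp_all add: bl_simps k_def inner_commute)
    \<comment> \<open>Completing the square leaves the remainder \<open>3 / (4 l)\<close> times
      \<open><v, v>\<close>.\<close>
    have q: "0 \<le> l * inner u u + inner u v + (1/l) * inner v v" for u v :: 'k
    proof -
      have "0 \<le> (1/l) * inner (l *\<^sub>R u + (1/2) *\<^sub>R v) (l *\<^sub>R u + (1/2) *\<^sub>R v) + 3 / (4 * l) * inner v v"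
        using l by (intro add_nonneg_nonneg mult_nonneg_nonneg) auto
      also have "\<dots> = l * inner u u + inner u v + (1/l) * inner v v"
        using l by (simp add: inner_add_left inner_add_right inner_commute field_simps power2_eq_square)
      finally show ?thesis .
    qed
    have "inner ((z + l *\<^sub>R id_blinfun + y) f) f = inner (\<mu> *\<^sub>R k + l *\<^sub>R (g + \<mu> *\<^sub>R k) + (h + \<mu> *\<^sub>R y k)) (g + \<mu> *\<^sub>R k)"
      using f zf yf by (simp add: blinfun.add_left blinfun.scaleR_left)
    also have "\<dots> = \<mu> * (inner h h + inner h k) + \<mu>\<^sup>2 * (inner k k + inner (y k) k)
      + (l * inner g g + inner g h + (l * \<mu>) * inner h h) + \<mu> * (l * inner h h + inner h k + (l * \<mu>) * inner k k)"
      using i1 by (simp add: inner_add_left inner_add_right inner_commute[of h g] inner_commute[of k h] algebra_simps power2_eq_square)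
    also have "\<dots> \<ge> 0" unfolding \<mu>(2)
      using mult_nonneg_nonneg[OF less_imp_le[OF \<mu>(1)] p(1)] mult_nonneg_nonneg[OF zero_le_power2[of \<mu>] p(2)]
        q[of g h] mult_nonneg_nonneg[OF less_imp_le[OF \<mu>(1)] q[of h k]] by linarith
    finally show ?thesis .
  qed
  then have "psd (z + l *\<^sub>R id_blinfun + y)" using y s by (intro psdI) (auto simp: z_def psd_def)
  moreover have "inner (z f) f \<le> (norm (y f))\<^sup>2 / l\<^sup>2" for f
    using resolvent_bounds(2)[OF Y s(1,3,4), of f] by (simp add: z_def bl_simps Y_def ys power2_norm_eq_inner)
  ultimately show ?thesis using that[of z] s sA by (simp add: z_def A_intros)
qed

text \<open>\<open>y = 3 (a - b)\<close> with \<open>a = (z + l + y) / 3\<close> and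
  \<open>b = (z + l) / 3\<close>, both between 0 and 1 and small at \<open>Om\<close>;
  \<open>z\<close> replaces the absolute value of \<open>y\<close>. The bound \<open>e / 6\<close>
  for each of them adds up to \<open>e\<close>.\<close>

lemma psi_continuous:
  assumes e: "e > 0"
  shows "\<exists>d>0. \<forall>y\<in>A. symm y \<longrightarrow> psd (id_blinfun - y) \<longrightarrow> psd (id_blinfun + y) \<longrightarrow> norm (y Om) \<le> d \<longrightarrow> \<bar>psi y\<bar> \<le> e"
proof -
  obtain d where d: "d > 0" "\<And>y. y \<in> A \<Longrightarrow> psd y \<Longrightarrow> psd (id_blinfun - y) \<Longrightarrow> inner (y Om) Om \<le> d \<Longrightarrow> \<bar>psi y\<bar> \<le> e / 6"
    using psi_continuous_pos[of "e/6"] e by auto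
  define l where "l = min 1 d"
  have l: "l > 0" "l \<le> 1" "l \<le> d" using d by (auto simp: l_def)
  \<comment> \<open>\<open>||y Om||^2 <= t <= d l^2\<close> makes
    \<open><z Om, Om> <= ||y Om||^2 / l^2\<close> at most \<open>d\<close>.\<close>
  define t where "t = min (min 1 d) (d * l\<^sup>2)"
  have t: "t > 0" "t \<le> 1" "t \<le> d" "t \<le> d * l\<^sup>2" using d l by (auto simp: t_def)
  have "\<bar>psi y\<bar> \<le> e" if y: "y \<in> A" "symm y" "psd (id_blinfun - y)" "psd (id_blinfun + y)" and yt: "norm (y Om) \<le> t" for y
  proof -
    obtain z where z: "z \<in> A" "psd z" "psd (id_blinfun - z)" "psd (z + l *\<^sub>R id_blinfun + y)"
      "\<And>f. inner (z f) f \<le> (norm (y f))\<^sup>2 / l\<^sup>2" by (rule rational_absolute_value[OF y l(1)]) (assumption | rule that)+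
    have zO: "inner (z Om) Om \<le> d"
    proof -
      have "(norm (y Om))\<^sup>2 \<le> t * 1" unfolding power2_eq_square using yt t by (intro mult_mono) auto
      also have "\<dots> \<le> d * l\<^sup>2" using t by simp
      finally show ?thesis using z(5)[of Om] l by (smt (verit) divide_le_eq zero_less_power)
    qed
    have lO: "l * inner Om Om \<le> d"
    proof -
      have "inner Om Om \<le> 1" using norm_Om by (metis norm_ge_zero power2_norm_eq_inner power_le_one)
      then have "l * inner Om Om \<le> l * 1" using l by (intro mult_left_mono) auto
      then show ?thesis using l by linarith
    qed
    have yO: "inner (y Om) Om \<le> d"
    proof -
      have "inner (y Om) Om \<le> norm (y Om) * norm Om" by (rule norm_cauchy_schwarz)
      also have "\<dots> \<le> norm (y Om) * 1" using norm_Om by (intro mult_left_mono) auto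
      finally show ?thesis using yt t by simp
    qed
    define a where "a = (1/3) *\<^sub>R (z + l *\<^sub>R id_blinfun + y)"
    define b where "b = (1/3) *\<^sub>R (z + l *\<^sub>R id_blinfun)"
    have aA: "a \<in> A" "b \<in> A" using z y by (auto simp: a_def b_def intro!: A_intros)
    have pa: "psd a" "psd b" using z l by (auto simp: a_def b_def)
    have "id_blinfun - a = (1/3) *\<^sub>R ((id_blinfun - z) + ((1 - l) *\<^sub>R id_blinfun + (id_blinfun - y)))"
      by (intro blinfun_eqI) (simp add: a_def bl_simps algebra_simps flip: scaleR_add_left)
    then have pa1: "psd (id_blinfun - a)" using z y l by simp
    have "id_blinfun - b = (1/3) *\<^sub>R ((id_blinfun - z) + ((1 - l) *\<^sub>R id_blinfun + id_blinfun))"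
      by (intro blinfun_eqI) (simp add: b_def bl_simps algebra_simps flip: scaleR_add_left)
    then have pb1: "psd (id_blinfun - b)" using z y l by simp
    have "\<bar>psi a\<bar> \<le> e / 6" using zO lO yO by (intro d(2) aA pa pa1) (simp add: a_def bl_simps)
    moreover have "\<bar>psi b\<bar> \<le> e / 6" using zO lO d by (intro d(2) aA pa pb1) (simp add: b_def bl_simps)
    moreover have "y = 3 *\<^sub>R (a - b)" by (simp add: a_def b_def algebra_simps)
    then have "psi y = 3 * (psi a - psi b)" using psi_scale[of "a - b" 3] psi_diff[of a b] aA pa by (simp add: A_diff psd_def)
    ultimately have "psi y \<le> 3 * (e / 3)" "3 * (- (e / 3)) \<le> psi y" by (simp_all add: abs_le_iff)
    then show ?thesis by (simp add: abs_le_iff)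
  qed
  then show ?thesis using t(1) by blast
qed

text \<open>Continuity on the ball gives a bound \<open>e' + C0 ||y Om||\<close>, as the
  minimisation requires. Multiplied by \<open>C\<close>, the first-order condition reads
  \<open>psi z - <z Om, C p> <= C l - C ||p||^2\<close> on the ball, and a large \<open>C\<close>
  makes the right side at most \<open>e\<close>.\<close>

lemma psi_approx:
  assumes e: "e > 0"
  shows "\<exists>p\<in>closure ((\<lambda>y. blinfun_apply y Om) ` A). \<forall>y\<in>A. symm y \<longrightarrow> psd (id_blinfun - y) \<longrightarrow> psd (id_blinfun + y) \<longrightarrow>
    \<bar>psi y - inner (y Om) p\<bar> \<le> e"
proof -
  define Y where "Y = {y \<in> A. symm y \<and> psd (id_blinfun - y) \<and> psd (id_blinfun + y)}"
  define e' where "e' = e / 2"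
  have e': "e' > 0" using e by (simp add: e'_def)
  obtain d where d: "d > 0" "\<And>y. y \<in> Y \<Longrightarrow> norm (y Om) \<le> d \<Longrightarrow> \<bar>psi y\<bar> \<le> e'"
    using psi_continuous[OF e'] unfolding Y_def by blast
  have Yminus: "- y \<in> Y" if "y \<in> Y" for y using that by (auto simp: Y_def A_minus)
  have "convex Y" unfolding convex_alt
  proof (intro ballI allI impI)
    fix x y :: "'k \<Rightarrow>\<^sub>L 'k" and u :: real assume xy: "x \<in> Y" "y \<in> Y" and u: "0 \<le> u \<and> u \<le> 1"
    have "id_blinfun - ((1 - u) *\<^sub>R x + u *\<^sub>R y) = (1 - u) *\<^sub>R (id_blinfun - x) + u *\<^sub>R (id_blinfun - y)"
      "id_blinfun + ((1 - u) *\<^sub>R x + u *\<^sub>R y) = (1 - u) *\<^sub>R (id_blinfun + x) + u *\<^sub>R (id_blinfun + y)"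
      by (simp_all add: algebra_simps)
    then show "(1 - u) *\<^sub>R x + u *\<^sub>R y \<in> Y" using xy u by (simp add: Y_def A_add A_scale)
  qed
  have Y0: "0 \<in> Y" by (simp add: Y_def A_0)
  have bd: "\<bar>psi y\<bar> \<le> e' + (e' / d) * norm (y Om)" if y: "y \<in> Y" for y
  proof (cases "norm (y Om) \<le> d")
    case True
    have "0 \<le> (e' / d) * norm (y Om)" using e' d by simp
    then show ?thesis using d(2)[OF y True] by linarith
  next
    case False
    \<comment> \<open>Shrinks \<open>y\<close> until the norm at \<open>Om\<close> equals
      \<open>d\<close>.\<close>
    define r where "r = d / norm (y Om)"
    have n: "norm (y Om) > d" "norm (y Om) > 0" using False d by auto
    have r: "0 < r" "r < 1" using n d by (auto simp: r_def)
    have "(1 - r) *\<^sub>R 0 + r *\<^sub>R y \<in> Y" using \<open>convex Y\<close> Y0 y r unfolding convex_alt by (meson less_imp_le)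
    then have "r *\<^sub>R y \<in> Y" by simp
    then have "\<bar>psi (r *\<^sub>R y)\<bar> \<le> e'" using n r d(1) by (intro d(2)) (auto simp: r_def bl_simps)
    then have "r * \<bar>psi y\<bar> \<le> e'" using y r by (simp add: Y_def psi_scale abs_mult)
    then have "\<bar>psi y\<bar> \<le> (e' / d) * norm (y Om)" using n d by (simp add: r_def field_simps)
    then show ?thesis using e' by linarith
  qed
  define C0 where "C0 = e' / d"
  \<comment> \<open>Any value from \<open>C0^2 / (4 e')\<close> on gives
    \<open>C0 t <= e' + C t^2\<close> for all \<open>t\<close>.\<close>
  define C where "C = C0\<^sup>2 / (4 * e') + 1"
  have C: "C > 0" using e' by (simp add: C_def add_nonneg_pos)
  obtain p l w where w: "\<And>n::nat. w n \<in> Y" "(\<lambda>n. blinfun_apply (w n) Om) \<longlonglongrightarrow> p" "(\<lambda>n. psi (w n) / C) \<longlonglongrightarrow> l"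
    and le: "\<And>z. z \<in> Y \<Longrightarrow> psi z / C - inner p (z Om) \<le> l - (norm p)\<^sup>2"
  proof (rule convex_minimization[of Y "\<lambda>y. blinfun_apply y Om" "\<lambda>y. psi y / C" "e' / C" "C0 / C"])
    show "psi y / C \<le> e' / C + C0 / C * norm (y Om)" if "y \<in> Y" for y
    proof -
      have "psi y \<le> e' + C0 * norm (y Om)" using bd[OF that] by (simp add: C0_def)
      then have "psi y / C \<le> (e' + C0 * norm (y Om)) / C" using C by (simp add: divide_right_mono)
      then show ?thesis by (simp add: add_divide_distrib)
    qed
    show "psi ((1 - t) *\<^sub>R y + t *\<^sub>R z) / C = (1 - t) * (psi y / C) + t * (psi z / C)" if "y \<in> Y" "z \<in> Y" for y z t
      using that by (simp add: Y_def psi_add psi_scale A_scale add_divide_distrib)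
  qed (use Y0 \<open>convex Y\<close> in \<open>auto simp: bl_simps\<close>)
  have "C * l \<le> e' + C0 * norm p"
  proof (rule LIMSEQ_le)
    show "(\<lambda>n. C * (psi (w n) / C)) \<longlonglongrightarrow> C * l" by (intro tendsto_mult tendsto_const w)
    show "(\<lambda>n. e' + C0 * norm (w n Om)) \<longlonglongrightarrow> e' + C0 * norm p" by (intro tendsto_intros w)
    show "\<exists>N. \<forall>n\<ge>N. C * (psi (w n) / C) \<le> e' + C0 * norm (w n Om)"
      using bd[OF w(1)] C by (simp add: C0_def abs_le_iff)
  qed
  moreover have "C0 * norm p \<le> e' + C * (norm p)\<^sup>2"
  proof -
    have "0 \<le> (norm p * C0 / (2 * e') - 1)\<^sup>2 * e'" using e' by simp
    also have "\<dots> = C0\<^sup>2 / (4 * e') * (norm p)\<^sup>2 - C0 * norm p + e'" using e' by (simp add: power2_eq_square field_simps)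
    also have "\<dots> \<le> C * (norm p)\<^sup>2 - C0 * norm p + e'" by (simp add: C_def algebra_simps)
    finally show ?thesis by simp
  qed
  ultimately have small: "C * l - C * (norm p)\<^sup>2 \<le> e" by (simp add: e'_def)
  have up: "psi z - inner (z Om) (C *\<^sub>R p) \<le> e" if "z \<in> Y" for z
  proof -
    have "C * (psi z / C - inner p (z Om)) \<le> C * (l - (norm p)\<^sup>2)" using le[OF that] C by (intro mult_left_mono) auto
    also have "\<dots> \<le> e" using small by (simp add: algebra_simps)
    finally show ?thesis using C by (simp add: algebra_simps inner_commute)
  qed
  \<comment> \<open>The ball is symmetric, so the one-sided estimate at \<open>- z\<close> gives the
    other half.\<close>
  have "\<bar>psi z - inner (z Om) (C *\<^sub>R p)\<bar> \<le> e" if "z \<in> Y" for z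
  proof -
    have "psi (- z) = - psi z" using psi_scale[of z "-1"] that by (simp add: Y_def)
    then show ?thesis using up[OF that] up[OF Yminus[OF that]] by (simp add: bl_simps abs_le_iff)
  qed
  moreover have "C *\<^sub>R p \<in> closure ((\<lambda>y. blinfun_apply y Om) ` A)" unfolding closure_sequential
  proof (intro exI conjI allI)
    show "(\<lambda>n. (C *\<^sub>R w n) Om) \<longlonglongrightarrow> C *\<^sub>R p" by (simp add: bl_simps, intro tendsto_scaleR tendsto_const w)
    show "(C *\<^sub>R w n) Om \<in> (\<lambda>y. blinfun_apply y Om) ` A" for n using w(1)[of n] by (auto simp: Y_def A_scale)
  qed
  ultimately show ?thesis unfolding Y_def by blast
qed

end

section \<open>Normal functionals as sums of vector functionals\<close>

text \<open>A maximiser up to a factor 2 exists even where the supremum is not attained; it drives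
  the exhaustion arguments. If the supremum is 0, every element will do.\<close>

lemma half_sup_attained:
  fixes S :: "real set"
  assumes "S \<noteq> {}" "\<And>s. s \<in> S \<Longrightarrow> 0 \<le> s" "\<And>s. s \<in> S \<Longrightarrow> s \<le> B"
  shows "\<exists>s\<in>S. \<forall>t\<in>S. t \<le> 2 * s"
proof -
  have bdd: "bdd_above S" using assms(3) by (auto simp: bdd_above_def)
  have up: "t \<le> Sup S" if "t \<in> S" for t using cSup_upper[OF that bdd] .
  show ?thesis
  proof (cases "Sup S \<le> 0")
    case True
    obtain s where "s \<in> S" using assms(1) by blast
    then show ?thesis using up True assms(2) by (intro bexI[of _ s]) force+
  next
    case False
    then obtain s where "s \<in> S" "Sup S / 2 < s" using less_cSup_iff[OF assms(1) bdd, of "Sup S / 2"] by auto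
    then show ?thesis using up by (intro bexI[of _ s]) force+
  qed
qed

section \<open>Real operator algebras and their positive functionals\<close>

locale op_algebra =
  fixes M :: "('h::{real_inner,banach} \<Rightarrow>\<^sub>L 'h) set"
  assumes M_id: "id_blinfun \<in> M"
    and M_add: "x \<in> M \<Longrightarrow> y \<in> M \<Longrightarrow> x + y \<in> M"
    and M_scale: "x \<in> M \<Longrightarrow> r *\<^sub>R x \<in> M"
    and M_comp: "x \<in> M \<Longrightarrow> y \<in> M \<Longrightarrow> x o\<^sub>L y \<in> M"
    and M_adj: "x \<in> M \<Longrightarrow> \<exists>x'\<in>M. \<forall>f g. inner (blinfun_apply x f) g = inner f (blinfun_apply x' g)"
    and M_lim: "(\<And>n. X n \<in> M) \<Longrightarrow> (\<And>f. (\<lambda>n. blinfun_apply (X n) f) \<longlonglongrightarrow> blinfun_apply z f) \<Longrightarrow> z \<in> M"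
begin

lemma M_minus: "x \<in> M \<Longrightarrow> - x \<in> M"
  using M_scale[of x "-1"] by simp

lemma M_diff: "x \<in> M \<Longrightarrow> y \<in> M \<Longrightarrow> x - y \<in> M"
  using M_add[of x "- y"] M_minus by simp

lemma M_0: "0 \<in> M"
  using M_scale[OF M_id, of 0] by simp

lemmas M_intros = M_id M_0 M_add M_scale M_comp M_minus M_diff

lemma subspace_M: "subspace M"
  by (auto simp: subspace_def intro: M_intros)

definition adj :: "('h \<Rightarrow>\<^sub>L 'h) \<Rightarrow> ('h \<Rightarrow>\<^sub>L 'h)" where
  "adj x = (SOME x'. x' \<in> M \<and> (\<forall>f g. inner (blinfun_apply x f) g = inner f (blinfun_apply x' g)))"

lemma adj:
  assumes "x \<in> M"
  shows "adj x \<in> M" "inner (x f) g = inner f (adj x g)" "inner (adj x f) g = inner f (x g)"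
proof -
  have *: "adj x \<in> M \<and> (\<forall>f g. inner (blinfun_apply x f) g = inner f (blinfun_apply (adj x) g))"
    unfolding adj_def by (rule someI_ex) (use M_adj[OF assms] in blast)
  show "adj x \<in> M" using * by (rule conjunct1)
  have "\<forall>f g. inner (blinfun_apply x f) g = inner f (blinfun_apply (adj x) g)" using * by (rule conjunct2)
  then show "inner (x f) g = inner f (adj x g)" by (elim allE)
  have "inner (x g) f = inner g (adj x f)" using * by (elim conjE allE)
  then show "inner (adj x f) g = inner f (x g)" by (simp only: inner_commute)
qed

lemma adj_eqI:
  assumes "x \<in> M" "\<And>f g. inner (x f) g = inner f (blinfun_apply z g)"
  shows "adj x = z"
proof (rule blinfun_eqI)
  fix g
  have "inner f (adj x g) = inner f (z g)" for f using adj(2)[OF assms(1), of f g] assms(2) by simp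
  then show "adj x g = z g" using vector_eq_ldot[of "adj x g" "z g"] by simp
qed

lemma adj_add: "x \<in> M \<Longrightarrow> y \<in> M \<Longrightarrow> adj (x + y) = adj x + adj y"
  by (rule adj_eqI) (auto simp: bl_simps adj(2) M_add)

lemma adj_scale: "x \<in> M \<Longrightarrow> adj (r *\<^sub>R x) = r *\<^sub>R adj x"
  by (rule adj_eqI) (auto simp: bl_simps adj(2) M_scale)

lemma adj_comp: "x \<in> M \<Longrightarrow> y \<in> M \<Longrightarrow> adj (x o\<^sub>L y) = adj y o\<^sub>L adj x"
  by (rule adj_eqI) (auto simp: adj(2) M_comp)

lemma adj_adj: "x \<in> M \<Longrightarrow> adj (adj x) = x"
  by (rule adj_eqI) (simp_all add: adj(1,3))

lemma adj_symm: "x \<in> M \<Longrightarrow> symm x \<Longrightarrow> adj x = x"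
  by (rule adj_eqI) (auto simp: symm_def)

lemma symm_add_adj: "x \<in> M \<Longrightarrow> symm (x + adj x)"
  by (simp add: symm_def bl_simps adj(2,3))

lemma psd_adj_conj: "v \<in> M \<Longrightarrow> psd x \<Longrightarrow> psd ((adj v o\<^sub>L x) o\<^sub>L v)"
  by (rule psd_conj) (auto simp: adj)

definition pfun :: "(('h \<Rightarrow>\<^sub>L 'h) \<Rightarrow> real) \<Rightarrow> bool" where
  "pfun w \<longleftrightarrow> (\<forall>x\<in>M. \<forall>y\<in>M. w (x + y) = w x + w y) \<and> (\<forall>r. \<forall>x\<in>M. w (r *\<^sub>R x) = r * w x) \<and>
    (\<forall>x\<in>M. w (adj x) = w x) \<and> (\<forall>x\<in>M. psd x \<longrightarrow> 0 \<le> w x)"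

lemma pfunD:
  assumes "pfun w"
  shows "x \<in> M \<Longrightarrow> y \<in> M \<Longrightarrow> w (x + y) = w x + w y" "x \<in> M \<Longrightarrow> w (r *\<^sub>R x) = r * w x"
    "x \<in> M \<Longrightarrow> w (adj x) = w x" "x \<in> M \<Longrightarrow> psd x \<Longrightarrow> 0 \<le> w x"
    "x \<in> M \<Longrightarrow> y \<in> M \<Longrightarrow> w (x - y) = w x - w y" "w 0 = 0"
proof -
  show a: "x \<in> M \<Longrightarrow> y \<in> M \<Longrightarrow> w (x + y) = w x + w y" "x \<in> M \<Longrightarrow> w (r *\<^sub>R x) = r * w x"
    "x \<in> M \<Longrightarrow> w (adj x) = w x" "x \<in> M \<Longrightarrow> psd x \<Longrightarrow> 0 \<le> w x" for x y r using assms by (auto simp: pfun_def)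
  show "x \<in> M \<Longrightarrow> y \<in> M \<Longrightarrow> w (x - y) = w x - w y"
    using a(1)[of "x - y" y] by (simp add: M_diff)
  show "w 0 = 0" using a(2)[of id_blinfun 0] M_id by simp
qed

lemma pfun_le_norm:
  assumes "pfun w" "x \<in> M" "symm x" shows "w x \<le> norm x * w id_blinfun" "- w x \<le> norm x * w id_blinfun"
  using pfunD(4)[OF assms(1) _ psd_norm_minus(1)[OF assms(3)]] pfunD(4)[OF assms(1) _ psd_norm_minus(2)[OF assms(3)]] assms
  by (simp_all add: pfunD[OF assms(1)] M_intros)

lemma pfun_vec: "pfun (\<lambda>x. inner (blinfun_apply x f) f)"
  unfolding pfun_def by (auto simp: bl_simps psd_def adj(3)) (metis adj(3) inner_commute)

lemma pfun_add: "pfun w \<Longrightarrow> pfun w' \<Longrightarrow> pfun (\<lambda>x. w x + w' x)"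
  by (simp add: pfun_def algebra_simps)

lemma pfun_scale: "pfun w \<Longrightarrow> 0 \<le> r \<Longrightarrow> pfun (\<lambda>x. r * w x)"
  by (simp add: pfun_def algebra_simps)

lemma pfun_minus:
  assumes "pfun w" "pfun w'" "\<And>x. x \<in> M \<Longrightarrow> psd x \<Longrightarrow> w' x \<le> w x"
  shows "pfun (\<lambda>x. w x - w' x)"
  using assms by (simp add: pfun_def algebra_simps)

text \<open>The form in question is \<open>(u, v) \<mapsto> w (v' z u)\<close>, with
  \<open>v'\<close> the adjoint of \<open>v\<close>. The weight \<open>z\<close> lets one lemma
  serve for norms (\<open>z = 1\<close>) and for matrix entries of a positive operator.\<close>

lemma pfun_cauchy_schwarz:
  assumes w: "pfun w" and z: "z \<in> M" "psd z" and uv: "u \<in> M" "v \<in> M"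
  shows "(w ((adj v o\<^sub>L z) o\<^sub>L u))\<^sup>2 \<le> w ((adj u o\<^sub>L z) o\<^sub>L u) * w ((adj v o\<^sub>L z) o\<^sub>L v)"
proof (rule discriminant_bound)
  fix t
  have A: "(adj a o\<^sub>L z) o\<^sub>L b \<in> M" if "a \<in> M" "b \<in> M" for a b using that z adj(1) by (intro M_comp)
  have "adj ((adj v o\<^sub>L z) o\<^sub>L u) = (adj u o\<^sub>L z) o\<^sub>L v"
    using z uv by (intro adj_eqI A) (simp_all add: adj(3)[OF uv(2)] adj(2)[OF uv(1)] symmD[OF psdD(1)[OF z(2)]])
  then have s: "w ((adj u o\<^sub>L z) o\<^sub>L v) = w ((adj v o\<^sub>L z) o\<^sub>L u)" using pfunD(3)[OF w A[OF uv(2,1)]] by simp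
  let ?c = "u + t *\<^sub>R v"
  have c: "?c \<in> M" using uv by (intro M_intros)
  have "(adj ?c o\<^sub>L z) o\<^sub>L ?c = ((adj u o\<^sub>L z) o\<^sub>L u) + (t *\<^sub>R ((adj u o\<^sub>L z) o\<^sub>L v) + (t *\<^sub>R ((adj v o\<^sub>L z) o\<^sub>L u) + t\<^sup>2 *\<^sub>R ((adj v o\<^sub>L z) o\<^sub>L v)))"
    using uv by (intro blinfun_eqI) (simp add: adj_add adj_scale M_scale bl_simps power2_eq_square scaleR_add_right)
  then have "w ((adj ?c o\<^sub>L z) o\<^sub>L ?c) = w ((adj u o\<^sub>L z) o\<^sub>L u) + (t * w ((adj u o\<^sub>L z) o\<^sub>L v) + (t * w ((adj v o\<^sub>L z) o\<^sub>L u) + t\<^sup>2 * w ((adj v o\<^sub>L z) o\<^sub>L v)))"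
    using A uv by (simp add: pfunD(1,2)[OF w] M_intros)
  moreover have "0 \<le> w ((adj ?c o\<^sub>L z) o\<^sub>L ?c)" by (intro pfunD(4)[OF w] A c psd_adj_conj z)
  ultimately show "0 \<le> w ((adj u o\<^sub>L z) o\<^sub>L u) + 2 * t * w ((adj v o\<^sub>L z) o\<^sub>L u) + t\<^sup>2 * w ((adj v o\<^sub>L z) o\<^sub>L v)"
    using s by simp
qed

lemma adj_id: "adj id_blinfun = id_blinfun"
  by (rule adj_eqI) (auto simp: M_id)

end

section \<open>Normal functionals dominated by a faithful one\<close>

locale normal_algebra = op_algebra M for M :: "('h::{real_inner,banach} \<Rightarrow>\<^sub>L 'h) set" +
  fixes R :: "('h \<Rightarrow>\<^sub>L 'h) \<Rightarrow> real"
  assumes R: "pfun R" and faithful: "x \<in> M \<Longrightarrow> psd x \<Longrightarrow> R x = 0 \<Longrightarrow> x = 0"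
    and R_lim: "(\<And>n. X n \<in> M) \<Longrightarrow> (\<And>n. psd (X n)) \<Longrightarrow> (\<And>n. psd (X (Suc n) - X n)) \<Longrightarrow> z \<in> M \<Longrightarrow>
      (\<And>f. (\<lambda>n. blinfun_apply (X n) f) \<longlonglongrightarrow> blinfun_apply z f) \<Longrightarrow> (\<lambda>n. R (X n)) \<longlonglongrightarrow> R z"
begin

definition dominated :: "(('h \<Rightarrow>\<^sub>L 'h) \<Rightarrow> real) \<Rightarrow> bool" where
  "dominated w \<longleftrightarrow> pfun w \<and> (\<forall>x\<in>M. psd x \<longrightarrow> w x \<le> R x)"

text \<open>\<open>0 <= w (z - X n) <= R (z - X n)\<close>, and the right side tends to 0:
  domination passes normality on.\<close>

lemma dominated_lim:
  assumes w: "dominated w" and X: "\<And>n. X n \<in> M" "\<And>n. psd (X n)" "\<And>n. psd (X (Suc n) - X n)" and z: "z \<in> M"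
    and lim: "\<And>f. (\<lambda>n. blinfun_apply (X n) f) \<longlonglongrightarrow> blinfun_apply z f"
  shows "(\<lambda>n. w (X n)) \<longlonglongrightarrow> w z"
proof -
  have p: "pfun w" using w by (simp add: dominated_def)
  have zX: "psd (z - X n)" for n by (rule psd_increasing_limit[of X, OF X(3) lim])
  have "(\<lambda>n. w (z - X n)) \<longlonglongrightarrow> 0"
  proof (rule tendsto_sandwich[of "\<lambda>_. 0" _ _ "\<lambda>n. R z - R (X n)"])
    show "\<forall>\<^sub>F n in sequentially. 0 \<le> w (z - X n)" using pfunD(4)[OF p] zX z X(1) by (simp add: M_diff)
    show "\<forall>\<^sub>F n in sequentially. w (z - X n) \<le> R z - R (X n)"
      using w zX z X(1) by (auto simp: dominated_def M_diff simp flip: pfunD(5)[OF R])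
    show "(\<lambda>n. R z - R (X n)) \<longlonglongrightarrow> 0" using tendsto_diff[OF tendsto_const R_lim[OF X z lim], of "R z"] by simp
  qed simp
  then have "(\<lambda>n. w z - w (z - X n)) \<longlonglongrightarrow> w z - 0" by (intro tendsto_diff tendsto_const)
  then show ?thesis using z X(1) by (simp add: pfunD(5)[OF p])
qed

text \<open>An exhaustion along which \<open>R\<close> grows as fast as possible, up to a factor 2. Faithfulness of
  \<open>R\<close> thus replaces Zorn's lemma.\<close>

lemma maximal_nonpositive:
  assumes d: "d \<in> M" "psd d"
    and \<delta>: "\<And>x y. x \<in> M \<Longrightarrow> y \<in> M \<Longrightarrow> \<delta> (x + y) = \<delta> x + \<delta> y"
    and \<delta>_lim: "\<And>X z. (\<And>n. X n \<in> M) \<Longrightarrow> (\<And>n. psd (X n)) \<Longrightarrow> (\<And>n. psd (X (Suc n) - X n)) \<Longrightarrow> z \<in> M \<Longrightarrow>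
      (\<And>f. (\<lambda>n. blinfun_apply (X n) f) \<longlonglongrightarrow> blinfun_apply z f) \<Longrightarrow> (\<lambda>n. \<delta> (X n)) \<longlonglongrightarrow> (\<delta> z :: real)"
  shows "\<exists>x\<in>M. psd x \<and> psd (d - x) \<and> \<delta> x \<le> 0 \<and>
    (\<forall>y\<in>M. psd y \<longrightarrow> psd (d - x - y) \<longrightarrow> \<delta> y \<le> 0 \<longrightarrow> y = 0)"
proof -
  have \<delta>0: "\<delta> 0 = 0" using \<delta>[of 0 0] M_0 by simp
  define adm where "adm x y \<longleftrightarrow> y \<in> M \<and> psd y \<and> psd (d - x - y) \<and> \<delta> y \<le> 0" for x y
  define good where "good x \<longleftrightarrow> x \<in> M \<and> psd x \<and> psd (d - x) \<and> \<delta> x \<le> 0" for x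
  have "\<exists>y. adm x y \<and> (\<forall>y'. adm x y' \<longrightarrow> R y' \<le> 2 * R y)" if x: "good x" for x
  proof -
    have "\<exists>s\<in>R ` Collect (adm x). \<forall>t\<in>R ` Collect (adm x). t \<le> 2 * s"
    proof (rule half_sup_attained[where B = "R d"])
      have "adm x 0" using x by (simp add: adm_def good_def M_0 \<delta>0)
      then show "R ` Collect (adm x) \<noteq> {}" by blast
      fix s assume "s \<in> R ` Collect (adm x)"
      then obtain y where y: "s = R y" "adm x y" by blast
      show "0 \<le> s" using y pfunD(4)[OF R] by (simp add: adm_def)
      have "psd (d - y)" using psd_intros(3)[of "d - x - y" x] y x by (simp add: adm_def good_def)
      then show "s \<le> R d" using pfunD(4)[OF R, of "d - y"] y d by (simp add: adm_def pfunD(5)[OF R] M_diff)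
    qed
    then show ?thesis by blast
  qed
  then have "\<exists>p. \<forall>x. good x \<longrightarrow> adm x (p x) \<and> (\<forall>y'. adm x y' \<longrightarrow> R y' \<le> 2 * R (p x))" by (intro choice) blast
  then obtain p where p: "\<And>x. good x \<Longrightarrow> adm x (p x)" "\<And>x y'. good x \<Longrightarrow> adm x y' \<Longrightarrow> R y' \<le> 2 * R (p x)" by blast
  define X where "X = rec_nat 0 (\<lambda>_ x. x + p x)"
  have X0: "X 0 = 0" and XS: "X (Suc n) = X n + p (X n)" for n by (simp_all add: X_def)
  have g: "good (X n)" for n
  proof (induction n)
    case 0 then show ?case using d by (simp add: X0 good_def M_0 \<delta>0)
  next
    case (Suc n)
    then show ?case using p(1)[OF Suc] by (simp add: XS good_def adm_def M_add \<delta> diff_diff_eq)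
  qed
  have XM: "X n \<in> M" and Xp: "psd (X n)" and Xd: "psd (d - X n)" for n using g[of n] by (auto simp: good_def)
  have inc: "psd (X (Suc n) - X n)" for n using p(1)[OF g[of n]] by (simp add: XS adm_def)
  have "inner (X n f) f \<le> norm d * (norm f)\<^sup>2" for n f
    using psdD(2)[OF Xd[of n], of f] inner_blinfun_le(1)[of d f] by (simp add: bl_simps)
  then have "\<exists>x. (\<forall>f. (\<lambda>n. X n f) \<longlonglongrightarrow> blinfun_apply x f) \<and> (\<forall>n. psd (x - X n))"
    by (rule monotone_convergence_op[of X "norm d", OF psdD(1)[OF Xp] inc]) blast
  then obtain x where x: "\<And>f. (\<lambda>n. X n f) \<longlonglongrightarrow> blinfun_apply x f" "\<And>n. psd (x - X n)" by blast
  have xM: "x \<in> M" using M_lim[OF XM x(1)] .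
  have xp: "psd x" using psd_limit[OF Xp x(1)] .
  have xd: "psd (d - x)"
    by (rule psd_limit[of "\<lambda>n. d - X n", OF Xd]) (unfold blinfun.diff_left, intro tendsto_diff tendsto_const x(1))
  have \<delta>x: "\<delta> x \<le> 0" by (rule lim_le[OF \<delta>_lim[OF XM Xp inc xM x(1)]]) (use g in \<open>simp add: good_def\<close>)
  have Rl: "(\<lambda>n. R (X n)) \<longlonglongrightarrow> R x" by (rule R_lim[OF XM Xp inc xM x(1)])
  have "R (p (X n)) = R (X (Suc n)) - R (X n)" for n
    using p(1)[OF g[of n]] XM[of n] by (simp add: XS adm_def pfunD(1)[OF R])
  \<comment> \<open>The increments of the convergent sequence \<open>R (X n)\<close> tend to 0,
    while a \<open>y\<close> admissible at the limit is admissible at every \<open>X n\<close>; this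
    forces \<open>R y = 0\<close>.\<close>
  then have Rp: "(\<lambda>n. 2 * R (p (X n))) \<longlonglongrightarrow> 2 * (R x - R x)"
    using Rl by (simp only:) (intro tendsto_mult tendsto_const tendsto_diff LIMSEQ_Suc)
  have "y = 0" if y: "y \<in> M" "psd y" "psd (d - x - y)" "\<delta> y \<le> 0" for y
  proof -
    have "adm (X n) y" for n
    proof -
      have "d - X n - y = (d - x - y) + (x - X n)" by simp
      then have "psd (d - X n - y)" using psd_intros(3)[OF y(3) x(2)[of n]] by (simp only:)
      then show ?thesis using y by (simp add: adm_def)
    qed
    then have "R y \<le> 2 * (R x - R x)" using p(2)[OF g] by (intro lim_ge[OF Rp]) blast
    then have "R y = 0" using pfunD(4)[OF R y(1,2)] by simp
    then show ?thesis using faithful y by blast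
  qed
  then show ?thesis using xM xp xd \<delta>x by blast
qed

text \<open>The classical construction with positive elements in place of projections. Two
  exhaustions find \<open>c\<close> with \<open>w c > 0\<close> such that
  \<open>w y <= <y f, f>\<close> whenever \<open>0 <= y <= c\<close>. Then
  \<open>x c f \<mapsto> w (x c)\<close> is bounded, and its Riesz vector is \<eta>.\<close>

lemma dominates_vector_functional:
  assumes w: "dominated w" and w1: "w id_blinfun > 0"
  shows "\<exists>\<eta>. \<eta> \<noteq> 0 \<and> (\<forall>x\<in>M. psd x \<longrightarrow> inner (x \<eta>) \<eta> \<le> w x)"
proof -
  have p: "pfun w" using w by (simp add: dominated_def)
  note wD = pfunD[OF p]
  \<comment> \<open>\<open>s\<close> is maximal among the elements on which \<open>w\<close>
    vanishes, so \<open>w\<close> is faithful below \<open>1 - s\<close>; this will give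
    \<open>w c > 0\<close>.\<close>
  obtain s where s: "s \<in> M" "psd s" "psd (id_blinfun - s)" "w s \<le> 0"
    "\<And>y. y \<in> M \<Longrightarrow> psd y \<Longrightarrow> psd (id_blinfun - s - y) \<Longrightarrow> w y \<le> 0 \<Longrightarrow> y = 0"
    using maximal_nonpositive[OF M_id psd_intros(2) wD(1) dominated_lim[OF w]] by blast
  define d where "d = id_blinfun - s"
  have d: "d \<in> M" "psd d" using s by (auto simp: d_def intro: M_intros)
  have wd: "w d > 0" using s w1 by (simp add: d_def wD(5) M_id)
  have "\<exists>g. inner (d g) g > 0"
  proof (rule ccontr)
    assume "\<not> ?thesis"
    then have "d = 0" using psd_eq_0[OF d(2)] by (meson not_le)
    then show False using wd wD(6) by simp
  qed
  then obtain g where g: "inner (d g) g > 0" by blast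
  \<comment> \<open>The scaling yields \<open><d f, f> = w d + 1\<close>, so the vector functional
    exceeds \<open>w\<close> at \<open>d\<close>, and then also at \<open>c\<close>.\<close>
  define f where "f = sqrt ((w d + 1) / inner (d g) g) *\<^sub>R g"
  have "inner (d f) f = (sqrt ((w d + 1) / inner (d g) g))\<^sup>2 * inner (d g) g"
    unfolding f_def power2_eq_square blinfun.scaleR_right inner_scaleR_left inner_scaleR_right by (simp only: mult.assoc)
  also have "\<dots> = (w d + 1) / inner (d g) g * inner (d g) g" using g wd by (subst real_sqrt_pow2) auto
  finally have "inner (d f) f = (w d + 1) / inner (d g) g * inner (d g) g" .
  then have f: "inner (d f) f > w d" using g by simp
  define \<delta> where "\<delta> x = inner (blinfun_apply x f) f - w x" for x
  have "\<exists>x\<in>M. psd x \<and> psd (d - x) \<and> \<delta> x \<le> 0 \<and> (\<forall>y\<in>M. psd y \<longrightarrow> psd (d - x - y) \<longrightarrow> \<delta> y \<le> 0 \<longrightarrow> y = 0)"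
  proof (rule maximal_nonpositive[OF d])
    show "\<delta> (x + y) = \<delta> x + \<delta> y" if "x \<in> M" "y \<in> M" for x y using that by (simp add: \<delta>_def bl_simps wD(1))
    fix X z assume X: "\<And>n. X n \<in> M" "\<And>n. psd (X n)" "\<And>n. psd (X (Suc n) - X n)" "z \<in> M"
      "\<And>f. (\<lambda>n. blinfun_apply (X n) f) \<longlonglongrightarrow> blinfun_apply z f"
    show "(\<lambda>n. \<delta> (X n)) \<longlonglongrightarrow> \<delta> z" unfolding \<delta>_def
      by (intro tendsto_diff tendsto_inner tendsto_const X(5) dominated_lim[OF w X])
  qed
  then obtain x1 where x1: "x1 \<in> M" "psd x1" "psd (d - x1)" "\<delta> x1 \<le> 0"
    "\<And>y. y \<in> M \<Longrightarrow> psd y \<Longrightarrow> psd (d - x1 - y) \<Longrightarrow> \<delta> y \<le> 0 \<Longrightarrow> y = 0" by blast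
  define c where "c = d - x1"
  have c: "c \<in> M" "psd c" using x1 d by (auto simp: c_def intro: M_intros)
  have cs: "inner (c u) v = inner u (c v)" for u v using c(2) by (simp add: psd_def symm_def)
  have \<delta>c: "\<delta> c > 0" using x1 f d by (simp add: c_def \<delta>_def bl_simps wD(5))
  have wc: "w c > 0"
  proof (rule ccontr)
    assume "\<not> ?thesis"
    moreover have "psd (id_blinfun - s - c)" using x1 by (simp add: c_def flip: d_def)
    ultimately have "c = 0" using s(5)[OF c] by simp
    then show False using \<delta>c by (simp add: \<delta>_def wD(6))
  qed
  have \<delta>pos: "w ((c o\<^sub>L x) o\<^sub>L c) \<le> inner (x (c f)) (c f)" if x: "x \<in> M" "psd x" for x
  proof -
    \<comment> \<open>\<open>c x c <= ||x|| c^2 <= ||x|| ||c|| c\<close>, so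
      \<open>c x c / k\<close> lies below \<open>c\<close>; the summand 1 keeps \<open>k\<close>
      positive.\<close>
    define k where "k = norm x * norm c + 1"
    have k: "k > 0" unfolding k_def by (simp add: add_nonneg_pos)
    define y where "y = (1 / k) *\<^sub>R ((c o\<^sub>L x) o\<^sub>L c)"
    have y: "y \<in> M" "psd y" using c x k cs unfolding y_def by (auto intro!: M_intros psd_intros psd_conj)
    have "inner ((c - y) u) u \<ge> 0" for u
    proof -
      have "inner (x (c u)) (c u) \<le> norm x * (norm (c u))\<^sup>2" by (rule inner_blinfun_le)
      also have "\<dots> \<le> norm x * (norm c * inner (c u) u)"
        by (intro mult_left_mono psd_norm_square[OF c(2)] inner_blinfun_le) auto
      also have "\<dots> \<le> k * inner (c u) u" using psdD(2)[OF c(2), of u] by (simp add: k_def algebra_simps)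
      finally show ?thesis using k by (simp add: y_def bl_simps cs field_simps)
    qed
    then have "psd (c - y)" by (rule psdI[OF symm_intros(4)[OF psdD(1)[OF c(2)] psdD(1)[OF y(2)]]])
    then have cy: "psd (d - x1 - y)" by (simp only: c_def)
    have "\<delta> y \<ge> 0"
    proof (rule ccontr)
      assume "\<not> ?thesis"
      then have "y = 0" using x1(5)[OF y cy] by simp
      then show False using \<open>\<not> 0 \<le> \<delta> y\<close> by (simp add: \<delta>_def wD(6))
    qed
    moreover have "\<delta> y = (1 / k) * (inner (x (c f)) (c f) - w ((c o\<^sub>L x) o\<^sub>L c))"
      using x c by (simp add: \<delta>_def y_def bl_simps wD(2) M_comp cs algebra_simps)
    ultimately show ?thesis using k by (simp add: zero_le_divide_iff)
  qed
  obtain \<eta> where \<eta>: "\<eta> \<in> closure ((\<lambda>x. blinfun_apply x (c f)) ` M)" "\<And>x. x \<in> M \<Longrightarrow> inner (x (c f)) \<eta> = w (x o\<^sub>L c)"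
  proof (rule riesz_on_image[OF subspace_M, of "\<lambda>x. blinfun_apply x (c f)" "\<lambda>x. w (x o\<^sub>L c)" "sqrt (w id_blinfun)"])
    fix x y r assume x: "x \<in> M"
    have *: "(x + y) o\<^sub>L c = (x o\<^sub>L c) + (y o\<^sub>L c)" "(r *\<^sub>R x) o\<^sub>L c = r *\<^sub>R (x o\<^sub>L c)" for y r
      by (auto intro!: blinfun_eqI simp: bl_simps)
    show "w ((x + y) o\<^sub>L c) = w (x o\<^sub>L c) + w (y o\<^sub>L c)" if "y \<in> M" unfolding * using x that c by (simp add: wD M_comp)
    show "w ((r *\<^sub>R x) o\<^sub>L c) = r * w (x o\<^sub>L c)" unfolding * using x c by (simp add: wD M_comp)
    have xc: "x o\<^sub>L c \<in> M" using x c by (intro M_comp)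
    \<comment> \<open>Cauchy-Schwarz for \<open>w\<close>, followed by \<open>\<delta>pos\<close>
      for \<open>adj x o\<^sub>L x\<close>, bounds the square of \<open>w (x c)\<close> by
      \<open>w 1\<close> times \<open>||x c f||^2\<close>.\<close>
    have "(w ((adj id_blinfun o\<^sub>L id_blinfun) o\<^sub>L (x o\<^sub>L c)))\<^sup>2
      \<le> w ((adj (x o\<^sub>L c) o\<^sub>L id_blinfun) o\<^sub>L (x o\<^sub>L c)) * w ((adj id_blinfun o\<^sub>L id_blinfun) o\<^sub>L id_blinfun)"
      by (rule pfun_cauchy_schwarz[OF p M_id psd_intros(2) xc M_id])
    also have "(adj id_blinfun o\<^sub>L id_blinfun) o\<^sub>L (x o\<^sub>L c) = x o\<^sub>L c" by (intro blinfun_eqI) (simp add: adj_id)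
    also have "(adj id_blinfun o\<^sub>L id_blinfun) o\<^sub>L id_blinfun = id_blinfun" by (intro blinfun_eqI) (simp add: adj_id)
    also have "(adj (x o\<^sub>L c) o\<^sub>L id_blinfun) o\<^sub>L (x o\<^sub>L c) = (c o\<^sub>L (adj x o\<^sub>L x)) o\<^sub>L c"
      using x c by (intro blinfun_eqI) (simp add: adj_comp adj_symm psdD)
    also have "w \<dots> \<le> inner ((adj x o\<^sub>L x) (c f)) (c f)"
      using x adj by (intro \<delta>pos M_comp psd_square) auto
    also have "\<dots> = (norm (x (c f)))\<^sup>2" using x by (simp add: adj(3) power2_norm_eq_inner)
    finally have "(w (x o\<^sub>L c))\<^sup>2 \<le> (sqrt (w id_blinfun) * norm (x (c f)))\<^sup>2"
      using w1 by (simp add: power_mult_distrib mult.commute)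
    then have "\<bar>w (x o\<^sub>L c)\<bar> \<le> \<bar>sqrt (w id_blinfun) * norm (x (c f))\<bar>" by (simp only: abs_le_square_iff)
    then show "\<bar>w (x o\<^sub>L c)\<bar> \<le> sqrt (w id_blinfun) * norm (x (c f))" using w1 by simp
  qed (auto simp: bl_simps)
  have "inner (c f) \<eta> = w c"
  proof -
    have "(id_blinfun o\<^sub>L c) = c" by (intro blinfun_eqI) simp
    then show ?thesis using \<eta>(2)[OF M_id] by simp
  qed
  then have "\<eta> \<noteq> 0" using wc by auto
  moreover have "inner (x \<eta>) \<eta> \<le> w x" if x: "x \<in> M" "psd x" for x
  proof -
    obtain y where y: "\<And>n::nat. y n \<in> M" "(\<lambda>n. y n (c f)) \<longlonglongrightarrow> \<eta>"
    proof -
      from \<eta>(1) obtain z where z: "\<And>n::nat. z n \<in> (\<lambda>x. blinfun_apply x (c f)) ` M" "z \<longlonglongrightarrow> \<eta>"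
        unfolding closure_sequential by blast
      then have "\<exists>y. \<forall>n. y n \<in> M \<and> z n = y n (c f)" by (intro choice) blast
      then obtain y where "\<And>n. y n \<in> M" "\<And>n. z n = y n (c f)" by blast
      moreover have "z = (\<lambda>n. y n (c f))" using calculation(2) by blast
      ultimately show ?thesis using z(2) that by blast
    qed
    let ?q = "inner (x \<eta>) \<eta>"
    \<comment> \<open>\<eta> is the limit of \<open>y n (c f)\<close>, and
      \<open><x y (c f), \<eta>> = w (x y c)\<close>. Cauchy-Schwarz with weight \<open>x\<close>
      and then \<open>\<delta>pos\<close> give the inequality in the limit; a factor
      \<open>?q\<close> cancels afterwards.\<close>
    have "?q\<^sup>2 \<le> w x * ?q"
    proof (rule LIMSEQ_le)
      show "(\<lambda>n. (inner (x (y n (c f))) \<eta>)\<^sup>2) \<longlonglongrightarrow> ?q\<^sup>2"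
        by (intro tendsto_power tendsto_inner tendsto_const op_tendsto y)
      show "(\<lambda>n. w x * inner (x (y n (c f))) (y n (c f))) \<longlonglongrightarrow> w x * ?q"
        by (intro tendsto_mult tendsto_inner tendsto_const op_tendsto y)
      have "(inner (x (y n (c f))) \<eta>)\<^sup>2 \<le> w x * inner (x (y n (c f))) (y n (c f))" for n
      proof -
        have yc: "y n o\<^sub>L c \<in> M" using y c by (intro M_comp)
        have "inner (x (y n (c f))) \<eta> = w ((x o\<^sub>L y n) o\<^sub>L c)" using \<eta>(2)[of "x o\<^sub>L y n"] x y by (simp add: M_comp)
        also have "(x o\<^sub>L y n) o\<^sub>L c = (adj id_blinfun o\<^sub>L x) o\<^sub>L (y n o\<^sub>L c)" by (intro blinfun_eqI) (simp add: adj_id)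
        finally have "(inner (x (y n (c f))) \<eta>)\<^sup>2 \<le> w ((adj (y n o\<^sub>L c) o\<^sub>L x) o\<^sub>L (y n o\<^sub>L c)) * w ((adj id_blinfun o\<^sub>L x) o\<^sub>L id_blinfun)"
          using pfun_cauchy_schwarz[OF p x yc M_id] by simp
        also have "(adj id_blinfun o\<^sub>L x) o\<^sub>L id_blinfun = x" by (intro blinfun_eqI) (simp add: adj_id)
        also have "(adj (y n o\<^sub>L c) o\<^sub>L x) o\<^sub>L (y n o\<^sub>L c) = (c o\<^sub>L ((adj (y n) o\<^sub>L x) o\<^sub>L y n)) o\<^sub>L c"
          using y c by (intro blinfun_eqI) (simp add: adj_comp adj_symm psdD)
        also have "w \<dots> * w x \<le> inner (((adj (y n) o\<^sub>L x) o\<^sub>L y n) (c f)) (c f) * w x"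
          using x y adj by (intro mult_right_mono \<delta>pos M_comp psd_adj_conj wD(4)) auto
        also have "\<dots> = w x * inner (x (y n (c f))) (y n (c f))" using y by (simp add: adj(3))
        finally show ?thesis .
      qed
      then show "\<exists>N. \<forall>n\<ge>N. (inner (x (y n (c f))) \<eta>)\<^sup>2 \<le> w x * inner (x (y n (c f))) (y n (c f))" by blast
    qed
    moreover have "?q \<ge> 0" "w x \<ge> 0" using psdD(2)[OF x(2)] wD(4)[OF x] by auto
    ultimately show ?thesis by (cases "?q = 0") (auto simp: power2_eq_square)
  qed
  ultimately show ?thesis by blast
qed

text \<open>Vector functionals are subtracted greedily, each of nearly maximal norm among those
  below the remainder. If the limit \<open>V\<close> of the remainders were nonzero, a nonzero
  vector functional below \<open>V\<close> would lie below every remainder, so its norm would be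
  controlled by those of the \<open>g n\<close>, which tend to 0.\<close>

lemma vector_representation:
  assumes w: "dominated w"
  shows "\<exists>g. \<forall>x\<in>M. psd x \<longrightarrow> (\<lambda>n::nat. inner (x (g n)) (g n)) sums w x"
proof -
  define below where "below W f \<longleftrightarrow> (\<forall>x\<in>M. psd x \<longrightarrow> inner (x f) f \<le> W x)" for W :: "('h \<Rightarrow>\<^sub>L 'h) \<Rightarrow> real" and f
  have "\<exists>f. below W f \<and> (\<forall>f'. below W f' \<longrightarrow> (norm f')\<^sup>2 \<le> 2 * (norm f)\<^sup>2)" if W: "pfun W" for W
  proof -
    have "\<exists>s\<in>(\<lambda>f. (norm f)\<^sup>2) ` Collect (below W). \<forall>t\<in>(\<lambda>f. (norm f)\<^sup>2) ` Collect (below W). t \<le> 2 * s"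
    proof (rule half_sup_attained[where B = "W id_blinfun"])
      have "below W 0" using pfunD(4)[OF W] by (simp add: below_def)
      then show "(\<lambda>f. (norm f)\<^sup>2) ` Collect (below W) \<noteq> {}" by blast
    qed (use M_id in \<open>auto simp: below_def power2_norm_eq_inner dest!: bspec[where x = id_blinfun]\<close>)
    then show ?thesis by blast
  qed
  then have "\<exists>p. \<forall>W. pfun W \<longrightarrow> below W (p W) \<and> (\<forall>f'. below W f' \<longrightarrow> (norm f')\<^sup>2 \<le> 2 * (norm (p W))\<^sup>2)"
    by (intro choice) blast
  then obtain p where p: "\<And>W. pfun W \<Longrightarrow> below W (p W)"
    "\<And>W f'. pfun W \<Longrightarrow> below W f' \<Longrightarrow> (norm f')\<^sup>2 \<le> 2 * (norm (p W))\<^sup>2" by blast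
  define W where "W = rec_nat w (\<lambda>_ v x. v x - inner (x (p v)) (p v))"
  define g where "g n = p (W n)" for n
  have W0: "W 0 = w" and WS: "W (Suc n) = (\<lambda>x. W n x - inner (x (g n)) (g n))" for n by (simp_all add: W_def g_def)
  have Wp: "pfun (W n)" for n
  proof (induction n)
    case 0 then show ?case using w by (simp add: W0 dominated_def)
  next
    case (Suc n)
    then show ?case unfolding WS using p(1)[OF Suc] by (intro pfun_minus pfun_vec) (auto simp: below_def g_def)
  qed
  have Weq: "W n x = w x - (\<Sum>k<n. inner (x (g k)) (g k))" for n x
    by (induction n) (simp_all add: W0 WS)
  have sg: "summable (\<lambda>k. (norm (g k))\<^sup>2)"
  proof (rule summableI_nonneg_bounded)
    show "(\<Sum>k<n. (norm (g k))\<^sup>2) \<le> w id_blinfun" for n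
      using pfunD(4)[OF Wp[of n] M_id] Weq[of n id_blinfun] by (simp add: power2_norm_eq_inner)
  qed simp
  have sx: "summable (\<lambda>k. inner (blinfun_apply x (g k)) (g k))" for x
  proof (rule summable_comparison_test'[of "\<lambda>k. norm x * (norm (g k))\<^sup>2"])
    show "summable (\<lambda>k. norm x * (norm (g k))\<^sup>2)" using sg by (rule summable_mult)
    show "norm (inner (x (g k)) (g k)) \<le> norm x * (norm (g k))\<^sup>2" if "k \<ge> 0" for k using inner_blinfun_le(2)[of x "g k"] by simp
  qed
  define V where "V x = w x - (\<Sum>k. inner (x (g k)) (g k))" for x
  have VW: "(\<lambda>n. W n x) \<longlonglongrightarrow> V x" for x
    unfolding Weq V_def by (intro tendsto_diff tendsto_const summable_LIMSEQ sx)
  have VleW: "V x \<le> W n x" if "x \<in> M" "psd x" for n x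
    unfolding V_def Weq using sum_le_suminf[OF sx, of "{..<n}" x] that by (simp add: psd_def)
  have Vp: "pfun V" unfolding pfun_def
  proof (intro conjI ballI allI impI)
    fix x y r assume x: "x \<in> M"
    show "V (x + y) = V x + V y" if y: "y \<in> M"
    proof -
      have "(\<lambda>n. W n (x + y)) = (\<lambda>n. W n x + W n y)" using x y pfunD(1)[OF Wp] by blast
      then show ?thesis using VW[of "x + y"] tendsto_add[OF VW[of x] VW[of y]] LIMSEQ_unique by metis
    qed
    show "V (r *\<^sub>R x) = r * V x"
    proof -
      have "(\<lambda>n. W n (r *\<^sub>R x)) = (\<lambda>n. r * W n x)" using x pfunD(2)[OF Wp] by blast
      then show ?thesis using VW[of "r *\<^sub>R x"] tendsto_mult[OF tendsto_const VW[of x], of r] LIMSEQ_unique by metis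
    qed
    show "V (adj x) = V x"
    proof -
      have "(\<lambda>n. W n (adj x)) = (\<lambda>n. W n x)" using x pfunD(3)[OF Wp] by blast
      then show ?thesis using VW[of "adj x"] VW[of x] LIMSEQ_unique by metis
    qed
    show "0 \<le> V x" if "psd x" by (rule lim_ge[OF VW]) (rule pfunD(4)[OF Wp x that])
  qed
  have Vd: "dominated V" unfolding dominated_def
  proof (intro conjI ballI impI Vp)
    fix x assume x: "x \<in> M" "psd x"
    have "V x \<le> w x" using VleW[OF x, of 0] by (simp add: W0)
    then show "V x \<le> R x" using w x by (force simp: dominated_def)
  qed
  have V1: "V id_blinfun \<le> 0"
  proof (rule ccontr)
    assume "\<not> ?thesis"
    then obtain f where f: "f \<noteq> 0" "\<And>x. x \<in> M \<Longrightarrow> psd x \<Longrightarrow> inner (x f) f \<le> V x"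
      using dominates_vector_functional[OF Vd] by (metis not_le)
    have "below (W n) f" for n unfolding below_def using f(2) VleW by (meson order_trans)
    then have "(norm f)\<^sup>2 \<le> 2 * (norm (g n))\<^sup>2" for n using p(2)[OF Wp] by (simp add: g_def)
    moreover have "(\<lambda>n. 2 * (norm (g n))\<^sup>2) \<longlonglongrightarrow> 2 * 0" by (intro tendsto_mult tendsto_const summable_LIMSEQ_zero sg)
    ultimately have "(norm f)\<^sup>2 \<le> 2 * 0" by (meson lim_ge)
    then show False using f(1) by simp
  qed
  have "V x = 0" if "x \<in> M" "psd x" for x
  proof -
    have "V x \<le> norm x * V id_blinfun" using pfun_le_norm(1)[OF Vp that(1) psdD(1)[OF that(2)]] .
    also have "\<dots> \<le> 0" using V1 by (simp add: mult_nonneg_nonpos)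
    finally show ?thesis using pfunD(4)[OF Vp that] by simp
  qed
  then have "(\<lambda>n. inner (x (g n)) (g n)) sums w x" if "x \<in> M" "psd x" for x
    using that summable_sums[OF sx, of x] by (simp add: V_def)
  then show ?thesis by blast
qed

end

section \<open>Square-summable sequences\<close>

typedef (overloaded) 'a ell2 = "{f :: nat \<Rightarrow> 'a::real_inner. summable (\<lambda>n. (norm (f n))\<^sup>2)}"
  morphisms coord Abs_ell2
  by (rule exI[of _ "\<lambda>_. 0"]) simp

lemma coord_summable: "summable (\<lambda>n. (norm (coord k n))\<^sup>2)"
  using coord[of k] by simp

lemma coord_Abs: "summable (\<lambda>n. (norm (f n))\<^sup>2) \<Longrightarrow> coord (Abs_ell2 f) = f"
  by (simp add: Abs_ell2_inverse)

lemma ell2_eqI: "(\<And>n. coord k n = coord l n) \<Longrightarrow> k = l"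
  by (metis coord_inverse ext)

lemma summable_norm_add:
  fixes f g :: "nat \<Rightarrow> 'a::real_inner"
  assumes "summable (\<lambda>n. (norm (f n))\<^sup>2)" "summable (\<lambda>n. (norm (g n))\<^sup>2)"
  shows "summable (\<lambda>n. (norm (f n + g n))\<^sup>2)"
proof (rule summable_comparison_test'[of "\<lambda>n. 2 * (norm (f n))\<^sup>2 + 2 * (norm (g n))\<^sup>2" 0])
  show "summable (\<lambda>n. 2 * (norm (f n))\<^sup>2 + 2 * (norm (g n))\<^sup>2)"
    using assms by (intro summable_add summable_mult)
  have "(norm (f n + g n))\<^sup>2 \<le> 2 * (norm (f n))\<^sup>2 + 2 * (norm (g n))\<^sup>2" for n
  proof -
    have "(norm (f n + g n))\<^sup>2 + inner (f n - g n) (f n - g n) = 2 * (norm (f n))\<^sup>2 + 2 * (norm (g n))\<^sup>2"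
      unfolding power2_norm_eq_inner by (simp add: inner_add_left inner_add_right inner_diff_left inner_diff_right inner_commute)
    moreover have "0 \<le> inner (f n - g n) (f n - g n)" by simp
    ultimately show ?thesis by linarith
  qed
  then show "norm ((norm (f n + g n))\<^sup>2) \<le> 2 * (norm (f n))\<^sup>2 + 2 * (norm (g n))\<^sup>2" if "n \<ge> 0" for n by simp
qed

lemma summable_norm_scaleR:
  fixes f :: "nat \<Rightarrow> 'a::real_inner"
  assumes "summable (\<lambda>n. (norm (f n))\<^sup>2)"
  shows "summable (\<lambda>n. (norm (r *\<^sub>R f n))\<^sup>2)"
  using summable_mult[OF assms, of "r\<^sup>2"] by (simp add: power_mult_distrib)

lemma summable_inner:
  fixes f g :: "nat \<Rightarrow> 'a::real_inner"
  assumes "summable (\<lambda>n. (norm (f n))\<^sup>2)" "summable (\<lambda>n. (norm (g n))\<^sup>2)"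
  shows "summable (\<lambda>n. inner (f n) (g n))"
proof (rule summable_comparison_test'[of "\<lambda>n. (norm (f n))\<^sup>2 + (norm (g n))\<^sup>2" 0])
  show "summable (\<lambda>n. (norm (f n))\<^sup>2 + (norm (g n))\<^sup>2)" using assms by (rule summable_add)
  have "\<bar>inner (f n) (g n)\<bar> \<le> (norm (f n))\<^sup>2 + (norm (g n))\<^sup>2" for n
  proof -
    have "0 \<le> (norm (f n) - norm (g n))\<^sup>2" "0 \<le> (norm (f n))\<^sup>2" "0 \<le> (norm (g n))\<^sup>2" by simp_all
    then show ?thesis using Cauchy_Schwarz_ineq2[of "f n" "g n"] unfolding power2_diff by linarith
  qed
  then show "norm (inner (f n) (g n)) \<le> (norm (f n))\<^sup>2 + (norm (g n))\<^sup>2" if "n \<ge> 0" for n by simp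
qed

instantiation ell2 :: (real_inner) real_inner
begin

definition "0 = Abs_ell2 (\<lambda>_. 0)"
definition "k + l = Abs_ell2 (\<lambda>n. coord k n + coord l n)"
definition "- k = Abs_ell2 (\<lambda>n. - coord k n)"
definition "k - l = Abs_ell2 (\<lambda>n. coord k n - coord l n)"
definition "r *\<^sub>R k = Abs_ell2 (\<lambda>n. r *\<^sub>R coord k n)"
definition "inner k l = (\<Sum>n. inner (coord k n) (coord l n))"
definition "norm k = sqrt (inner k k)" for k :: "'a ell2"
definition "dist k l = norm (k - l)" for k l :: "'a ell2"
definition "sgn k = scaleR (inverse (norm k)) k" for k :: "'a ell2"
definition "(uniformity :: ('a ell2 \<times> 'a ell2) filter) = (INF e\<in>{0 <..}. principal {(x, y). dist x y < e})"
definition "open U \<longleftrightarrow> (\<forall>x\<in>U. \<forall>\<^sub>F (x', y) in uniformity. x' = x \<longrightarrow> y \<in> U)" for U :: "'a ell2 set"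

lemma coord_simps [simp]:
  "coord 0 n = 0" "coord (k + l) n = coord k n + coord l n" "coord (- k) n = - coord k n"
  "coord (k - l) n = coord k n - coord l n" "coord (r *\<^sub>R k) n = r *\<^sub>R coord k n"
proof -
  have m: "summable (\<lambda>n. (norm (- coord k n))\<^sup>2)" for k :: "'a ell2" by (simp add: coord_summable)
  show "coord 0 n = 0" by (simp add: zero_ell2_def coord_Abs)
  show "coord (k + l) n = coord k n + coord l n"
    by (simp add: plus_ell2_def coord_Abs summable_norm_add coord_summable)
  show "coord (- k) n = - coord k n" by (simp add: uminus_ell2_def coord_Abs coord_summable)
  show "coord (k - l) n = coord k n - coord l n"
    using summable_norm_add[OF coord_summable m, of k l] by (simp add: minus_ell2_def coord_Abs)
  show "coord (r *\<^sub>R k) n = r *\<^sub>R coord k n"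
    using summable_norm_scaleR[OF coord_summable, of r k] by (simp add: scaleR_ell2_def coord_Abs)
qed

instance
proof
  fix x y z :: "'a ell2" and r s :: real
  have s: "summable (\<lambda>n. inner (coord x n) (coord y n))" for x y :: "'a ell2"
    by (intro summable_inner coord_summable)
  show "x + y + z = x + (y + z)" "x + y = y + x" "0 + x = x" "- x + x = 0" "x - y = x + - y"
    "r *\<^sub>R (x + y) = r *\<^sub>R x + r *\<^sub>R y" "(r + s) *\<^sub>R x = r *\<^sub>R x + s *\<^sub>R x" "r *\<^sub>R s *\<^sub>R x = (r * s) *\<^sub>R x" "1 *\<^sub>R x = x"
    by (auto intro!: ell2_eqI simp: algebra_simps)
  show "dist x y = norm (x - y)" "sgn x = scaleR (inverse (norm x)) x" "norm x = sqrt (inner x x)"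
    by (simp_all add: dist_ell2_def sgn_ell2_def norm_ell2_def)
  show "(uniformity :: ('a ell2 \<times> 'a ell2) filter) = (INF e\<in>{0 <..}. principal {(x, y). dist x y < e})"
    by (rule uniformity_ell2_def)
  show "open U \<longleftrightarrow> (\<forall>x\<in>U. \<forall>\<^sub>F (x', y) in uniformity. x' = x \<longrightarrow> y \<in> U)" for U :: "'a ell2 set"
    by (rule open_ell2_def)
  show "inner x y = inner y x" by (simp add: inner_ell2_def inner_commute)
  show "inner (x + y) z = inner x z + inner y z" by (simp add: inner_ell2_def inner_add_left suminf_add s)
  show "inner (r *\<^sub>R x) y = r * inner x y" by (simp add: inner_ell2_def suminf_mult s)
  show "0 \<le> inner x x" unfolding inner_ell2_def by (intro suminf_nonneg s) simp
  show "inner x x = 0 \<longleftrightarrow> x = 0"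
  proof
    assume "inner x x = 0"
    then have "\<forall>n. inner (coord x n) (coord x n) = 0"
      unfolding inner_ell2_def using suminf_eq_zero_iff[OF s[of x x]] by simp
    then show "x = 0" by (intro ell2_eqI) simp
  qed (simp add: inner_ell2_def)
qed

end

lemma coord_inner_sums: "(\<lambda>n. inner (coord k n) (coord l n)) sums inner k l"
  unfolding inner_ell2_def by (intro summable_sums summable_inner coord_summable)

lemma norm_coord_le: "norm (coord k n) \<le> norm k"
proof -
  have "(norm (coord k n))\<^sup>2 \<le> (norm k)\<^sup>2"
    using sum_le_suminf[OF sums_summable[OF coord_inner_sums], of "{n}" k k]
    by (simp add: power2_norm_eq_inner inner_ell2_def)
  then show ?thesis by (simp add: power2_le_iff_abs_le)
qed

lemma norm_ell2_le:
  assumes s: "summable (\<lambda>n. (norm (f n))\<^sup>2)" and "0 \<le> B" "(\<Sum>n. (norm (f n))\<^sup>2) \<le> B\<^sup>2"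
  shows "norm (Abs_ell2 f) \<le> B"
proof -
  have "(norm (Abs_ell2 f))\<^sup>2 \<le> B\<^sup>2"
    using assms by (simp add: power2_norm_eq_inner inner_ell2_def coord_Abs)
  then show ?thesis using assms(2) by (simp add: power2_le_iff_abs_le)
qed

instance ell2 :: ("{real_inner, banach}") banach
proof
  fix X :: "nat \<Rightarrow> 'a ell2" assume X: "Cauchy X"
  have c: "Cauchy (\<lambda>m. coord (X m) n)" for n
  proof (rule metric_CauchyI)
    fix e :: real assume "e > 0"
    then obtain N where N: "\<And>i j. i \<ge> N \<Longrightarrow> j \<ge> N \<Longrightarrow> norm (X i - X j) < e" using X by (meson CauchyD)
    have "dist (coord (X i) n) (coord (X j) n) < e" if "i \<ge> N" "j \<ge> N" for i j
      using norm_coord_le[of "X i - X j" n] N[OF that] by (simp add: dist_norm)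
    then show "\<exists>N. \<forall>i\<ge>N. \<forall>j\<ge>N. dist (coord (X i) n) (coord (X j) n) < e" by blast
  qed
  define l where "l n = lim (\<lambda>m. coord (X m) n)" for n
  have l: "(\<lambda>m. coord (X m) n) \<longlonglongrightarrow> l n" for n
    unfolding l_def using c[of n] by (simp add: Cauchy_convergent_iff convergent_LIMSEQ_iff)
  \<comment> \<open>Finite partial sums of the Cauchy estimate pass to the coordinatewise limit, as
    in Fatou's lemma.\<close>
  have key: "summable (\<lambda>n. (norm (coord (X m) n - l n))\<^sup>2) \<and> (\<Sum>n. (norm (coord (X m) n - l n))\<^sup>2) \<le> e\<^sup>2"
    if e: "e > 0" and N: "\<And>i j. i \<ge> N \<Longrightarrow> j \<ge> N \<Longrightarrow> norm (X i - X j) < e" and m: "m \<ge> N" for e N m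
  proof -
    have b: "(\<Sum>n<J. (norm (coord (X m) n - l n))\<^sup>2) \<le> e\<^sup>2" for J
    proof (rule lim_le)
      show "(\<lambda>i. \<Sum>n<J. (norm (coord (X m) n - coord (X (i + N)) n))\<^sup>2) \<longlonglongrightarrow> (\<Sum>n<J. (norm (coord (X m) n - l n))\<^sup>2)"
        by (intro tendsto_sum tendsto_power tendsto_norm tendsto_diff tendsto_const LIMSEQ_ignore_initial_segment[OF l])
      fix i
      have "(\<Sum>n<J. (norm (coord (X m) n - coord (X (i + N)) n))\<^sup>2) \<le> (norm (X m - X (i + N)))\<^sup>2"
        using sum_le_suminf[OF sums_summable[OF coord_inner_sums], of "{..<J}" "X m - X (i + N)" "X m - X (i + N)"]
        by (simp add: power2_norm_eq_inner inner_ell2_def)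
      also have "\<dots> \<le> e\<^sup>2" using N[OF m, of "i + N"] by (intro power_mono) auto
      finally show "(\<Sum>n<J. (norm (coord (X m) n - coord (X (i + N)) n))\<^sup>2) \<le> e\<^sup>2" .
    qed
    have s: "summable (\<lambda>n. (norm (coord (X m) n - l n))\<^sup>2)" using b by (intro summableI_nonneg_bounded) auto
    then show ?thesis using b by (intro conjI suminf_le_const) auto
  qed
  obtain N where N: "\<And>i j. i \<ge> N \<Longrightarrow> j \<ge> N \<Longrightarrow> norm (X i - X j) < 1" using X by (meson CauchyD zero_less_one)
  have "summable (\<lambda>n. (norm (coord (X N) n + (-1) *\<^sub>R (coord (X N) n - l n)))\<^sup>2)"
    using key[OF zero_less_one N, of N N] by (intro summable_norm_add coord_summable summable_norm_scaleR) auto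
  then have sl: "summable (\<lambda>n. (norm (l n))\<^sup>2)" by simp
  have "X \<longlonglongrightarrow> Abs_ell2 l"
  proof (rule LIMSEQ_I)
    fix r :: real assume r: "r > 0"
    then obtain N where N: "\<And>i j. i \<ge> N \<Longrightarrow> j \<ge> N \<Longrightarrow> norm (X i - X j) < r / 2" using X by (meson CauchyD half_gt_zero)
    have "norm (X m - Abs_ell2 l) < r" if m: "m \<ge> N" for m
    proof -
      have k: "summable (\<lambda>n. (norm (coord (X m) n - l n))\<^sup>2)" "(\<Sum>n. (norm (coord (X m) n - l n))\<^sup>2) \<le> (r/2)\<^sup>2"
        using key[of "r/2" N m] r N m by auto
      have "X m - Abs_ell2 l = Abs_ell2 (\<lambda>n. coord (X m) n - l n)"
        using k by (intro ell2_eqI) (simp add: coord_Abs sl)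
      also have "norm \<dots> \<le> r / 2" using k r by (intro norm_ell2_le) auto
      finally show ?thesis using r by simp
    qed
    then show "\<exists>N. \<forall>m\<ge>N. norm (X m - Abs_ell2 l) < r" by blast
  qed
  then show "convergent X" by (rule convergentI)
qed

text \<open>The amplification \<open>x \<otimes> 1\<close>. A countable sum of vector functionals of
  \<open>x\<close> is one vector functional of \<open>amp x\<close>.\<close>

definition amp :: "('a::real_inner \<Rightarrow>\<^sub>L 'a) \<Rightarrow> 'a ell2 \<Rightarrow>\<^sub>L 'a ell2" where
  "amp x = Blinfun (\<lambda>k. Abs_ell2 (\<lambda>n. x (coord k n)))"

lemma coord_amp [simp]: "coord (amp x k) n = x (coord k n)"
proof -
  have s: "summable (\<lambda>n. (norm (x (coord k n)))\<^sup>2) \<and> (\<Sum>n. (norm (x (coord k n)))\<^sup>2) \<le> (norm x * norm k)\<^sup>2" for k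
  proof -
    have le: "(norm (x (coord k n)))\<^sup>2 \<le> (norm x)\<^sup>2 * (norm (coord k n))\<^sup>2" for n
      unfolding power_mult_distrib[symmetric] by (intro power_mono norm_blinfun) simp
    have s2: "summable (\<lambda>n. (norm x)\<^sup>2 * (norm (coord k n))\<^sup>2)" by (intro summable_mult coord_summable)
    have s1: "summable (\<lambda>n. (norm (x (coord k n)))\<^sup>2)"
      by (rule summable_comparison_test'[OF s2, of 0]) (use le in simp)
    have "(\<Sum>n. (norm (x (coord k n)))\<^sup>2) \<le> (\<Sum>n. (norm x)\<^sup>2 * (norm (coord k n))\<^sup>2)" by (rule suminf_le[OF le s1 s2])
    also have "\<dots> = (norm x * norm k)\<^sup>2"
      by (simp add: suminf_mult coord_summable power_mult_distrib power2_norm_eq_inner[of k] inner_ell2_def)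
        (simp add: power2_norm_eq_inner)
    finally show ?thesis using s1 by blast
  qed
  have "bounded_linear (\<lambda>k. Abs_ell2 (\<lambda>n. x (coord k n)))"
  proof (rule bounded_linear_intro[where K = "norm x"])
    fix k l :: "'a ell2" and r
    show "Abs_ell2 (\<lambda>n. x (coord (k + l) n)) = Abs_ell2 (\<lambda>n. x (coord k n)) + Abs_ell2 (\<lambda>n. x (coord l n))"
      using s[of k] s[of l] s[of "k + l"] by (intro ell2_eqI) (simp add: coord_Abs blinfun.add_right summable_norm_add)
    show "Abs_ell2 (\<lambda>n. x (coord (r *\<^sub>R k) n)) = r *\<^sub>R Abs_ell2 (\<lambda>n. x (coord k n))"
      using s[of k] s[of "r *\<^sub>R k"] by (intro ell2_eqI) (simp add: coord_Abs blinfun.scaleR_right)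
    show "norm (Abs_ell2 (\<lambda>n. x (coord k n))) \<le> norm k * norm x"
      using s[of k] by (intro norm_ell2_le) (auto simp: mult.commute)
  qed
  then have "blinfun_apply (amp x) = (\<lambda>k. Abs_ell2 (\<lambda>n. x (coord k n)))" by (simp add: amp_def bounded_linear_Blinfun_apply)
  then show ?thesis using s[of k] by (simp add: coord_Abs)
qed

lemma amp_simps:
  "amp id_blinfun = id_blinfun" "amp (x + y) = amp x + amp y" "amp (x - y) = amp x - amp y"
  "amp (r *\<^sub>R x) = r *\<^sub>R amp x" "amp (x o\<^sub>L y) = amp x o\<^sub>L amp y"
  by (auto intro!: blinfun_eqI ell2_eqI simp: bl_simps)

lemma amp_inner_sums: "(\<lambda>n. inner (blinfun_apply x (coord k n)) (coord l n)) sums inner (amp x k) l"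
  using coord_inner_sums[of "amp x k" l] by simp

lemma amp_adj: "(\<And>f g. inner (blinfun_apply x f) g = inner f (blinfun_apply z g)) \<Longrightarrow> inner (amp x k) l = inner k (amp z l)"
  by (simp add: inner_ell2_def)

lemma symm_amp: "symm x \<Longrightarrow> symm (amp x)"
  unfolding symm_def using amp_adj[of x x] by blast

lemma psd_amp: "psd x \<Longrightarrow> psd (amp x)"
  unfolding psd_def by (auto intro: symm_amp sums_le[OF _ sums_zero amp_inner_sums])

section \<open>Functionals and the commutant\<close>

lemma subspace_closure:
  fixes S :: "'a::real_normed_vector set"
  assumes "subspace S" shows "subspace (closure S)"
  unfolding subspace_def
proof (intro conjI ballI allI)
  show "0 \<in> closure S" using subspace_0[OF assms] closure_subset by blast
  fix x y r assume "x \<in> closure S"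
  then obtain u where u: "\<And>n::nat. u n \<in> S" "u \<longlonglongrightarrow> x" unfolding closure_sequential by blast
  show "r *\<^sub>R x \<in> closure S" unfolding closure_sequential
    using u assms by (intro exI[of _ "\<lambda>n. r *\<^sub>R u n"]) (auto intro: subspace_scale tendsto_intros)
  assume "y \<in> closure S"
  then obtain v where v: "\<And>n::nat. v n \<in> S" "v \<longlonglongrightarrow> y" unfolding closure_sequential by blast
  show "x + y \<in> closure S" unfolding closure_sequential
    using u v assms by (intro exI[of _ "\<lambda>n. u n + v n"]) (auto intro: subspace_add tendsto_intros)
qed

lemma has_sum_Plus:
  fixes F :: "'a + 'b \<Rightarrow> 'c::topological_comm_monoid_add"
  assumes "((\<lambda>j. F (Inl j)) has_sum s) J" "((\<lambda>j. F (Inr j)) has_sum t) J'"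
  shows "(F has_sum (s + t)) (J <+> J')"
  unfolding Plus_def
proof (rule has_sum_Un_disjoint)
  show "(F has_sum s) (Inl ` J)" "(F has_sum t) (Inr ` J')"
    using assms by (simp_all add: has_sum_reindex o_def)
qed auto

text \<open>The known half of a sum over a disjoint union is subtracted; both halves are summable as
  subfamilies of a summable real family.\<close>

lemma has_sum_PlusD:
  fixes F :: "'a + 'b \<Rightarrow> real"
  assumes "(F has_sum s) (J <+> J')"
  shows "((\<lambda>j. F (Inl j)) has_sum (s - infsum (\<lambda>j. F (Inr j)) J')) J"
proof -
  have "F summable_on (J <+> J')" using assms by (auto simp: summable_on_def)
  then have "F summable_on Inl ` J" "F summable_on Inr ` J'"
    by (auto intro: summable_on_subset_banach simp: Plus_def)
  then have *: "(\<lambda>j. F (Inl j)) summable_on J" "(\<lambda>j. F (Inr j)) summable_on J'"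
    by (simp_all add: summable_on_reindex o_def)
  have "s = infsum (\<lambda>j. F (Inl j)) J + infsum (\<lambda>j. F (Inr j)) J'"
    using has_sum_unique[OF assms has_sum_Plus[OF has_sum_infsum[OF *(1)] has_sum_infsum[OF *(2)]]] .
  then show ?thesis using has_sum_infsum[OF *(1)] by simp
qed

section \<open>Representations of functionals by families of vectors\<close>

context normal_algebra
begin

definition rep :: "(('h \<Rightarrow>\<^sub>L 'h) \<Rightarrow> real) \<Rightarrow> 'j set \<Rightarrow> ('j \<Rightarrow> 'h) \<Rightarrow> bool" where
  "rep w J g \<longleftrightarrow> (\<forall>x\<in>M. psd x \<longrightarrow> ((\<lambda>j. inner (x (g j)) (g j)) has_sum w x) J)"

definition bounded_by :: "real \<Rightarrow> (('h \<Rightarrow>\<^sub>L 'h) \<Rightarrow> real) \<Rightarrow> bool" where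
  "bounded_by l w \<longleftrightarrow> 0 < l \<and> pfun w \<and> (\<forall>x\<in>M. psd x \<longrightarrow> w x \<le> l * R x)"

lemma repD: "rep w J g \<Longrightarrow> x \<in> M \<Longrightarrow> psd x \<Longrightarrow> ((\<lambda>j. inner (x (g j)) (g j)) has_sum w x) J"
  by (simp add: rep_def)

lemma rep_scale:
  assumes "rep w J g" "r \<ge> 0" shows "rep (\<lambda>x. r * w x) J (\<lambda>j. sqrt r *\<^sub>R g j)"
  unfolding rep_def
proof (intro ballI impI)
  fix x assume x: "x \<in> M" "psd x"
  have "inner (x (sqrt r *\<^sub>R g j)) (sqrt r *\<^sub>R g j) = r * inner (x (g j)) (g j)" for j
    using assms(2) by (simp add: bl_simps flip: mult.assoc)
  then show "((\<lambda>j. inner (x (sqrt r *\<^sub>R g j)) (sqrt r *\<^sub>R g j)) has_sum r * w x) J"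
    using has_sum_cmult_right[OF repD[OF assms(1) x]] by simp
qed

lemma rep_Plus:
  assumes "rep w J g" "rep w' J' g'"
  shows "rep (\<lambda>x. w x + w' x) (J <+> J') (case_sum g g')"
  using assms unfolding rep_def by (auto intro!: has_sum_Plus)

lemma dominated_scale: "bounded_by l w \<Longrightarrow> dominated (\<lambda>x. (1/l) * w x)"
  unfolding bounded_by_def dominated_def using pfun_scale[of w "1/l"] by (auto simp: field_simps)

lemma rep_exists:
  assumes "bounded_by l w" shows "\<exists>g :: nat \<Rightarrow> 'h. rep w UNIV g"
proof -
  have l: "l > 0" using assms by (simp add: bounded_by_def)
  obtain g where g: "\<And>x. x \<in> M \<Longrightarrow> psd x \<Longrightarrow> (\<lambda>n::nat. inner (x (g n)) (g n)) sums ((1/l) * w x)"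
    using vector_representation[OF dominated_scale[OF assms]] by blast
  have "rep (\<lambda>x. (1/l) * w x) (UNIV :: nat set) g" unfolding rep_def
  proof (intro ballI impI)
    fix x assume x: "x \<in> M" "psd x"
    show "((\<lambda>n. inner (x (g n)) (g n)) has_sum (1/l) * w x) UNIV"
      using g[OF x] x by (intro norm_summable_imp_has_sum) (auto simp: psd_def summable_def)
  qed
  from rep_scale[OF this, of l] l show ?thesis by (auto simp: less_imp_le)
qed

lemma rep_member:
  assumes "rep w J g" "bounded_by l w" "j \<in> J" "x \<in> M" "psd x"
  shows "inner (x (g j)) (g j) \<le> l * R x"
proof -
  have "sum (\<lambda>j. inner (x (g j)) (g j)) {j} \<le> w x"
    using repD[OF assms(1,4,5)] assms(3,5) by (intro finite_sum_le_has_sum) (auto simp: psd_def)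
  then show ?thesis using assms(2,4,5) by (force simp: bounded_by_def)
qed

lemma dominated_complement: "dominated w \<Longrightarrow> dominated (\<lambda>x. R x - w x)"
  using pfun_minus[OF R] pfunD(4) by (auto simp: dominated_def)

lemma bounded_by_dominated: "bounded_by 1 w \<longleftrightarrow> dominated w"
  by (simp add: bounded_by_def dominated_def)

end

text \<open>The content of (ii) for a hermitian form: \<open>q f\<close> stands for the diagonal
  value at \<open>f\<close>, and \<open>C0\<close> for the common sum over all countable
  representations. Homogeneity is the one algebraic property of the form that enters.\<close>

locale invariant_sum = normal_algebra M R
  for M :: "('h::{real_inner,banach} \<Rightarrow>\<^sub>L 'h) set" and R +
  fixes q :: "'h \<Rightarrow> real" and C0 :: real
  assumes R1: "R id_blinfun = 1"
    and q_scale: "0 < l \<Longrightarrow> (\<And>x. x \<in> M \<Longrightarrow> psd x \<Longrightarrow> inner (blinfun_apply x f) f \<le> l * R x) \<Longrightarrow> q (r *\<^sub>R f) = r\<^sup>2 * q f"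
    and q_sum: "\<And>(I :: nat set) g. rep R I g \<Longrightarrow> ((\<lambda>i. q (g i)) has_sum C0) I"
begin

lemma q_sum_countable:
  fixes J :: "'j::countable set"
  assumes "rep R J g" shows "((\<lambda>j. q (g j)) has_sum C0) J"
proof -
  have inj: "inj_on to_nat J" by (rule inj_on_subset[OF inj_to_nat]) simp
  have "rep R (to_nat ` J) (\<lambda>n. g (from_nat n))"
    using assms unfolding rep_def by (simp add: has_sum_reindex[OF inj] o_def)
  then show ?thesis using q_sum[of "to_nat ` J" "\<lambda>n. g (from_nat n)"]
    by (simp add: has_sum_reindex[OF inj] o_def)
qed

text \<open>The representing sequence is picked arbitrarily; \<open>Psi_has_sum\<close> shows that
  the choice does not matter.\<close>

definition Psi :: "(('h \<Rightarrow>\<^sub>L 'h) \<Rightarrow> real) \<Rightarrow> real" where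
  "Psi w = (\<Sum>\<^sub>\<infinity>n. q ((SOME g :: nat \<Rightarrow> 'h. rep w UNIV g) n))"

lemma Psi_cong: "(\<And>x. x \<in> M \<Longrightarrow> psd x \<Longrightarrow> w x = w' x) \<Longrightarrow> Psi w = Psi w'"
  unfolding Psi_def rep_def by simp

text \<open>A representation of \<open>w\<close> is completed by a fixed representation of the complement to one of \<open>R\<close>.\<close>

lemma Psi_has_sum:
  fixes J :: "'j::countable set"
  assumes w: "bounded_by l w" and g: "rep w J g"
  shows "((\<lambda>j. q (g j)) has_sum Psi w) J"
proof -
  have l: "l > 0" using w by (simp add: bounded_by_def)
  define v where "v = (\<lambda>x. (1/l) * w x)"
  have v: "dominated v" unfolding v_def by (rule dominated_scale[OF w])
  obtain h :: "nat \<Rightarrow> 'h" where h: "rep (\<lambda>x. R x - v x) UNIV h"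
    using rep_exists dominated_complement[OF v] bounded_by_dominated by metis
  define s where "s = C0 - infsum (\<lambda>n. q (h n)) UNIV"
  have main: "((\<lambda>j. q (g j)) has_sum (l * s)) J" if g: "rep w J g" for J :: "'i::countable set" and g
  proof -
    have "rep v J (\<lambda>j. sqrt (1/l) *\<^sub>R g j)" unfolding v_def using rep_scale[OF g, of "1/l"] l by simp
    from rep_Plus[OF this h] have "rep R (J <+> UNIV) (case_sum (\<lambda>j. sqrt (1/l) *\<^sub>R g j) h)" by simp
    from has_sum_PlusD[OF q_sum_countable[OF this]] have "((\<lambda>j. q (sqrt (1/l) *\<^sub>R g j)) has_sum s) J"
      by (simp add: s_def)
    moreover have "q (sqrt (1/l) *\<^sub>R g j) = (1/l) * q (g j)" if "j \<in> J" for j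
      using q_scale[OF l rep_member[OF g w that], of "sqrt (1/l)"] l by simp
    ultimately have "((\<lambda>j. (1/l) * q (g j)) has_sum s) J" by (simp cong: has_sum_cong)
    from has_sum_cmult_right[OF this, of l] show ?thesis using l by simp
  qed
  define g0 where "g0 = (SOME g :: nat \<Rightarrow> 'h. rep w UNIV g)"
  have "rep w (UNIV :: nat set) g0" unfolding g0_def using rep_exists[OF w] by (rule someI_ex)
  from main[OF this] have "Psi w = l * s" unfolding Psi_def g0_def[symmetric] by (rule infsumI)
  then show ?thesis using main[OF g] by simp
qed

lemma bounded_by_add: "bounded_by l w \<Longrightarrow> bounded_by l' w' \<Longrightarrow> bounded_by (l + l') (\<lambda>x. w x + w' x)"
  by (auto simp: bounded_by_def distrib_right intro!: pfun_add add_mono)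

text \<open>The summand 1 keeps the bound positive when \<open>r = 0\<close>.\<close>

lemma bounded_by_scale: "bounded_by l w \<Longrightarrow> r \<ge> 0 \<Longrightarrow> bounded_by (r * l + 1) (\<lambda>x. r * w x)"
proof -
  assume w: "bounded_by l w" and r: "r \<ge> 0"
  have "r * w x \<le> (r * l + 1) * R x" if "x \<in> M" "psd x" for x
  proof -
    have "r * w x \<le> r * (l * R x)" using w r that by (intro mult_left_mono) (auto simp: bounded_by_def)
    also have "\<dots> \<le> (r * l + 1) * R x" using pfunD(4)[OF R that] by (simp add: algebra_simps)
    finally show ?thesis .
  qed
  then show ?thesis using w r by (auto simp: bounded_by_def intro!: pfun_scale add_nonneg_pos)
qed

lemma Psi_add:
  assumes "bounded_by l w" "bounded_by l' w'" shows "Psi (\<lambda>x. w x + w' x) = Psi w + Psi w'"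
proof -
  obtain g g' :: "nat \<Rightarrow> 'h" where g: "rep w UNIV g" "rep w' UNIV g'" using rep_exists assms by metis
  have "((\<lambda>j. q (case_sum g g' j)) has_sum Psi (\<lambda>x. w x + w' x)) (UNIV <+> UNIV)"
    by (rule Psi_has_sum[OF bounded_by_add[OF assms] rep_Plus[OF g]])
  moreover have "((\<lambda>j. q (case_sum g g' j)) has_sum Psi w + Psi w') (UNIV <+> UNIV)"
    using Psi_has_sum[OF assms(1) g(1)] Psi_has_sum[OF assms(2) g(2)] by (intro has_sum_Plus) auto
  ultimately show ?thesis by (rule has_sum_unique)
qed

lemma Psi_scale:
  assumes "bounded_by l w" "r \<ge> 0" shows "Psi (\<lambda>x. r * w x) = r * Psi w"
proof -
  obtain g :: "nat \<Rightarrow> 'h" where g: "rep w UNIV g" using rep_exists assms by metis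
  have "((\<lambda>j. q (sqrt r *\<^sub>R g j)) has_sum Psi (\<lambda>x. r * w x)) UNIV"
    by (rule Psi_has_sum[OF bounded_by_scale[OF assms] rep_scale[OF g assms(2)]])
  moreover have "q (sqrt r *\<^sub>R g j) = r * q (g j)" for j
    using q_scale[OF _ rep_member[OF g assms(1) UNIV_I], of "sqrt r" j] assms by (simp add: bounded_by_def)
  ultimately have "((\<lambda>j. r * q (g j)) has_sum Psi (\<lambda>x. r * w x)) UNIV" by simp
  then show ?thesis using has_sum_cmult_right[OF Psi_has_sum[OF assms(1) g], of r] has_sum_unique by blast
qed

text \<open>Representations of all the \<open>w k\<close>, indexed by pairs, together represent
  \<open>W\<close>; summing this double family by rows gives the claim. It is the source of the
  continuity of \<open>psi\<close> along increasing sequences.\<close>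

lemma Psi_sums:
  assumes W: "bounded_by l W" and w: "\<And>k::nat. bounded_by (L k) (w k)"
    and sums: "\<And>x. x \<in> M \<Longrightarrow> psd x \<Longrightarrow> (\<lambda>k. w k x) sums W x"
  shows "(\<lambda>k. Psi (w k)) sums Psi W"
proof -
  have "\<exists>g. \<forall>k. rep (w k) (UNIV :: nat set) (g k)" using rep_exists[OF w] by (intro choice) blast
  then obtain g where g: "\<And>k. rep (w k) (UNIV :: nat set) (g k)" by blast
  have "rep W (UNIV \<times> UNIV) (\<lambda>(k, i). g k i)" unfolding rep_def
  proof (intro ballI impI)
    fix x assume x: "x \<in> M" "psd x"
    have 1: "((\<lambda>i. inner (x (g k i)) (g k i)) has_sum w k x) UNIV" for k using repD[OF g x] .
    have 2: "((\<lambda>k. w k x) has_sum W x) UNIV"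
      using sums[OF x] pfunD(4)[OF _ x] w by (intro norm_summable_imp_has_sum) (auto simp: bounded_by_def summable_def)
    have 3: "(\<lambda>(k, i). inner (x (g k i)) (g k i)) summable_on (UNIV \<times> UNIV)"
      using 1 2 x by (intro summable_on_SigmaI[where g = "\<lambda>k. w k x"]) (auto simp: psd_def summable_on_def)
    have "((\<lambda>(k, i). inner (x (g k i)) (g k i)) has_sum W x) (UNIV \<times> UNIV)"
      using 1 2 3 by (intro has_sum_SigmaI[where g = "\<lambda>k. w k x"]) auto
    then show "((\<lambda>j. inner (x ((\<lambda>(k, i). g k i) j)) ((\<lambda>(k, i). g k i) j)) has_sum W x) (UNIV \<times> UNIV)"
      by (simp add: case_prod_unfold)
  qed
  from Psi_has_sum[OF W this] have "((\<lambda>(k, i). q (g k i)) has_sum Psi W) (UNIV \<times> UNIV)" by (simp add: case_prod_unfold)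
  then have "((\<lambda>k. Psi (w k)) has_sum Psi W) UNIV"
    by (rule has_sum_SigmaD) (use Psi_has_sum[OF w g] in auto)
  then show ?thesis by (rule has_sum_imp_sums)
qed

end

section \<open>The cyclic subspace of the representing vector and the commutant\<close>

context normal_algebra
begin

lemma bounded_by_R: "bounded_by 1 R"
  using R by (simp add: bounded_by_def)

definition cyc :: "'h ell2" where
  "cyc = Abs_ell2 (SOME g :: nat \<Rightarrow> 'h. rep R UNIV g)"

lemma summable_rep:
  assumes "rep w (UNIV :: nat set) g" shows "summable (\<lambda>n. (norm (g n))\<^sup>2)"
  using has_sum_imp_sums[OF repD[OF assms M_id psd_intros(2)]]
  by (simp add: power2_norm_eq_inner summable_def) blast

lemma rep_amp:
  assumes "rep w (UNIV :: nat set) g" "x \<in> M" "psd x"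
  shows "inner (amp x (Abs_ell2 g)) (Abs_ell2 g) = w x"
proof -
  have "(\<lambda>n. inner (x (g n)) (g n)) sums inner (amp x (Abs_ell2 g)) (Abs_ell2 g)"
    using amp_inner_sums[of x "Abs_ell2 g" "Abs_ell2 g"] by (simp add: coord_Abs[OF summable_rep[OF assms(1)]])
  then show ?thesis using has_sum_imp_sums[OF repD[OF assms]] sums_unique2 by blast
qed

lemma amp_cyc:
  assumes "x \<in> M" "psd x" shows "inner (amp x cyc) cyc = R x"
proof -
  have "rep R UNIV (SOME g :: nat \<Rightarrow> 'h. rep R UNIV g)" using rep_exists[OF bounded_by_R] by (rule someI_ex)
  then show ?thesis unfolding cyc_def by (rule rep_amp[OF _ assms])
qed

lemma amp_adj_inner: "x \<in> M \<Longrightarrow> inner (amp x k) l = inner k (amp (adj x) l)" "x \<in> M \<Longrightarrow> inner (amp (adj x) k) l = inner k (amp x l)"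
  by (rule amp_adj, simp add: adj(2,3))+

lemma norm_amp_square:
  "x \<in> M \<Longrightarrow> (norm (amp x k))\<^sup>2 = inner (amp (adj x o\<^sub>L x) k) k"
  by (simp add: power2_norm_eq_inner amp_simps amp_adj_inner(2))

lemma adj_self_psd: "x \<in> M \<Longrightarrow> psd (adj x o\<^sub>L x)" "x \<in> M \<Longrightarrow> adj x o\<^sub>L x \<in> M"
  by (auto intro!: psd_square M_comp simp: adj)

text \<open>A model of the Hilbert space of the GNS construction; in general it is not all of
  l2(H).\<close>

definition K0 :: "'h ell2 set" where
  "K0 = closure ((\<lambda>x. amp x cyc) ` M)"

lemma subspace_K0: "subspace K0"
  unfolding K0_def
proof (rule subspace_closure)
  show "subspace ((\<lambda>x. amp x cyc) ` M)" unfolding subspace_def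
  proof (intro conjI ballI allI)
    have "amp 0 = (0 :: 'h ell2 \<Rightarrow>\<^sub>L 'h ell2)" using amp_simps(4)[of 0 id_blinfun] by simp
    then show "0 \<in> (\<lambda>x. amp x cyc) ` M" using M_0 by (intro image_eqI[of _ _ 0]) simp_all
    fix k l r assume "k \<in> (\<lambda>x. amp x cyc) ` M" 
    then obtain x where x: "x \<in> M" "k = amp x cyc" by blast
    show "r *\<^sub>R k \<in> (\<lambda>x. amp x cyc) ` M" using x by (intro image_eqI[of _ _ "r *\<^sub>R x"]) (auto simp: amp_simps bl_simps M_scale)
    assume "l \<in> (\<lambda>x. amp x cyc) ` M"
    then obtain y where y: "y \<in> M" "l = amp y cyc" by blast
    show "k + l \<in> (\<lambda>x. amp x cyc) ` M" using x y by (intro image_eqI[of _ _ "x + y"]) (auto simp: amp_simps bl_simps M_add)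
  qed
qed

lemma closed_K0: "closed K0"
  by (simp add: K0_def)

lemma amp_cyc_K0: "x \<in> M \<Longrightarrow> amp x cyc \<in> K0"
  unfolding K0_def by (rule subsetD[OF closure_subset]) simp

lemma cyc_K0: "cyc \<in> K0"
  using amp_cyc_K0[OF M_id] by (simp add: amp_simps)

text \<open>Density as an induction rule: membership in a closed set need only be checked on the
  orbit of \<open>cyc\<close>.\<close>

lemma K0_induct:
  assumes k: "k \<in> K0" and S: "closed S" "\<And>x. x \<in> M \<Longrightarrow> amp x cyc \<in> S" shows "k \<in> S"
proof -
  have "(\<lambda>x. amp x cyc) ` M \<subseteq> S" using S(2) by blast
  then have "K0 \<subseteq> S" unfolding K0_def by (rule closure_minimal[OF _ S(1)])
  then show ?thesis using k by blast
qed

lemma closed_vimage_op: "closed S \<Longrightarrow> closed {k. blinfun_apply y k \<in> S}"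
  using closed_vimage[OF _ linear_continuous_on[OF blinfun.bounded_linear_right], of S y] by (simp add: vimage_def)

lemma K0_eqI:
  assumes "k \<in> K0" "l \<in> K0" "\<And>x. x \<in> M \<Longrightarrow> inner (amp x cyc) k = inner (amp x cyc) l"
  shows "k = l"
proof -
  have d: "k - l \<in> K0" by (rule subspace_diff[OF subspace_K0 assms(1,2)])
  have "closed {u. inner u (k - l) = 0}" by (intro closed_Collect_eq continuous_intros)
  then have "k - l \<in> {u. inner u (k - l) = 0}" by (rule K0_induct[OF d]) (simp add: inner_diff_right assms(3))
  then show ?thesis by simp
qed

lemma amp_K0: "x \<in> M \<Longrightarrow> k \<in> K0 \<Longrightarrow> amp x k \<in> K0"
proof -
  assume x: "x \<in> M" and k: "k \<in> K0"
  have "k \<in> {k. amp x k \<in> K0}"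
  proof (rule K0_induct[OF k closed_vimage_op[OF closed_K0]])
    show "amp y cyc \<in> {k. amp x k \<in> K0}" if "y \<in> M" for y
      using amp_cyc_K0[OF M_comp[OF x that]] by (simp add: amp_simps)
  qed
  then show ?thesis by simp
qed

text \<open>The commutant of the amplified algebra on \<open>K0\<close>, encoded by operators on the
  whole space. The condition on \<open>y cyc\<close> makes them preserve \<open>K0\<close>, so that
  \<open>A\<close> is closed under composition and the vectors \<open>y cyc\<close> can be
  approximated by \<open>amp x cyc\<close>.\<close>

definition A :: "('h ell2 \<Rightarrow>\<^sub>L 'h ell2) set" where
  "A = {y. (\<forall>x\<in>M. \<forall>k. blinfun_apply y (amp x k) = amp x (y k)) \<and> blinfun_apply y cyc \<in> K0}"

lemma AD: "y \<in> A \<Longrightarrow> x \<in> M \<Longrightarrow> blinfun_apply y (amp x k) = amp x (y k)" "y \<in> A \<Longrightarrow> blinfun_apply y cyc \<in> K0"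
  by (auto simp: A_def)

lemma A_K0: "y \<in> A \<Longrightarrow> k \<in> K0 \<Longrightarrow> blinfun_apply y k \<in> K0"
proof -
  assume y: "y \<in> A" and k: "k \<in> K0"
  have "k \<in> {k. y k \<in> K0}"
    by (rule K0_induct[OF k closed_vimage_op[OF closed_K0]]) (simp add: AD[OF y] amp_K0)
  then show ?thesis by simp
qed

definition om :: "('h ell2 \<Rightarrow>\<^sub>L 'h ell2) \<Rightarrow> ('h \<Rightarrow>\<^sub>L 'h) \<Rightarrow> real" where
  "om y x = inner (amp x (y cyc)) cyc"

lemma om_linear: "om (y + z) x = om y x + om z x" "om (y - z) x = om y x - om z x" "om (r *\<^sub>R y) x = r * om y x"
  by (simp_all add: om_def bl_simps)

lemma om_pfun:
  assumes y: "y \<in> A" "psd y" shows "pfun (om y)"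
  unfolding pfun_def
proof (intro conjI ballI allI impI)
  fix x z r assume x: "x \<in> M"
  show "om y (x + z) = om y x + om y z" "om y (r *\<^sub>R x) = r * om y x" by (simp_all add: om_def amp_simps bl_simps)
  have "om y (adj x) = inner (y cyc) (amp x cyc)" using x by (simp add: om_def amp_adj_inner(2))
  also have "\<dots> = inner cyc (amp x (y cyc))" using AD(1)[OF y(1) x, of cyc] symmD[OF psdD(1)[OF y(2)]] by simp
  finally show "om y (adj x) = om y x" by (simp add: om_def inner_commute)
  \<comment> \<open>\<open>amp x\<close> and \<open>y\<close> are commuting positive operators, so
    their product is positive.\<close>
  assume "psd x"
  moreover have "amp x o\<^sub>L y = y o\<^sub>L amp x" using AD(1)[OF y(1) x] by (intro blinfun_eqI) simp
  ultimately show "0 \<le> om y x" unfolding om_def using psd_commuting_product[OF psd_amp y(2)] by blast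
qed

lemma A_id': "id_blinfun \<in> A"
  by (simp add: A_def cyc_K0)

lemma A_add': "y \<in> A \<Longrightarrow> z \<in> A \<Longrightarrow> y + z \<in> A"
  by (auto simp: A_def bl_simps intro: subspace_add[OF subspace_K0])

lemma A_scale': "y \<in> A \<Longrightarrow> r *\<^sub>R y \<in> A"
  by (auto simp: A_def bl_simps intro: subspace_scale[OF subspace_K0])

lemma A_diff': "y \<in> A \<Longrightarrow> z \<in> A \<Longrightarrow> y - z \<in> A"
  using A_add'[of y "(-1) *\<^sub>R z"] A_scale'[of z "-1"] by simp

lemma om_id: "x \<in> M \<Longrightarrow> psd x \<Longrightarrow> om id_blinfun x = R x"
  by (simp add: om_def amp_cyc)

lemma om_bounded:
  assumes y: "y \<in> A" "psd y" shows "bounded_by (norm y + 1) (om y)"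
proof -
  have "om y x \<le> (norm y + 1) * R x" if x: "x \<in> M" "psd x" for x
  proof -
    have "0 \<le> om (norm y *\<^sub>R id_blinfun - y) x"
      using y x by (intro pfunD(4)[OF om_pfun] A_diff' A_scale' A_id' psd_norm_minus psdD)
    then have "om y x \<le> norm y * R x" using x by (simp add: om_linear om_id)
    then show ?thesis using pfunD(4)[OF R x] by (simp add: algebra_simps)
  qed
  then show ?thesis using om_pfun[OF y] by (auto simp: bounded_by_def intro: add_nonneg_pos)
qed

text \<open>If the vector \<open>h\<close> represents \<open>w\<close>, then \<open>y\<close> is the square of the absolute value of the map
  $x\, cyc \mapsto x h$.\<close>

lemma om_surj:
  assumes w: "bounded_by l w"
  shows "\<exists>y\<in>A. psd y \<and> psd (l *\<^sub>R id_blinfun - y) \<and> (\<forall>x\<in>M. psd x \<longrightarrow> om y x = w x)"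
proof -
  have l: "l > 0" using w by (simp add: bounded_by_def)
  obtain g :: "nat \<Rightarrow> 'h" where g: "rep w UNIV g" using rep_exists[OF w] by blast
  define h where "h = Abs_ell2 g"
  have h: "inner (amp x h) h = w x" if "x \<in> M" "psd x" for x unfolding h_def by (rule rep_amp[OF g that])
  \<comment> \<open>\<open>||z h||^2 = w (z' z) <= l R (z' z) = l ||z cyc||^2\<close>, with
    \<open>z'\<close> the adjoint of \<open>z\<close>; so \<open>z cyc \<mapsto> z h\<close> is well
    defined and bounded.\<close>
  have nh: "norm (amp z h) \<le> sqrt l * norm (amp z cyc)" if z: "z \<in> M" for z
  proof -
    have "(norm (amp z h))\<^sup>2 = w (adj z o\<^sub>L z)" using z adj_self_psd[OF z] by (simp add: norm_amp_square h)
    also have "\<dots> \<le> l * R (adj z o\<^sub>L z)" using w adj_self_psd[OF z] by (simp add: bounded_by_def)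
    also have "\<dots> = (sqrt l * norm (amp z cyc))\<^sup>2"
      using z adj_self_psd[OF z] l by (simp add: power_mult_distrib norm_amp_square amp_cyc)
    finally show ?thesis by (rule power2_le_imp_le) (use l in simp)
  qed
  \<comment> \<open>Riesz representation directly yields the adjoint \<open>u\<close> of that map,
    extended by 0 to the orthogonal complement of \<open>K0\<close>.\<close>
  have "\<exists>p\<in>K0. \<forall>z\<in>M. inner (amp z cyc) p = inner (amp z h) k" for k
  proof (rule riesz_on_image[OF subspace_M, of "\<lambda>z. amp z cyc" "\<lambda>z. inner (amp z h) k" "sqrt l * norm k"])
    show "\<bar>inner (amp z h) k\<bar> \<le> sqrt l * norm k * norm (amp z cyc)" if "z \<in> M" for z
    proof -
      have "\<bar>inner (amp z h) k\<bar> \<le> norm (amp z h) * norm k" by (rule Cauchy_Schwarz_ineq2)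
      also have "\<dots> \<le> sqrt l * norm (amp z cyc) * norm k" by (intro mult_right_mono nh that) simp
      finally show ?thesis by (simp add: ac_simps)
    qed
  qed (auto simp: amp_simps bl_simps K0_def)
  then have "\<exists>U. \<forall>k. U k \<in> K0 \<and> (\<forall>z\<in>M. inner (amp z cyc) (U k) = inner (amp z h) k)" by (intro choice) blast
  then obtain u where u: "\<And>k. u k \<in> K0" "\<And>k z. z \<in> M \<Longrightarrow> inner (amp z cyc) (u k) = inner (amp z h) k" by blast
  have nu: "norm (u k) \<le> norm k * sqrt l" for k
  proof -
    have "closed {v. inner v (u k) \<le> sqrt l * norm v * norm k}" by (intro closed_Collect_le continuous_intros)
    then have "u k \<in> {v. inner v (u k) \<le> sqrt l * norm v * norm k}"
    proof (rule K0_induct[OF u(1)])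
      fix z assume z: "z \<in> M"
      have "inner (amp z h) k \<le> norm (amp z h) * norm k" by (rule norm_cauchy_schwarz)
      also have "\<dots> \<le> sqrt l * norm (amp z cyc) * norm k" by (intro mult_right_mono nh z) simp
      finally show "amp z cyc \<in> {v. inner v (u k) \<le> sqrt l * norm v * norm k}" by (simp add: u(2) z)
    qed
    then have "norm (u k) * norm (u k) \<le> norm (u k) * (norm k * sqrt l)"
      by (simp add: power2_norm_eq_inner[symmetric] power2_eq_square ac_simps)
    then show ?thesis using l by (cases "u k = 0") auto
  qed
  have "bounded_linear u"
  proof (rule bounded_linear_intro[OF _ _ nu])
    show "u (k + k') = u k + u k'" for k k'
      by (rule K0_eqI) (auto simp: u inner_add_right subspace_add[OF subspace_K0])
    show "u (r *\<^sub>R k) = r *\<^sub>R u k" for r k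
      by (rule K0_eqI) (auto simp: u subspace_scale[OF subspace_K0])
  qed
  define U where "U = Blinfun u"
  have U: "blinfun_apply U = u" using \<open>bounded_linear u\<close> by (simp add: U_def bounded_linear_Blinfun_apply)
  have nU: "norm U \<le> sqrt l" using nu l by (intro norm_blinfun_bound) (auto simp: U mult.commute)
  obtain S where S: "\<And>k k'. inner (U k) k' = inner k (blinfun_apply S k')" "norm S \<le> norm U" by (rule adjoint_exists[of U]) (rule that)
  have Uc: "U (amp x k) = amp x (U k)" if x: "x \<in> M" for x k
  proof (rule K0_eqI)
    fix z assume z: "z \<in> M"
    have "inner (amp z cyc) (U (amp x k)) = inner (amp (adj x o\<^sub>L z) h) k"
      using x z by (simp add: U u amp_simps amp_adj_inner(2))
    also have "\<dots> = inner (amp (adj x o\<^sub>L z) cyc) (U k)" using x z by (simp add: U u adj M_comp)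
    also have "\<dots> = inner (amp z cyc) (amp x (U k))" using x by (simp add: amp_simps amp_adj_inner(2))
    finally show "inner (amp z cyc) (U (amp x k)) = inner (amp z cyc) (amp x (U k))" .
  qed (use x in \<open>auto simp: U u amp_K0\<close>)
  have Sc: "S (amp x k) = amp x (S k)" if x: "x \<in> M" for x k
  proof -
    have "inner f (S (amp x k)) = inner f (amp x (S k))" for f
    proof -
      have "inner f (S (amp x k)) = inner (amp (adj x) (U f)) k" using x by (simp add: S(1)[symmetric] amp_adj_inner(2))
      also have "\<dots> = inner (amp (adj x) f) (S k)" using x by (simp add: Uc[symmetric] adj S(1))
      finally show ?thesis using x by (simp add: amp_adj_inner(2))
    qed
    then show ?thesis using vector_eq_ldot by blast
  qed
  have Sh: "S cyc = h"
  proof -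
    have "inner f (S cyc) = inner f h" for f
      using u(2)[OF M_id, of f] by (simp add: S(1)[symmetric] U amp_simps inner_commute)
    then show ?thesis using vector_eq_ldot by blast
  qed
  \<comment> \<open>\<open>S\<close> is the extended map itself and \<open>U\<close> its adjoint, so
    \<open>y\<close> is positive, and \<open>S cyc = h\<close> recovers \<open>w\<close>.\<close>
  define y where "y = U o\<^sub>L S"
  have yy: "inner (y f) g = inner (S f) (S g)" for f g by (simp add: y_def S(1))
  have "psd y" unfolding psd_def symm_def yy by (simp add: inner_commute[of _ "y _"] yy) (simp add: inner_commute)
  moreover have "psd (l *\<^sub>R id_blinfun - y)"
  proof (rule psdI)
    fix f
    have "norm (S f) \<le> sqrt l * norm f"
      using norm_blinfun[of S f] mult_right_mono[OF order_trans[OF S(2) nU] norm_ge_zero[of f]] by linarith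
    then have "(norm (S f))\<^sup>2 \<le> (sqrt l * norm f)\<^sup>2" by (intro power_mono) auto
    then show "0 \<le> inner ((l *\<^sub>R id_blinfun - y) f) f" using l
      by (simp add: bl_simps yy power_mult_distrib power2_norm_eq_inner)
  qed (use \<open>psd y\<close> in \<open>auto simp: psd_def\<close>)
  moreover have "y \<in> A" by (simp add: A_def y_def Uc Sc) (simp add: U u)
  moreover have "om y x = w x" if "x \<in> M" "psd x" for x
  proof -
    have "om y x = inner (y (amp x cyc)) cyc" using AD(1)[OF \<open>y \<in> A\<close> that(1)] by (simp add: om_def)
    also have "\<dots> = w x" using that by (simp add: yy Sc Sh h)
    finally show ?thesis .
  qed
  ultimately show ?thesis by blast
qed

text \<open>A symmetric element is a difference of two positive ones, and both functionals are
  linear.\<close>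

lemma om_symm_ext:
  assumes "pfun w" "y \<in> A" "psd y" "\<And>x. x \<in> M \<Longrightarrow> psd x \<Longrightarrow> om y x = w x" and x: "x \<in> M" "symm x"
  shows "om y x = w x"
proof -
  have "om y ((norm x *\<^sub>R id_blinfun + x) - norm x *\<^sub>R id_blinfun) = w ((norm x *\<^sub>R id_blinfun + x) - norm x *\<^sub>R id_blinfun)"
    using assms psd_norm_minus(2)[OF x(2)]
    by (simp only: pfunD(5)[OF om_pfun[OF assms(2,3)]] pfunD(5)[OF assms(1)] M_intros) (simp add: M_intros)
  then show ?thesis by simp
qed

end

section \<open>Approximation in the norm of the state\<close>

text \<open>With \<open>P = (1 + y) / 2\<close> one has \<open>0 <= P <= 1\<close>, hence
  \<open>P^2 <= P\<close>, and \<open>y^2 = 1 - 4 (P - P^2)\<close>.\<close>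

lemma contraction_norm_le:
  assumes "symm y" "psd (id_blinfun - y)" "psd (id_blinfun + y)"
  shows "norm (blinfun_apply y k) \<le> norm k"
proof -
  define P where "P = (1/2) *\<^sub>R (id_blinfun + y)"
  have "id_blinfun - P = (1/2) *\<^sub>R (id_blinfun - y)"
    using scaleR_half_double[of "id_blinfun :: 'a \<Rightarrow>\<^sub>L 'a"] by (simp add: P_def scaleR_add_right algebra_simps)
  then have P: "psd P" "psd (id_blinfun - P)" using assms by (auto simp: P_def)
  have "y k = 2 *\<^sub>R P k - k" by (simp add: P_def bl_simps)
  then have "(norm (y k))\<^sup>2 = 4 * ((norm (P k))\<^sup>2 - inner (P k) k) + (norm k)\<^sup>2"
    by (simp add: power2_norm_eq_inner inner_diff_left inner_diff_right inner_commute)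
  then have "(norm (y k))\<^sup>2 \<le> (norm k)\<^sup>2" using psd_le_one(1)[OF P, of k] by simp
  then show ?thesis by (rule power2_le_imp_le) simp
qed

context normal_algebra
begin

lemma A_comp': "y \<in> A \<Longrightarrow> z \<in> A \<Longrightarrow> y o\<^sub>L z \<in> A"
  unfolding A_def using A_K0[of y] by (auto simp: A_def)

lemma A_lim':
  assumes X: "\<And>n. X n \<in> A" and lim: "\<And>f. (\<lambda>n. blinfun_apply (X n) f) \<longlonglongrightarrow> blinfun_apply z f"
  shows "z \<in> A"
  unfolding A_def
proof (intro CollectI conjI ballI allI)
  fix x k assume x: "x \<in> M"
  have "(\<lambda>n. X n (amp x k)) \<longlonglongrightarrow> amp x (z k)" unfolding AD(1)[OF X x] by (intro op_tendsto lim)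
  then show "z (amp x k) = amp x (z k)" using lim[of "amp x k"] LIMSEQ_unique by blast
next
  show "z cyc \<in> K0" by (rule closed_sequentially[OF closed_K0 AD(2)[OF X] lim])
qed

text \<open>\<open>s\<close> commutes with the amplified algebra because it inverts an operator that
  does. For the condition at \<open>cyc\<close> the equation is solved inside \<open>K0\<close>, and
  uniqueness identifies the solution with \<open>s cyc\<close>.\<close>

lemma A_res':
  assumes y: "y \<in> A" "psd y" and s: "\<And>f. blinfun_apply s f + y (s f) = f" shows "s \<in> A"
  unfolding A_def
proof (intro CollectI conjI ballI allI)
  fix x k assume x: "x \<in> M"
  have "s (amp x k) + y (s (amp x k)) = amp x (s k + y (s k))" by (simp add: s)
  also have "\<dots> = amp x (s k) + y (amp x (s k))" using AD(1)[OF y(1) x] by (simp add: bl_simps)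
  finally show "s (amp x k) = amp x (s k)" by (rule resolvent_unique[OF y(2)])
next
  obtain g where g: "g \<in> K0" "g + y g = cyc"
    using resolvent_equation[OF y(2) closed_K0 subspace_K0 A_K0[OF y(1)] cyc_K0] by blast
  have "s cyc = g" by (rule resolvent_unique[OF y(2)]) (simp add: s g)
  then show "s cyc \<in> K0" using g by simp
qed

text \<open>\<open>y\<close> commutes with the amplified algebra, so it kills the orbit of
  \<open>cyc\<close>, hence all of \<open>K0\<close>, which contains \<open>x cyc\<close>.\<close>

lemma A_separating:
  assumes y: "y \<in> A" "y cyc = 0" and x: "x \<in> A" shows "y (x cyc) = 0"
proof -
  have "x cyc \<in> {k. y k \<in> {0}}"
    by (rule K0_induct[OF AD(2)[OF x] closed_vimage_op[OF closed_singleton]]) (simp add: AD(1)[OF y(1)] y(2))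
  then show ?thesis by simp
qed

lemma om_symm_adj:
  assumes y: "y \<in> A" "symm y" and x: "x \<in> M" shows "om y (adj x) = inner (y cyc) (amp x cyc)" "om y x = inner (y cyc) (amp x cyc)"
proof -
  show "om y (adj x) = inner (y cyc) (amp x cyc)" using x by (simp add: om_def amp_adj_inner(2))
  have "inner (y cyc) (amp x cyc) = inner cyc (y (amp x cyc))" using y(2) by (simp add: symm_def)
  then show "om y x = inner (y cyc) (amp x cyc)" using AD(1)[OF y(1) x, of cyc] by (simp add: om_def inner_commute)
qed

end

section \<open>The functional \<open>psi\<close> on symmetric elements of the commutant\<close>

context invariant_sum
begin

text \<open>\<open>Psi\<close> handles positive functionals; the shift by the norm of
  \<open>y\<close> writes a symmetric \<open>y\<close> as a difference of positive elements, and
  \<open>psi_repr\<close> shows that any other such difference gives the same value.\<close>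

definition psi :: "('h ell2 \<Rightarrow>\<^sub>L 'h ell2) \<Rightarrow> real" where
  "psi y = Psi (om (y + norm y *\<^sub>R id_blinfun)) - Psi (om (norm y *\<^sub>R id_blinfun))"

lemma Psi_om_add:
  assumes "p \<in> A" "psd p" "p' \<in> A" "psd p'" shows "Psi (om (p + p')) = Psi (om p) + Psi (om p')"
proof -
  have "om (p + p') = (\<lambda>x. om p x + om p' x)" by (simp add: om_linear fun_eq_iff)
  then show ?thesis using Psi_add[OF om_bounded om_bounded] assms by simp
qed

lemma Psi_om_scale:
  assumes "p \<in> A" "psd p" "r \<ge> 0" shows "Psi (om (r *\<^sub>R p)) = r * Psi (om p)"
proof -
  have "om (r *\<^sub>R p) = (\<lambda>x. r * om p x)" by (simp add: om_linear fun_eq_iff)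
  then show ?thesis using Psi_scale[OF om_bounded] assms by simp
qed

lemma symm_decomp:
  assumes "y \<in> A" "symm y"
  shows "y + norm y *\<^sub>R id_blinfun \<in> A" "psd (y + norm y *\<^sub>R id_blinfun)"
    "norm y *\<^sub>R id_blinfun \<in> A" "psd (norm y *\<^sub>R id_blinfun :: 'h ell2 \<Rightarrow>\<^sub>L 'h ell2)"
    "(y + norm y *\<^sub>R id_blinfun) - norm y *\<^sub>R id_blinfun = y"
  using assms psd_norm_minus(2)[of y] by (auto intro!: A_add' A_scale' A_id' simp: add.commute)

lemma psi_repr:
  assumes p: "p \<in> A" "psd p" and p': "p' \<in> A" "psd p'"
  shows "psi (p - p') = Psi (om p) - Psi (om p')"
proof -
  define y where "y = p - p'"
  have y: "y \<in> A" "symm y" using assms by (auto simp: y_def psd_def intro: A_diff')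
  note d = symm_decomp[OF y]
  have "Psi (om (y + norm y *\<^sub>R id_blinfun)) + Psi (om p') = Psi (om ((y + norm y *\<^sub>R id_blinfun) + p'))"
    using Psi_om_add[OF d(1,2) p'] by simp
  also have "(y + norm y *\<^sub>R id_blinfun) + p' = p + norm y *\<^sub>R id_blinfun" by (simp add: y_def)
  also have "Psi (om \<dots>) = Psi (om p) + Psi (om (norm y *\<^sub>R id_blinfun))" by (rule Psi_om_add[OF p d(3,4)])
  finally show ?thesis by (simp add: psi_def y_def[symmetric])
qed

lemma psi_psd:
  assumes "p \<in> A" "psd p" shows "psi p = Psi (om p)"
proof -
  have "0 \<in> A" using A_scale'[OF A_id', of 0] by simp
  moreover have "Psi (om 0) = 0" using Psi_om_scale[OF A_id' psd_intros(2), of 0] by simp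
  ultimately show ?thesis using psi_repr[OF assms, of 0] by simp
qed

lemma psi_add':
  assumes x: "x \<in> A" "symm x" and y: "y \<in> A" "symm y" shows "psi (x + y) = psi x + psi y"
proof -
  note dx = symm_decomp[OF x] note dy = symm_decomp[OF y]
  let ?p = "x + norm x *\<^sub>R id_blinfun" and ?p' = "y + norm y *\<^sub>R id_blinfun"
  let ?n = "norm x *\<^sub>R id_blinfun :: 'h ell2 \<Rightarrow>\<^sub>L 'h ell2" and ?n' = "norm y *\<^sub>R id_blinfun :: 'h ell2 \<Rightarrow>\<^sub>L 'h ell2"
  have "psi ((?p + ?p') - (?n + ?n')) = Psi (om (?p + ?p')) - Psi (om (?n + ?n'))"
    by (intro psi_repr A_add' psd_intros dx dy)
  also have "\<dots> = psi x + psi y"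
    using dx dy by (simp add: Psi_om_add psi_def)
  finally show ?thesis by (simp add: algebra_simps)
qed

lemma psi_scale':
  assumes x: "x \<in> A" "symm x" shows "psi (r *\<^sub>R x) = r * psi x"
proof -
  note dx = symm_decomp[OF x]
  let ?p = "x + norm x *\<^sub>R id_blinfun" and ?n = "norm x *\<^sub>R id_blinfun :: 'h ell2 \<Rightarrow>\<^sub>L 'h ell2"
  have pos: "psi (s *\<^sub>R p - s *\<^sub>R p') = s * (Psi (om p) - Psi (om p'))"
    if "s \<ge> 0" "p \<in> A" "psd p" "p' \<in> A" "psd p'" for s p p'
    using that psi_repr[of "s *\<^sub>R p" "s *\<^sub>R p'"] by (simp add: Psi_om_scale A_scale' right_diff_distrib)
  show ?thesis
  proof (cases "r \<ge> 0")
    case True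
    have "r *\<^sub>R x = r *\<^sub>R ?p - r *\<^sub>R ?n" by (simp add: scaleR_add_right)
    then show ?thesis using pos[OF True dx(1-4)] by (simp add: psi_def)
  next
    case False
    have "r *\<^sub>R x = (- r) *\<^sub>R ?n - (- r) *\<^sub>R ?p" by (simp add: scaleR_add_right)
    then have "psi (r *\<^sub>R x) = (- r) * (Psi (om ?n) - Psi (om ?p))" using pos[of "- r" ?n ?p] False dx(1-4) by simp
    then show ?thesis by (simp add: psi_def algebra_simps)
  qed
qed

lemma norm_cyc: "norm cyc = 1"
  using amp_cyc[OF M_id psd_intros(2)] R1 by (simp add: amp_simps norm_eq_sqrt_inner)

text \<open>The increments of \<open>X\<close> are positive and sum up to \<open>z - X 0\<close>, so
  this is countable additivity of \<open>Psi\<close> in telescoped form.\<close>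

lemma psi_mono':
  assumes X: "\<And>n. X n \<in> A" "\<And>n. symm (X n)" "\<And>n. psd (X (Suc n) - X n)" and z: "z \<in> A"
    and lim: "\<And>f. (\<lambda>n. blinfun_apply (X n) f) \<longlonglongrightarrow> blinfun_apply z f"
  shows "(\<lambda>n. psi (X n)) \<longlonglongrightarrow> psi z"
proof -
  define w where "w k = X (Suc k) - X k" for k
  have w: "w k \<in> A" "psd (w k)" for k using X by (auto simp: w_def A_diff')
  have sw: "(\<Sum>k<n. w k) = X n - X 0" for n unfolding w_def by (rule sum_lessThan_telescope)
  have zX: "psd (z - X 0)" by (rule psd_increasing_limit[of X, OF X(3) lim])
  have zs: "symm z" by (rule symm_limit[OF X(2) lim])
  have zA: "z - X 0 \<in> A" using z X by (intro A_diff')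
  have "(\<lambda>k. Psi (om (w k))) sums Psi (om (z - X 0))"
  proof (rule Psi_sums[OF om_bounded[OF zA zX] om_bounded[OF w]])
    fix x
    have "(\<Sum>k<n. om (w k) x) = om (X n - X 0) x" for n
      unfolding sw[symmetric] by (simp add: om_def bl_simps blinfun.sum_left blinfun.sum_right inner_sum_left)
    then show "(\<lambda>k. om (w k) x) sums om (z - X 0) x" unfolding sums_def om_def
      by (simp only: blinfun.diff_left) (intro tendsto_inner tendsto_const op_tendsto tendsto_diff lim)
  qed
  then have 1: "(\<lambda>n. (\<Sum>k<n. psi (w k)) + psi (X 0)) \<longlonglongrightarrow> psi (z - X 0) + psi (X 0)"
    unfolding sums_def psi_psd[OF w] psi_psd[OF zA zX] by (intro tendsto_add tendsto_const)
  have "psi (X n) = (\<Sum>k<n. psi (w k)) + psi (X 0)" for n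
  proof (induction n)
    case (Suc n)
    have "psi (X (Suc n)) = psi (w n + X n)" by (simp add: w_def)
    also have "\<dots> = psi (w n) + psi (X n)" using w X by (intro psi_add') (auto simp: psd_def)
    finally show ?case using Suc by simp
  qed simp
  moreover have "psi z = psi (z - X 0) + psi (X 0)"
    using psi_add'[OF zA psdD(1)[OF zX] X(1,2), of 0] by simp
  ultimately have "(\<lambda>n. psi (X n)) = (\<lambda>n. (\<Sum>k<n. psi (w k)) + psi (X 0))" "psi z = psi (z - X 0) + psi (X 0)" by blast+
  then show ?thesis using 1 by (simp only:)
qed

sublocale op: operator_state A cyc psi
proof
  show "y (x cyc) = 0" if "y \<in> A" "x \<in> A" "y cyc = 0" for x y by (rule A_separating[OF that(1,3,2)])
  show "psi x = 0" if "x \<in> A" "symm x" "x cyc = 0" for x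
  proof -
    \<comment> \<open>\<open>om\<close> uses an operator only at \<open>cyc\<close>, so the two
      functionals in the definition of \<open>psi\<close> coincide.\<close>
    have "om (x + norm x *\<^sub>R id_blinfun) = om (norm x *\<^sub>R id_blinfun)"
      using that by (simp add: fun_eq_iff om_def bl_simps)
    then show ?thesis by (simp add: psi_def)
  qed
qed (fact A_id' A_add' A_scale' A_comp' A_lim' A_res' A_separating psi_add' psi_scale' psi_mono' | simp add: norm_cyc)+

text \<open>The squares of \<open>u + d\<close> and \<open>u - d\<close>, divided by
  \<open>4 d\<close>, differ by \<open>u\<close> and sum to \<open>(u^2 + d^2) / (2 d)\<close>, on
  which \<open>R\<close> is at most \<open>d\<close>. So the norm of \<open>amp u cyc\<close>
  controls the norm of the state.\<close>

lemma sum_norm_le_state_norm: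
  assumes u: "u \<in> M" "symm u" and d: "d > 0" and t: "norm (amp u cyc) \<le> d"
  shows "\<exists>x1\<in>M. \<exists>x2\<in>M. psd x1 \<and> psd x2 \<and> u = x1 - x2 \<and> R (x1 + x2) \<le> d"
proof -
  define a where "a = u + d *\<^sub>R id_blinfun"
  define a' where "a' = u - d *\<^sub>R id_blinfun"
  have aM: "a \<in> M" "a' \<in> M" using u by (auto simp: a_def a'_def intro: M_intros)
  have "symm a" "symm a'" using u by (auto simp: a_def a'_def)
  then have sq: "psd (a o\<^sub>L a)" "psd (a' o\<^sub>L a')" by (auto intro!: psd_square simp: symm_def)
  have uu: "psd (u o\<^sub>L u)" using u by (auto intro!: psd_square simp: symm_def)
  have Ruu: "R (u o\<^sub>L u) \<le> d\<^sup>2"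
  proof -
    have "R (u o\<^sub>L u) = (norm (amp u cyc))\<^sup>2"
      using u uu norm_amp_square[OF u(1), of cyc] by (simp add: adj_symm amp_cyc M_comp)
    also have "\<dots> \<le> d\<^sup>2" using t by (intro power_mono) auto
    finally show ?thesis .
  qed
  let ?x1 = "(1 / (4 * d)) *\<^sub>R (a o\<^sub>L a)" and ?x2 = "(1 / (4 * d)) *\<^sub>R (a' o\<^sub>L a')"
  have e: "(a o\<^sub>L a) - (a' o\<^sub>L a') = (4 * d) *\<^sub>R u" "(a o\<^sub>L a) + (a' o\<^sub>L a') = 2 *\<^sub>R (u o\<^sub>L u) + (2 * d\<^sup>2) *\<^sub>R id_blinfun"
    by (auto intro!: blinfun_eqI simp: a_def a'_def bl_simps power2_eq_square scaleR_2 scaleR_add_left[symmetric] algebra_simps)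
  have "u = ?x1 - ?x2" using e(1) d by (simp flip: scaleR_diff_right)
  moreover have "R (?x1 + ?x2) \<le> d"
  proof -
    have "R (?x1 + ?x2) = (1 / (4 * d)) * R (2 *\<^sub>R (u o\<^sub>L u) + (2 * d\<^sup>2) *\<^sub>R id_blinfun)"
      using aM by (simp add: pfunD(2)[OF R] M_intros flip: scaleR_add_right e(2))
    also have "\<dots> = (1 / (4 * d)) * (2 * R (u o\<^sub>L u) + 2 * d\<^sup>2)"
      using u by (simp add: pfunD(1,2)[OF R] M_intros R1)
    also have "\<dots> \<le> (1 / (4 * d)) * (4 * d\<^sup>2)" using Ruu d by (intro mult_left_mono) auto
    also have "\<dots> = d" using d by (simp add: power2_eq_square)
    finally show ?thesis .
  qed
  ultimately show ?thesis using sq d aM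
    by (intro bexI[of _ ?x1] bexI[of _ ?x2] conjI psd_intros) (auto intro: M_intros)
qed

text \<open>The predual norm is the dual norm of the unit ball of \<open>A\<close>: an element outside a ball of the
  former norm has positive Hilbert space distance from it, and the nearest point separates.\<close>

lemma duality:
  assumes x: "x \<in> M" "symm x" and r: "r \<ge> 0" and e: "e > 0"
    and le: "\<And>y. y \<in> A \<Longrightarrow> symm y \<Longrightarrow> psd (id_blinfun - y) \<Longrightarrow> psd (id_blinfun + y) \<Longrightarrow> om y x \<le> r"
  shows "\<exists>x1\<in>M. \<exists>x2\<in>M. psd x1 \<and> psd x2 \<and> x = x1 - x2 \<and> R (x1 + x2) \<le> r + e"
proof (rule ccontr)
  assume neg: "\<not> ?thesis"
  \<comment> \<open>The slack is split: half of it enlarges the radius of the ball \<open>Q\<close>,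
    half is the distance that \<open>x\<close> keeps from \<open>Q\<close>.\<close>
  define s where "s = r + e / 2"
  define d where "d = e / 2"
  have s: "s > 0" "s > r" and d: "d > 0" using r e by (auto simp: s_def d_def)
  define Q where "Q = {w. \<exists>x1\<in>M. \<exists>x2\<in>M. psd x1 \<and> psd x2 \<and> w = x1 - x2 \<and> R (x1 + x2) \<le> s}"
  have QI: "x1 - x2 \<in> Q" if "x1 \<in> M" "x2 \<in> M" "psd x1" "psd x2" "R x1 + R x2 \<le> s" for x1 x2
    using that pfunD(1)[OF R that(1,2)] unfolding Q_def by auto
  have QM: "w \<in> M" "symm w" if "w \<in> Q" for w using that by (auto simp: Q_def psd_def intro: M_diff)
  \<comment> \<open>Otherwise \<open>sum_norm_le_state_norm\<close> decomposes \<open>x - w\<close>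
    at cost \<open>d\<close>, and together with \<open>w\<close> this decomposes \<open>x\<close> at
    cost \<open>s + d = r + e\<close>.\<close>
  have far: "d \<le> norm (amp (w - x) cyc)" if w: "w \<in> Q" for w
  proof (rule ccontr)
    assume "\<not> ?thesis"
    then have "norm (amp (x - w) cyc) \<le> d" by (simp add: amp_simps bl_simps norm_minus_commute)
    then obtain u1 u2 where u: "u1 \<in> M" "u2 \<in> M" "psd u1" "psd u2" "x - w = u1 - u2" "R (u1 + u2) \<le> d"
      using sum_norm_le_state_norm[of "x - w" d] x QM[OF w] d by (auto intro: M_diff)
    obtain x1 x2 where x12: "x1 \<in> M" "x2 \<in> M" "psd x1" "psd x2" "w = x1 - x2" "R (x1 + x2) \<le> s"
      using w by (auto simp: Q_def)
    have "x = (x1 + u1) - (x2 + u2)" using u(5) x12(5) by (simp add: algebra_simps)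
    moreover have "R ((x1 + u1) + (x2 + u2)) \<le> r + e"
      using u x12 by (simp add: pfunD(1)[OF R] M_add s_def d_def)
    moreover have "x1 + u1 \<in> M" "x2 + u2 \<in> M" "psd (x1 + u1)" "psd (x2 + u2)"
      using u x12 by (simp_all add: M_add)
    ultimately show False using neg by blast
  qed
  have "convex Q" unfolding convex_alt
  proof (intro ballI allI impI)
    fix w w' t assume w: "w \<in> Q" "w' \<in> Q" and t: "0 \<le> t \<and> t \<le> (1::real)"
    obtain x1 x2 where a: "x1 \<in> M" "x2 \<in> M" "psd x1" "psd x2" "w = x1 - x2" "R (x1 + x2) \<le> s"
      using w by (auto simp: Q_def)
    obtain u1 u2 where b: "u1 \<in> M" "u2 \<in> M" "psd u1" "psd u2" "w' = u1 - u2" "R (u1 + u2) \<le> s"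
      using w by (auto simp: Q_def)
    let ?v1 = "(1 - t) *\<^sub>R x1 + t *\<^sub>R u1" and ?v2 = "(1 - t) *\<^sub>R x2 + t *\<^sub>R u2"
    have v: "?v1 \<in> M" "?v2 \<in> M" by (intro M_add M_scale a b)+
    have vp: "psd ?v1" "psd ?v2" by (rule psd_intros(3)[OF psd_intros(4) psd_intros(4)], use a b t in simp_all)+
    have "R ?v1 + R ?v2 = (1 - t) * R (x1 + x2) + t * R (u1 + u2)"
      using a(1,2) b(1,2) by (simp add: pfunD(1,2)[OF R] M_add M_scale distrib_left add_ac)
    also have "\<dots> \<le> (1 - t) * s + t * s"
      using a(6) b(6) t by (intro add_mono mult_left_mono) auto
    finally have "?v1 - ?v2 \<in> Q" by (intro QI v vp) (simp add: algebra_simps)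
    moreover have "(1 - t) *\<^sub>R w + t *\<^sub>R w' = ?v1 - ?v2" unfolding a(5) b(5) by (simp add: algebra_simps)
    ultimately show "(1 - t) *\<^sub>R w + t *\<^sub>R w' \<in> Q" by (simp only:)
  qed
  have Q0: "0 \<in> Q" using QI[OF M_0 M_0] s by (simp add: pfunD(6)[OF R])
  \<comment> \<open>With \<open>L = 0\<close> the minimisation yields the point of the closure
    nearest to \<open>x\<close>, and \<open>p\<close> is the difference vector.\<close>
  obtain p l w where w: "\<And>n::nat. w n \<in> Q" "(\<lambda>n. amp (w n - x) cyc) \<longlonglongrightarrow> p" "(\<lambda>n. 0 :: real) \<longlonglongrightarrow> l"
    and min: "\<And>z. z \<in> Q \<Longrightarrow> 0 - inner p (amp (z - x) cyc) \<le> l - (norm p)\<^sup>2"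
  proof (rule convex_minimization[of Q "\<lambda>w. amp (w - x) cyc" "\<lambda>_. 0" 0 0])
    show "amp ((1 - t) *\<^sub>R y + t *\<^sub>R z - x) cyc = (1 - t) *\<^sub>R amp (y - x) cyc + t *\<^sub>R amp (z - x) cyc" for y z t
      by (simp add: amp_simps bl_simps algebra_simps)
  qed (use Q0 \<open>convex Q\<close> in auto)
  have l: "l = 0" using w(3) LIMSEQ_unique tendsto_const by metis
  have pd: "d \<le> norm p" by (rule lim_ge[OF tendsto_norm[OF w(2)]]) (rule far[OF w(1)])
  then have p: "(norm p)\<^sup>2 > 0" using d by (intro zero_less_power) linarith
  \<comment> \<open>The functional separating \<open>x\<close> from \<open>Q\<close>: at most
    \<kappa> on \<open>Q\<close>, and larger by \<open>||p||^2\<close> at \<open>x\<close>.\<close>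
  define \<theta> where "\<theta> z = - inner p (amp z cyc)" for z
  have \<theta>: "\<theta> (y + z) = \<theta> y + \<theta> z" "\<theta> (y - z) = \<theta> y - \<theta> z" "\<theta> (a *\<^sub>R y) = a * \<theta> y" for y z a
    by (simp_all add: \<theta>_def amp_simps bl_simps)
  define \<kappa> where "\<kappa> = \<theta> x - (norm p)\<^sup>2"
  have \<theta>Q: "\<theta> z \<le> \<kappa>" if "z \<in> Q" for z
    using min[OF that] by (simp add: \<kappa>_def \<theta>_def l amp_simps bl_simps)
  have \<kappa>0: "\<kappa> \<ge> 0" using \<theta>Q[OF Q0] \<theta>(3)[of 0 0] by simp
  \<comment> \<open>Both signs of a positive \<open>z\<close>, rescaled so that \<open>R\<close>
    takes the value \<open>s\<close>, lie in \<open>Q\<close>.\<close>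
  have bound: "\<bar>\<theta> z\<bar> * s \<le> \<kappa> * R z" if z: "z \<in> M" "psd z" for z
  proof (cases "R z = 0")
    case True
    then have "z = 0" using faithful z by blast
    then show ?thesis using True \<theta>(3)[of 0 0] by simp
  next
    case False
    then have Rz: "R z > 0" using pfunD(4)[OF R z] by simp
    have "(s / R z) *\<^sub>R z \<in> Q" "- ((s / R z) *\<^sub>R z) \<in> Q"
      using QI[of "(s / R z) *\<^sub>R z" 0] QI[of 0 "(s / R z) *\<^sub>R z"] z s Rz
      by (simp_all add: M_intros pfunD(2,6)[OF R])
    then have "\<bar>(s / R z) * \<theta> z\<bar> \<le> \<kappa>" using \<theta>Q[of "(s / R z) *\<^sub>R z"] \<theta>Q[of "- ((s / R z) *\<^sub>R z)"] \<theta>(3)[of "-1" "(s / R z) *\<^sub>R z"]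
      by (simp add: \<theta>(3) abs_le_iff)
    then show ?thesis using Rz s by (simp add: abs_mult field_simps)
  qed
  have \<kappa>: "\<kappa> > 0"
  proof (rule ccontr)
    assume "\<not> \<kappa> > 0"
    then have k0: "\<kappa> = 0" using \<kappa>0 by simp
    have t0: "\<theta> z = 0" if "z \<in> M" "psd z" for z using bound[OF that] k0 s by (simp add: mult_le_0_iff)
    have "\<theta> (norm x *\<^sub>R id_blinfun + x) = 0"
      by (rule t0[OF _ psd_norm_minus(2)[OF x(2)]]) (intro M_intros x)
    moreover have "\<theta> (norm x *\<^sub>R id_blinfun) = 0" by (rule t0) (auto intro: M_intros)
    ultimately have "\<theta> x = 0" by (simp add: \<theta>(1))
    then show False using k0 p by (simp add: \<kappa>_def)
  qed
  \<comment> \<open>\<theta> is made invariant under \<open>adj\<close>, scaled so that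
    \<open>R\<close> dominates its modulus on positive elements, and shifted by \<open>R\<close> to
    lie between 0 and \<open>2 R\<close>. It then comes from some \<open>y'\<close> with
    \<open>0 <= y' <= 2\<close>, and \<open>y' - 1\<close> lies in the unit ball.\<close>
  define W where "W z = R z + (s / \<kappa>) * ((1/2) * (\<theta> z + \<theta> (adj z)))" for z
  have W: "bounded_by 2 W" unfolding bounded_by_def pfun_def
  proof (intro conjI ballI allI impI)
    fix z a assume z: "z \<in> M"
    show "W (z + z') = W z + W z'" if "z' \<in> M" for z' using z that by (simp add: W_def pfunD(1)[OF R] adj_add \<theta> algebra_simps)
    show "W (a *\<^sub>R z) = a * W z" using z by (simp add: W_def pfunD(2)[OF R] adj_scale \<theta> algebra_simps)
    show "W (adj z) = W z" using z by (simp add: W_def pfunD(3)[OF R] adj_adj)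
    assume zp: "psd z"
    then have Wz: "W z = R z + (s / \<kappa>) * \<theta> z" using z by (simp add: W_def adj_symm psdD)
    have "\<bar>(s / \<kappa>) * \<theta> z\<bar> \<le> R z" using bound[OF z zp] s \<kappa> by (simp add: abs_mult field_simps)
    then have "(s / \<kappa>) * \<theta> z \<le> R z" "- ((s / \<kappa>) * \<theta> z) \<le> R z" unfolding abs_le_iff by blast+
    then show "0 \<le> W z" "W z \<le> 2 * R z" using Wz by simp_all
  qed simp
  obtain y' where y': "y' \<in> A" "psd y'" "psd (2 *\<^sub>R id_blinfun - y')" "\<And>z. z \<in> M \<Longrightarrow> psd z \<Longrightarrow> om y' z = W z"
    using om_surj[OF W] by blast
  define y where "y = y' - id_blinfun"
  have "id_blinfun - y = 2 *\<^sub>R id_blinfun - y'" "id_blinfun + y = y'" by (simp_all add: y_def scaleR_2)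
  then have "psd (id_blinfun - y)" "psd (id_blinfun + y)" using y'(2,3) by (simp_all only:)
  moreover have "y \<in> A" "symm y" unfolding y_def by (intro A_diff' A_id' y' symm_intros psdD(1))+
  ultimately have "om y x \<le> r" by (intro le)
  moreover have "om y x = (s / \<kappa>) * \<theta> x"
  proof -
    have "om y' x = W x" using W by (intro om_symm_ext[OF _ y'(1,2,4) x]) (auto simp: bounded_by_def)
    moreover have "om id_blinfun x = R x" by (rule om_symm_ext[OF R A_id' psd_intros(2) om_id x])
    ultimately show ?thesis using x by (simp add: y_def om_linear W_def adj_symm)
  qed
  moreover have "(s / \<kappa>) * \<theta> x = s + (s / \<kappa>) * (norm p)\<^sup>2" using \<kappa> by (simp add: \<kappa>_def field_simps)
  moreover have "(s / \<kappa>) * (norm p)\<^sup>2 > 0" using s \<kappa> p by simp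
  ultimately show False using s by linarith
qed

text \<open>\<open>psi_approx\<close> with error \<open>1 / (n + 1)\<close> gives vectors in
  \<open>K0\<close>, hence symmetric \<open>X n\<close> that approximate \<open>psi\<close> on the
  ball. The Cauchy estimate is \<open>duality\<close> for \<open>X n - X m\<close>; convergence on
  the diagonal comes from writing the functional of a vector in the lineal as
  \<open>om y\<close>.\<close>

lemma approximation:
  shows "\<exists>X. (\<forall>n. X n \<in> M \<and> symm (X n)) \<and>
    (\<forall>n m. \<exists>x1\<in>M. \<exists>x2\<in>M. psd x1 \<and> psd x2 \<and> X n - X m = x1 - x2 \<and> R (x1 + x2) \<le> 3 / real (Suc n) + 3 / real (Suc m)) \<and>
    (\<forall>l f. 0 < l \<longrightarrow> (\<forall>x\<in>M. psd x \<longrightarrow> inner (x f) f \<le> l * R x) \<longrightarrow> (\<lambda>n. inner (X n f) f) \<longlonglongrightarrow> q f)"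
proof -
  define ball where "ball y \<longleftrightarrow> y \<in> A \<and> symm y \<and> psd (id_blinfun - y) \<and> psd (id_blinfun + y)" for y
  have approx: "\<exists>x. x \<in> M \<and> symm x \<and> (\<forall>y. ball y \<longrightarrow> \<bar>psi y - om y x\<bar> \<le> 2 * e)" if e: "e > 0" for e
  proof -
    obtain p where p: "p \<in> closure ((\<lambda>y. blinfun_apply y cyc) ` A)" "\<And>y. ball y \<Longrightarrow> \<bar>psi y - inner (y cyc) p\<bar> \<le> e"
      using op.psi_approx[OF e] by (auto simp: ball_def)
    have "closure ((\<lambda>y. blinfun_apply y cyc) ` A) \<subseteq> K0"
      by (rule closure_minimal) (auto simp: closed_K0 AD(2))
    then have "p \<in> closure ((\<lambda>x. amp x cyc) ` M)" using p(1) by (auto simp: K0_def)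
    then obtain z where z: "z \<in> M" "dist (amp z cyc) p < e" using e unfolding closure_approachable by blast
    \<comment> \<open>Against symmetric \<open>y\<close> only the symmetric part of \<open>z\<close>
      counts, by \<open>om_symm_adj\<close>.\<close>
    define x where "x = (1/2) *\<^sub>R (z + adj z)"
    have x: "x \<in> M" "symm x" using z by (auto simp: x_def adj intro!: M_intros symm_intros symm_add_adj)
    have "\<bar>psi y - om y x\<bar> \<le> 2 * e" if y: "ball y" for y
    proof -
      have yA: "y \<in> A" "symm y" using y by (auto simp: ball_def)
      have "om y x = (1/2) * (om y z + om y (adj z))" by (simp add: x_def om_def amp_simps bl_simps)
      then have "om y x = inner (y cyc) (amp z cyc)" using om_symm_adj[OF yA z(1)] by simp
      moreover have "\<bar>inner (y cyc) (amp z cyc) - inner (y cyc) p\<bar> \<le> e"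
      proof -
        have "\<bar>inner (y cyc) (amp z cyc - p)\<bar> \<le> norm (y cyc) * norm (amp z cyc - p)" by (rule Cauchy_Schwarz_ineq2)
        also have "\<dots> \<le> 1 * e"
          using contraction_norm_le[of y cyc] y z(2) e norm_cyc by (intro mult_mono) (auto simp: ball_def dist_norm)
        finally show ?thesis by (simp add: inner_diff_right)
      qed
      ultimately show ?thesis using p(2)[OF y] by linarith
    qed
    then show ?thesis using x by blast
  qed
  have "\<exists>x. x \<in> M \<and> symm x \<and> (\<forall>y. ball y \<longrightarrow> \<bar>psi y - om y x\<bar> \<le> 2 * (1 / real (Suc n)))" for n
    by (rule approx) simp
  then have "\<exists>X. \<forall>n. X n \<in> M \<and> symm (X n) \<and> (\<forall>y. ball y \<longrightarrow> \<bar>psi y - om y (X n)\<bar> \<le> 2 * (1 / real (Suc n)))"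
    by (intro choice) blast
  then obtain X where X: "\<And>n. X n \<in> M" "\<And>n. symm (X n)" "\<And>n y. ball y \<Longrightarrow> \<bar>psi y - om y (X n)\<bar> \<le> 2 * (1 / real (Suc n))"
    by blast
  have cauchy: "\<exists>x1\<in>M. \<exists>x2\<in>M. psd x1 \<and> psd x2 \<and> X n - X m = x1 - x2 \<and> R (x1 + x2) \<le> 3 / real (Suc n) + 3 / real (Suc m)" for n m
  proof -
    \<comment> \<open>Numerator 2 stems from the approximation errors, 1 is the slack that
      \<open>duality\<close> asks for; together they make the constant 3.\<close>
    have "\<exists>x1\<in>M. \<exists>x2\<in>M. psd x1 \<and> psd x2 \<and> X n - X m = x1 - x2 \<and>
      R (x1 + x2) \<le> (2 * (1 / real (Suc n)) + 2 * (1 / real (Suc m))) + (1 / real (Suc n) + 1 / real (Suc m))"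
    proof (rule duality)
      show "om y (X n - X m) \<le> 2 * (1 / real (Suc n)) + 2 * (1 / real (Suc m))"
        if "y \<in> A" "symm y" "psd (id_blinfun - y)" "psd (id_blinfun + y)" for y
      proof -
        have "ball y" using that by (simp add: ball_def)
        moreover have "om y (X n - X m) = om y (X n) - om y (X m)" by (simp add: om_def amp_simps bl_simps)
        ultimately show ?thesis using X(3)[of y n] X(3)[of y m] by linarith
      qed
    qed (use X in \<open>auto intro: M_diff add_pos_pos\<close>)
    moreover have "(2 * (1 / real (Suc n)) + 2 * (1 / real (Suc m))) + (1 / real (Suc n) + 1 / real (Suc m))
      = 3 / real (Suc n) + 3 / real (Suc m)" by (simp del: of_nat_Suc)
    ultimately show ?thesis by (simp only:)
  qed
  have lim: "(\<lambda>n. inner (X n f) f) \<longlonglongrightarrow> q f" if l: "0 < l" and f: "\<And>x. x \<in> M \<Longrightarrow> psd x \<Longrightarrow> inner (x f) f \<le> l * R x" for l f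
  proof -
    define w where "w x = inner (blinfun_apply x f) f" for x
    have w: "bounded_by l w" using l f pfun_vec[of f] by (auto simp: bounded_by_def w_def[abs_def])
    obtain y where y: "y \<in> A" "psd y" "psd (l *\<^sub>R id_blinfun - y)" "\<And>z. z \<in> M \<Longrightarrow> psd z \<Longrightarrow> om y z = w z"
      using om_surj[OF w] by blast
    \<comment> \<open>The single vector \<open>f\<close> represents its own functional, so
      \<open>Psi w\<close> is just \<open>q f\<close>.\<close>
    have "rep w {0 :: nat} (\<lambda>_. f)" by (auto simp: rep_def w_def intro!: has_sum_finiteI)
    from Psi_has_sum[OF w this] have qf: "q f = Psi w" by (metis (no_types, lifting) has_sum_finite has_sum_unique finite.emptyI finite_insert sum.insert sum.empty empty_iff add.right_neutral)
    have psiy: "psi y = q f" using Psi_cong[OF y(4)] by (simp add: psi_psd[OF y(1,2)] qf)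
    have wX: "om y (X n) = inner (X n f) f" for n
    proof -
      have "pfun w" using w by (simp add: bounded_by_def)
      from om_symm_ext[OF this y(1,2,4) X(1,2)] show ?thesis by (simp only: w_def)
    qed
    define y1 where "y1 = (1 / l) *\<^sub>R y"
    have "id_blinfun - y1 = (1/l) *\<^sub>R (l *\<^sub>R id_blinfun - y)" using l by (simp add: y1_def scaleR_diff_right)
    then have "ball y1" using y l by (auto simp: ball_def y1_def psd_def[of y] intro!: A_scale' psd_intros)
    have lim: "(\<lambda>n. 2 * l * (1 / real (Suc n))) \<longlonglongrightarrow> 2 * l * 0"
      by (intro tendsto_mult tendsto_const LIMSEQ_Suc[OF lim_1_over_n])
    have bd: "\<bar>inner (X n f) f - q f\<bar> \<le> 2 * l * (1 / real (Suc n))" for n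
    proof -
      have "psi y1 - om y1 (X n) = (1/l) * (q f - inner (X n f) f)"
        using y by (simp add: y1_def psi_scale' psd_def om_linear wX psiy right_diff_distrib)
      then have "\<bar>(1/l) * (q f - inner (X n f) f)\<bar> \<le> 2 * (1 / real (Suc n))" using X(3)[OF \<open>ball y1\<close>, of n] by simp
      then show ?thesis using l by (simp add: abs_mult field_simps abs_minus_commute)
    qed
    have "(\<lambda>n. inner (X n f) f - q f) \<longlonglongrightarrow> 0"
    proof (rule Lim_null_comparison)
      show "\<forall>\<^sub>F n in sequentially. norm (inner (X n f) f - q f) \<le> 2 * l * (1 / real (Suc n))"
        unfolding real_norm_def by (rule always_eventually, rule allI, rule bd)
      show "(\<lambda>n. 2 * l * (1 / real (Suc n))) \<longlonglongrightarrow> 0" using lim by (simp only: mult_zero_right)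
    qed
    then show ?thesis by (simp add: LIM_zero_iff)
  qed
  show ?thesis
  proof (intro exI[of _ X] conjI allI impI)
    show "X n \<in> M" "symm (X n)" for n by (rule X)+
    show "(\<lambda>n. inner (X n f) f) \<longlonglongrightarrow> q f" if "0 < l" "\<forall>x\<in>M. psd x \<longrightarrow> inner (x f) f \<le> l * R x" for l f
      using that by (intro lim) auto
  qed (rule cauchy)
qed

end

section \<open>The complex case\<close>

lemma cinner_add_right: "cinner x (y + z) = cinner x y + cinner x z" for x :: "'a::complex_inner"
  by (metis cinner_add_left cinner_commute complex_cnj_add)

lemma cinner_scaleC_right: "cinner x (c *\<^sub>C y) = cnj c * cinner x y" for x :: "'a::complex_inner"
  by (metis cinner_commute cinner_scaleC_left complex_cnj_mult)

lemma scaleC_minus1: "(- 1) *\<^sub>C x = - x" for x :: "'a::complex_vector"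
  using scaleC_of_real[of "-1" x] by simp

lemma cinner_minus: "cinner (- x) y = - cinner x y" "cinner x (- y) = - cinner x y" for x :: "'a::complex_inner"
  using cinner_scaleC_left[of "-1" x y] cinner_scaleC_right[of x "-1" y] by (simp_all add: scaleC_minus1)

lemma cinner_diff: "cinner (x - y) z = cinner x z - cinner y z" for x :: "'a::complex_inner"
  using cinner_add_left[of x "- y" z] by (simp add: cinner_minus)

lemma Re_cinner: "Re (cinner x y) = inner x y" and Im_cinner: "Im (cinner x y) = inner x (\<i> *\<^sub>C y)"
  for x :: "'a::complex_inner"
  by (simp_all add: inner_eq_Re_cinner cinner_scaleC_right)

lemma cinner_eq_Complex: "cinner x y = Complex (inner x y) (inner x (\<i> *\<^sub>C y))" for x :: "'a::complex_inner"
  by (simp add: complex_eq_iff Re_cinner Im_cinner)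

lemma inner_i_left: "inner (\<i> *\<^sub>C x) y = - inner x (\<i> *\<^sub>C y)" for x :: "'a::complex_inner"
  by (simp add: inner_eq_Re_cinner cinner_scaleC_left cinner_scaleC_right)

lemma cboundedD: "x \<in> cbounded_ops \<Longrightarrow> blinfun_apply x (c *\<^sub>C f) = c *\<^sub>C x f"
  by (simp add: cbounded_ops_def)

text \<open>The imaginary part of \<open>cinner f g\<close> is the real inner product of
  \<open>f\<close> with \<open>\<i> *\<^sub>C g\<close>, and complex linearity of \<open>y\<close>
  moves this factor through.\<close>

lemma is_adjoint_iff:
  assumes "y \<in> cbounded_ops"
  shows "is_adjoint x y \<longleftrightarrow> (\<forall>f g. inner (blinfun_apply x f) g = inner f (blinfun_apply y g))"
  unfolding is_adjoint_def cinner_eq_Complex using assms by (auto simp: cboundedD[symmetric])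

lemma is_adjoint_self_iff: "x \<in> cbounded_ops \<Longrightarrow> is_adjoint x x \<longleftrightarrow> symm x"
  by (simp add: is_adjoint_iff symm_def)

text \<open>Over the complex numbers real diagonal values force symmetry: expand at
  \<open>\<i> *\<^sub>C f + g\<close>. So \<open>psd\<close>, which demands symmetry explicitly, is
  the right real counterpart.\<close>

lemma positive_iff_psd:
  assumes x: "x \<in> cbounded_ops"
  shows "(\<forall>f. cinner (blinfun_apply x f) f \<in> \<real>\<^sub>\<ge>\<^sub>0) \<longleftrightarrow> psd x"
proof
  assume pos: "\<forall>f. cinner (x f) f \<in> \<real>\<^sub>\<ge>\<^sub>0"
  then have re: "0 \<le> inner (x f) f" and im: "Im (cinner (x f) f) = 0" for f
    by (auto simp: complex_nonneg_Reals_iff Re_cinner)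
  have "inner (x f) g = inner f (x g)" for f g
  proof -
    have "Im (cinner (x (\<i> *\<^sub>C f + g)) (\<i> *\<^sub>C f + g)) = 0" by (rule im)
    then have "Im (cinner (x (\<i> *\<^sub>C f)) g + cinner (x g) (\<i> *\<^sub>C f)) = 0"
      using im[of "\<i> *\<^sub>C f"] im[of g] by (simp add: blinfun.add_right cinner_add_left cinner_add_right)
    then have "Re (cinner (x f) g) = Re (cinner (x g) f)"
      using x by (simp add: cboundedD cinner_scaleC_left cinner_scaleC_right)
    then show ?thesis by (simp add: Re_cinner inner_commute)
  qed
  then show "psd x" using re by (auto simp: psd_def symm_def)
next
  assume p: "psd x"
  have "Im (cinner (x f) f) = 0" for f
  proof -
    have "is_adjoint x x" using x p by (simp add: is_adjoint_self_iff psd_def)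
    then have "cinner (x f) f = cinner f (x f)" by (simp add: is_adjoint_def)
    then show ?thesis using cinner_commute[of f "x f"] by (metis Reals_cnj_iff complex_is_Real_iff)
  qed
  then show "\<forall>f. cinner (x f) f \<in> \<real>\<^sub>\<ge>\<^sub>0" using p by (simp add: complex_nonneg_Reals_iff Re_cinner psd_def)
qed

lemma commutant_closed:
  fixes C :: "('h::chilbert_space \<Rightarrow>\<^sub>L 'h) set"
  assumes C: "C \<subseteq> cbounded_ops"
  shows "id_blinfun \<in> commutant C"
    "x \<in> commutant C \<Longrightarrow> y \<in> commutant C \<Longrightarrow> x + y \<in> commutant C"
    "x \<in> commutant C \<Longrightarrow> c *\<^sub>C x \<in> commutant C"
    "x \<in> commutant C \<Longrightarrow> y \<in> commutant C \<Longrightarrow> x o\<^sub>L y \<in> commutant C"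
    "(\<And>n. X n \<in> commutant C) \<Longrightarrow> (\<And>f. (\<lambda>n. blinfun_apply (X n) f) \<longlonglongrightarrow> blinfun_apply z f) \<Longrightarrow> z \<in> commutant C"
proof -
  have iff: "x \<in> commutant C \<longleftrightarrow> (\<forall>c f. x (c *\<^sub>C f) = c *\<^sub>C x f) \<and> (\<forall>s\<in>C. \<forall>f. s (x f) = x (s f))" for x
  proof -
    have "s o\<^sub>L x = x o\<^sub>L s \<longleftrightarrow> (\<forall>f. s (x f) = x (s f))" for s
      by (metis blinfun_eqI blinfun_apply_blinfun_compose)
    then show ?thesis by (auto simp: commutant_def cbounded_ops_def)
  qed
  show "id_blinfun \<in> commutant C" by (simp add: iff)
  show "x \<in> commutant C \<Longrightarrow> y \<in> commutant C \<Longrightarrow> x + y \<in> commutant C" by (simp add: iff bl_simps scaleC_add_right)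
  show "x \<in> commutant C \<Longrightarrow> y \<in> commutant C \<Longrightarrow> x o\<^sub>L y \<in> commutant C" by (simp add: iff)
  have "s (c *\<^sub>C f) = c *\<^sub>C s f" if "s \<in> C" for s c f using that C cboundedD by blast
  then show "x \<in> commutant C \<Longrightarrow> c *\<^sub>C x \<in> commutant C"
    by (simp add: iff blinfun_apply_scaleC scaleC_scaleC mult.commute)
  assume X: "\<And>n. X n \<in> commutant C" and lim: "\<And>f. (\<lambda>n. blinfun_apply (X n) f) \<longlonglongrightarrow> blinfun_apply z f"
  show "z \<in> commutant C" unfolding iff
  proof (intro conjI allI ballI)
    fix c f
    have "(\<lambda>n. c *\<^sub>C X n f) \<longlonglongrightarrow> c *\<^sub>C z f" by (intro bounded_linear.tendsto[OF bounded_linear_scaleC] lim)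
    moreover have "(\<lambda>n. c *\<^sub>C X n f) = (\<lambda>n. X n (c *\<^sub>C f))" using X by (simp add: iff)
    ultimately show "z (c *\<^sub>C f) = c *\<^sub>C z f" using lim[of "c *\<^sub>C f"] LIMSEQ_unique by metis
  next
    fix s f assume s: "s \<in> C"
    have "(\<lambda>n. s (X n f)) \<longlonglongrightarrow> s (z f)" by (intro op_tendsto lim)
    moreover have "(\<lambda>n. s (X n f)) = (\<lambda>n. X n (s f))" using X s by (simp add: iff)
    ultimately show "s (z f) = z (s f)" using lim[of "s f"] LIMSEQ_unique by metis
  qed
qed

lemma commutant_cbounded: "commutant C \<subseteq> cbounded_ops"
  by (auto simp: commutant_def)

section \<open>A faithful normal state as an instance of the real theory\<close>

locale faithful_normal_state =
  fixes M :: "('h::chilbert_space \<Rightarrow>\<^sub>L 'h) set" and \<phi> :: "'h \<Rightarrow>\<^sub>L 'h \<Rightarrow> complex"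
  assumes vN: "von_neumann_algebra M" and state: "state_on M \<phi>" and faith: "faithful_on M \<phi>" and normal: "normal_on M \<phi>"
begin

lemma M_cbounded: "M \<subseteq> cbounded_ops"
  using vN by (simp add: von_neumann_algebra_def)

lemma M_bicommutant: "M = commutant (commutant M)"
  using vN by (simp add: von_neumann_algebra_def)

lemma M_scaleC: "x \<in> M \<Longrightarrow> c *\<^sub>C x \<in> M"
  using commutant_closed(3)[OF commutant_cbounded, of x M c] M_bicommutant by simp

sublocale op_algebra M
proof
  show "id_blinfun \<in> M" using commutant_closed(1)[OF commutant_cbounded, of M] M_bicommutant by simp
  show "x + y \<in> M" "x o\<^sub>L y \<in> M" if "x \<in> M" "y \<in> M" for x y
    using commutant_closed(2,4)[OF commutant_cbounded, of x M y] that M_bicommutant by simp_all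
  show "r *\<^sub>R x \<in> M" if "x \<in> M" for x r using M_scaleC[OF that, of "of_real r"] by (simp add: scaleC_of_real)
  show "\<exists>x'\<in>M. \<forall>f g. inner (x f) g = inner f (blinfun_apply x' g)" if "x \<in> M" for x
    using vN that M_cbounded is_adjoint_iff unfolding von_neumann_algebra_def by (meson subsetD)
  show "z \<in> M" if "\<And>n. X n \<in> M" "\<And>f. (\<lambda>n. blinfun_apply (X n) f) \<longlonglongrightarrow> blinfun_apply z f" for X z
    using commutant_closed(5)[OF commutant_cbounded, of X M z] that M_bicommutant by simp
qed

lemma pos_part_iff: "x \<in> pos_part M \<longleftrightarrow> x \<in> M \<and> psd x"
  using M_cbounded positive_iff_psd unfolding pos_part_def by blast

lemma sa_part_iff: "x \<in> sa_part M \<longleftrightarrow> x \<in> M \<and> symm x"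
  using M_cbounded is_adjoint_self_iff unfolding sa_part_def by blast

lemma \<phi>_add: "x \<in> M \<Longrightarrow> y \<in> M \<Longrightarrow> \<phi> (x + y) = \<phi> x + \<phi> y"
  and \<phi>_scaleC: "x \<in> M \<Longrightarrow> \<phi> (c *\<^sub>C x) = c * \<phi> x"
  and \<phi>_pos: "x \<in> M \<Longrightarrow> psd x \<Longrightarrow> \<phi> x \<in> \<real>\<^sub>\<ge>\<^sub>0"
  and \<phi>_one: "\<phi> id_blinfun = 1"
  using state by (auto simp: state_on_def pos_part_iff)

lemma \<phi>_scaleR: "x \<in> M \<Longrightarrow> \<phi> (r *\<^sub>R x) = of_real r * \<phi> x"
  using \<phi>_scaleC[of x "of_real r"] by (simp add: scaleC_of_real)

lemma \<phi>_diff: "x \<in> M \<Longrightarrow> y \<in> M \<Longrightarrow> \<phi> (x - y) = \<phi> x - \<phi> y"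
  using \<phi>_add[of "x - y" y] by (simp add: M_diff)

lemma \<phi>_pos_real: "x \<in> M \<Longrightarrow> psd x \<Longrightarrow> \<phi> x = of_real (Re (\<phi> x))" "x \<in> M \<Longrightarrow> psd x \<Longrightarrow> 0 \<le> Re (\<phi> x)"
  using \<phi>_pos[of x] by (auto simp: complex_nonneg_Reals_iff complex_eq_iff)

lemma \<phi>_symm_real: "x \<in> M \<Longrightarrow> symm x \<Longrightarrow> Im (\<phi> x) = 0"
proof -
  assume x: "x \<in> M" "symm x"
  have 1: "norm x *\<^sub>R id_blinfun + x \<in> M" using x by (intro M_intros)
  have "Im (\<phi> (norm x *\<^sub>R id_blinfun + x)) = 0"
    using \<phi>_pos[OF 1 psd_norm_minus(2)[OF x(2)]] by (simp add: complex_nonneg_Reals_iff)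
  then show ?thesis using x by (simp add: \<phi>_add \<phi>_scaleR M_intros \<phi>_one)
qed

text \<open>\<open>x - adj x\<close> is skew, so \<i> times it is symmetric, where \<phi> is real;
  complex linearity turns this into a vanishing real part.\<close>

lemma \<phi>_adj: "x \<in> M \<Longrightarrow> Re (\<phi> (adj x)) = Re (\<phi> x)"
proof -
  assume x: "x \<in> M"
  define s where "s = x - adj x"
  have s: "s \<in> M" unfolding s_def using x adj by (intro M_intros)
  have skew: "inner (s f) g = - inner f (s g)" for f g using x by (simp add: s_def bl_simps adj(2,3))
  have "symm (\<i> *\<^sub>C s)" unfolding symm_def blinfun_apply_scaleC
    using cboundedD[of s] s M_cbounded by (auto simp: inner_i_left skew)
  then have "Im (\<phi> (\<i> *\<^sub>C s)) = 0" by (intro \<phi>_symm_real M_scaleC s)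
  then have "Re (\<phi> s) = 0" using \<phi>_scaleC[OF s, of \<i>] by simp
  then show ?thesis using x by (simp add: s_def \<phi>_diff adj)
qed

text \<open>The link between normality, which speaks of least upper bounds, and
  \<open>R_lim\<close>, which speaks of strong limits.\<close>

lemma lim_is_lub:
  assumes X: "\<And>n. X n \<in> M" "\<And>n. psd (X n)" "\<And>n. psd (X (Suc n) - X n)" "z \<in> M"
    and lim: "\<And>f. (\<lambda>n. blinfun_apply (X n) f) \<longlonglongrightarrow> blinfun_apply z f"
  shows "is_lub_in M (range X) z"
  unfolding is_lub_in_def
proof (intro conjI ballI impI)
  show "z \<in> sa_part M" using X lim symm_limit[of X z, OF psdD(1)[OF X(2)]] by (simp add: sa_part_iff)
  show "z - x \<in> pos_part M" if "x \<in> range X" for x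
    using that psd_increasing_limit[of X z, OF X(3) lim] X by (auto simp: pos_part_iff M_diff)
  fix u assume u: "u \<in> sa_part M" "\<forall>x\<in>range X. u - x \<in> pos_part M"
  have "psd (u - z)"
  proof (rule psd_limit[of "\<lambda>n. u - X n"])
    show "psd (u - X n)" for n using u by (simp add: pos_part_iff)
    show "(\<lambda>n. (u - X n) f) \<longlonglongrightarrow> (u - z) f" for f
      unfolding blinfun.diff_left by (intro tendsto_diff tendsto_const lim)
  qed
  then show "u - z \<in> pos_part M" using u X by (simp add: pos_part_iff sa_part_iff M_diff)
qed

sublocale normal_algebra M "\<lambda>x. Re (\<phi> x)"
proof
  show "pfun (\<lambda>x. Re (\<phi> x))" unfolding pfun_def by (simp add: \<phi>_add \<phi>_scaleR \<phi>_adj \<phi>_pos_real(2))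
  show "x = 0" if "x \<in> M" "psd x" "Re (\<phi> x) = 0" for x
    using faith that \<phi>_pos_real(1)[of x] by (simp add: faithful_on_def pos_part_iff)
  fix X z assume X: "\<And>n. X n \<in> M" "\<And>n. psd (X n)" "\<And>n. psd (X (Suc n) - X n)" "z \<in> M"
    and lim: "\<And>f. (\<lambda>n. blinfun_apply (X n) f) \<longlonglongrightarrow> blinfun_apply z f"
  have inc: "incseq (\<lambda>n. Re (\<phi> (X n)))"
    using \<phi>_pos_real(2)[OF _ X(3)] X by (intro incseq_SucI) (simp add: \<phi>_diff M_diff)
  have zX: "psd (z - X n)" for n by (rule psd_increasing_limit[of X, OF X(3) lim])
  have bdd: "bdd_above (range (\<lambda>n. Re (\<phi> (X n))))"
    using \<phi>_pos_real(2)[OF _ zX] X by (intro bdd_aboveI2[of _ _ "Re (\<phi> z)"]) (simp add: \<phi>_diff M_diff)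
  have "Re (\<phi> z) = (SUP x\<in>range X. Re (\<phi> x))"
  proof -
    have dir: "\<forall>x\<in>range X. \<forall>y\<in>range X. \<exists>w\<in>range X. w - x \<in> pos_part M \<and> w - y \<in> pos_part M"
    proof (intro ballI)
      fix x y assume "x \<in> range X" "y \<in> range X"
      then obtain i j where ij: "x = X i" "y = X j" by blast
      show "\<exists>w\<in>range X. w - x \<in> pos_part M \<and> w - y \<in> pos_part M"
        using psd_increasing[of X i "max i j", OF X(3)] psd_increasing[of X j "max i j", OF X(3)] X(1)
        by (intro bexI[of _ "X (max i j)"]) (auto simp: ij pos_part_iff M_diff)
    qed
    have "range X \<subseteq> pos_part M" using X by (auto simp: pos_part_iff)
    then show ?thesis using normal dir lim_is_lub[OF X lim] unfolding normal_on_def by blast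
  qed
  then have "Re (\<phi> z) = (SUP n. Re (\<phi> (X n)))" by (simp add: image_image)
  then show "(\<lambda>n. Re (\<phi> (X n))) \<longlonglongrightarrow> Re (\<phi> z)" using LIMSEQ_incseq_SUP[OF bdd inc] by simp
qed

lemma represents_iff: "represents M \<phi> I f \<longleftrightarrow> rep (\<lambda>x. Re (\<phi> x)) I f"
proof -
  have "((\<lambda>i. cinner (x (f i)) (f i)) has_sum \<phi> x) I \<longleftrightarrow> ((\<lambda>i. inner (x (f i)) (f i)) has_sum Re (\<phi> x)) I"
    if x: "x \<in> M" "psd x" for x
  proof -
    have "cinner (x (f i)) (f i) = of_real (inner (x (f i)) (f i))" for i
      using positive_iff_psd[of x] x M_cbounded by (auto simp: complex_nonneg_Reals_iff complex_eq_iff Re_cinner)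
    then show ?thesis using \<phi>_pos_real(1)[OF x] by (metis (no_types, lifting) has_sum_cong has_sum_of_real_iff)
  qed
  then show ?thesis by (auto simp: represents_def rep_def pos_part_iff)
qed

lemma lineal_iff: "f \<in> lineal M \<phi> \<longleftrightarrow> (\<exists>l>0. \<forall>x\<in>M. psd x \<longrightarrow> inner (x f) f \<le> l * Re (\<phi> x))"
  by (simp add: lineal_def pos_part_iff Re_cinner Ball_def) blast

lemma lineal_represents: "represents M \<phi> I f \<Longrightarrow> i \<in> I \<Longrightarrow> f i \<in> lineal M \<phi>"
  using rep_member[OF _ bounded_by_R] by (force simp: represents_iff lineal_iff intro!: exI[of _ 1])

lemma lineal_scaleC: "f \<in> lineal M \<phi> \<Longrightarrow> c *\<^sub>C f \<in> lineal M \<phi>"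
proof -
  assume "f \<in> lineal M \<phi>"
  then obtain l where l: "l > 0" "\<And>x. x \<in> M \<Longrightarrow> psd x \<Longrightarrow> inner (x f) f \<le> l * Re (\<phi> x)" by (auto simp: lineal_iff)
  have "inner (x (c *\<^sub>C f)) (c *\<^sub>C f) \<le> ((cmod c)\<^sup>2 * l + 1) * Re (\<phi> x)" if x: "x \<in> M" "psd x" for x
  proof -
    have "cinner (x (c *\<^sub>C f)) (c *\<^sub>C f) = (c * cnj c) * cinner (x f) f"
      using x M_cbounded by (simp add: cboundedD[OF subsetD] cinner_scaleC_left cinner_scaleC_right)
    then have "inner (x (c *\<^sub>C f)) (c *\<^sub>C f) = (cmod c)\<^sup>2 * inner (x f) f"
      by (simp add: inner_eq_Re_cinner flip: complex_norm_square)
    also have "\<dots> \<le> (cmod c)\<^sup>2 * (l * Re (\<phi> x))" by (intro mult_left_mono l x) simp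
    also have "\<dots> \<le> ((cmod c)\<^sup>2 * l + 1) * Re (\<phi> x)" using \<phi>_pos_real(2)[OF x] by (simp add: algebra_simps)
    finally show ?thesis .
  qed
  moreover have "(cmod c)\<^sup>2 * l + 1 > 0" using l by (simp add: add_nonneg_pos)
  ultimately show ?thesis unfolding lineal_iff by blast
qed

lemma lineal_add: "f \<in> lineal M \<phi> \<Longrightarrow> g \<in> lineal M \<phi> \<Longrightarrow> f + g \<in> lineal M \<phi>"
proof -
  assume "f \<in> lineal M \<phi>" "g \<in> lineal M \<phi>"
  then obtain l k where l: "l > 0" "\<And>x. x \<in> M \<Longrightarrow> psd x \<Longrightarrow> inner (x f) f \<le> l * Re (\<phi> x)"
    and k: "k > 0" "\<And>x. x \<in> M \<Longrightarrow> psd x \<Longrightarrow> inner (x g) g \<le> k * Re (\<phi> x)" by (auto simp: lineal_iff)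
  have "inner (x (f + g)) (f + g) \<le> (2 * l + 2 * k) * Re (\<phi> x)" if x: "x \<in> M" "psd x" for x
  proof -
    have "inner (x (f + g)) (f + g) + inner (x (f - g)) (f - g) = 2 * inner (x f) f + 2 * inner (x g) g" by (simp add: bl_simps)
    then show ?thesis using psdD(2)[OF x(2), of "f - g"] l(2)[OF x] k(2)[OF x] by (simp add: distrib_right)
  qed
  then show ?thesis unfolding lineal_iff using l k by (intro exI[of _ "2 * l + 2 * k"]) auto
qed

lemma lineal_minus: "f \<in> lineal M \<phi> \<Longrightarrow> - f \<in> lineal M \<phi>"
  using lineal_scaleC[of f "-1"] by (simp add: scaleC_minus1)

lemma lineal_diff: "f \<in> lineal M \<phi> \<Longrightarrow> g \<in> lineal M \<phi> \<Longrightarrow> f - g \<in> lineal M \<phi>"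
  using lineal_add[of f "- g"] lineal_minus by simp

text \<open>A hermitian form is determined by its real diagonal. Applied to the given form and to
  the forms of the approximating operators, this reduces convergence on pairs to convergence on the
  diagonal.\<close>

lemma polarization:
  assumes s: "sesquilinear_on (lineal M \<phi>) s" "hermitian_on (lineal M \<phi>) s" and fg: "f \<in> lineal M \<phi>" "g \<in> lineal M \<phi>"
  defines "Q \<equiv> \<lambda>h. Re (s h h)"
  shows "s f g = Complex ((Q (f + g) - Q (f - g)) / 4) ((Q (f + \<i> *\<^sub>C g) - Q (f - \<i> *\<^sub>C g)) / 4)"
proof -
  have re: "Re (s u v) = (Q (u + v) - Q (u - v)) / 4" if uv: "u \<in> lineal M \<phi>" "v \<in> lineal M \<phi>" for u v
  proof -
    have m: "s u' (- v) = - s u' v" "s (- v) u' = - s v u'" if "u' \<in> lineal M \<phi>" for u'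
    proof -
      have "s u' ((-1) *\<^sub>C v) = cnj (-1) * s u' v" "s ((-1) *\<^sub>C v) u' = (-1) * s v u'"
        using s(1) that uv unfolding sesquilinear_on_def by blast+
      then show "s u' (- v) = - s u' v" "s (- v) u' = - s v u'" by (simp_all add: scaleC_minus1)
    qed
    have add: "s (u + w) h = s u h + s w h" "s h (u + w) = s h u + s h w" if "w \<in> lineal M \<phi>" "h \<in> lineal M \<phi>" for w h
      using s(1) that uv unfolding sesquilinear_on_def by blast+
    have sq: "s (u + w) (u + w) = s u u + s w u + (s u w + s w w)" if "w \<in> lineal M \<phi>" for w
      using uv that by (simp add: add lineal_add)
    have "s (u + v) (u + v) = s u u + s v u + (s u v + s v v)" by (rule sq[OF uv(2)])
    moreover have "s (u - v) (u - v) = s u u - s v u - s u v + s v v"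
      using sq[OF lineal_minus[OF uv(2)]] m(1)[OF uv(1)] m(2)[OF uv(1)] m(1)[OF uv(2)] m(2)[OF lineal_minus[OF uv(2)]] by simp
    moreover have "Re (s v u) = Re (s u v)" using s(2) uv unfolding hermitian_on_def by (metis complex_cnj(1) complex_cnj_cnj complex_surj cnj.sel(1))
    ultimately show ?thesis by (simp add: Q_def)
  qed
  have "s f (\<i> *\<^sub>C g) = cnj \<i> * s f g" using s(1) fg unfolding sesquilinear_on_def by blast
  then have "Im (s f g) = Re (s f (\<i> *\<^sub>C g))" by simp
  then show ?thesis using re[OF fg] re[OF fg(1) lineal_scaleC[OF fg(2)], of \<i>] by (simp add: complex_eq_iff)
qed

lemma sesquilinear_op: "x \<in> M \<Longrightarrow> sesquilinear_on D (\<lambda>f g. cinner (blinfun_apply x f) g)"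
  unfolding sesquilinear_on_def using M_cbounded
  by (auto simp: blinfun.add_right cinner_add_left cinner_add_right cboundedD[OF subsetD] cinner_scaleC_left cinner_scaleC_right)

lemma hermitian_op: "x \<in> M \<Longrightarrow> symm x \<Longrightarrow> hermitian_on D (\<lambda>f g. cinner (blinfun_apply x f) g)"
proof -
  assume x: "x \<in> M" "symm x"
  then have "is_adjoint x x" using is_adjoint_self_iff M_cbounded by blast
  then have "cinner (x f) g = cnj (cinner (x g) f)" for f g
    using cinner_commute[of f "x g"] by (simp only: is_adjoint_def)
  then show ?thesis unfolding hermitian_on_def by blast
qed

lemma phi_norm_bdd: "bdd_below {Re (\<phi> (x1 + x2)) | x1 x2. x1 \<in> pos_part M \<and> x2 \<in> pos_part M \<and> x = x1 - x2}"
  by (rule bdd_belowI[of _ 0]) (auto simp: pos_part_iff \<phi>_pos_real(2) M_add)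

lemma phi_norm_le:
  assumes "x1 \<in> M" "x2 \<in> M" "psd x1" "psd x2" shows "phi_norm M \<phi> (x1 - x2) \<le> Re (\<phi> (x1 + x2))"
  unfolding phi_norm_def by (rule cInf_lower[OF _ phi_norm_bdd]) (use assms in \<open>auto simp: pos_part_iff\<close>)

text \<open>An infimum below \<open>e\<close> has a witness only over a nonempty set;
  \<open>x = (||x|| + x) - ||x||\<close> provides an element.\<close>

lemma phi_norm_lessD:
  assumes x: "x \<in> M" "symm x" and less: "phi_norm M \<phi> x < e"
  obtains x1 x2 where "x1 \<in> M" "x2 \<in> M" "psd x1" "psd x2" "x = x1 - x2" "Re (\<phi> (x1 + x2)) < e"
proof -
  let ?S = "{Re (\<phi> (x1 + x2)) | x1 x2. x1 \<in> pos_part M \<and> x2 \<in> pos_part M \<and> x = x1 - x2}"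
  have "x = (norm x *\<^sub>R id_blinfun + x) - norm x *\<^sub>R id_blinfun" by simp
  moreover have "norm x *\<^sub>R id_blinfun + x \<in> pos_part M" "norm x *\<^sub>R id_blinfun \<in> pos_part M"
    using x psd_norm_minus(2)[OF x(2)] by (auto simp: pos_part_iff M_intros)
  ultimately have "?S \<noteq> {}" by blast
  from cInf_lessD[OF this less[unfolded phi_norm_def]] show ?thesis using that by (auto simp: pos_part_iff)
qed

text \<open>The implication from (ii) to (i) for hermitian forms: their diagonal supplies the
  \<open>q\<close> of \<open>invariant_sum\<close>, and \<open>approximation\<close> the Cauchy
  sequence.\<close>

lemma L1_sa_intro:
  assumes s: "sesquilinear_on (lineal M \<phi>) s" "hermitian_on (lineal M \<phi>) s"
    and q_sum: "\<And>(I :: nat set) g. represents M \<phi> I g \<Longrightarrow> ((\<lambda>i. Re (s (g i) (g i))) has_sum C0) I"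
  shows "s \<in> L1_sa M \<phi>"
proof -
  have sr: "s (r *\<^sub>R f) (r *\<^sub>R f) = of_real (r\<^sup>2) * s f f" if f: "f \<in> lineal M \<phi>" for f r
  proof -
    have rf: "of_real r *\<^sub>C f \<in> lineal M \<phi>" using f by (rule lineal_scaleC)
    have "s (of_real r *\<^sub>C f) (of_real r *\<^sub>C f) = of_real r * s f (of_real r *\<^sub>C f)"
      using s(1) f rf unfolding sesquilinear_on_def by blast
    moreover have "s f (of_real r *\<^sub>C f) = cnj (of_real r) * s f f" using s(1) f unfolding sesquilinear_on_def by blast
    ultimately show ?thesis by (simp add: scaleC_of_real power2_eq_square)
  qed
  interpret invariant_sum M "\<lambda>x. Re (\<phi> x)" "\<lambda>f. Re (s f f)" C0
  proof
    show "Re (s (r *\<^sub>R f) (r *\<^sub>R f)) = r\<^sup>2 * Re (s f f)"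
      if "0 < l" "\<And>x. x \<in> M \<Longrightarrow> psd x \<Longrightarrow> inner (blinfun_apply x f) f \<le> l * Re (\<phi> x)" for l f r
    proof -
      have "f \<in> lineal M \<phi>" unfolding lineal_iff using that by blast
      from sr[OF this, of r] show ?thesis by simp
    qed
  qed (use \<phi>_one q_sum represents_iff in auto)
  obtain X where X: "\<And>n. X n \<in> M" "\<And>n. symm (X n)"
    and cau: "\<And>n m. \<exists>x1\<in>M. \<exists>x2\<in>M. psd x1 \<and> psd x2 \<and> X n - X m = x1 - x2 \<and> Re (\<phi> (x1 + x2)) \<le> 3 / real (Suc n) + 3 / real (Suc m)"
    and lim: "\<And>l f. 0 < l \<Longrightarrow> \<forall>x\<in>M. psd x \<longrightarrow> inner (x f) f \<le> l * Re (\<phi> x) \<Longrightarrow> (\<lambda>n. inner (X n f) f) \<longlonglongrightarrow> Re (s f f)"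
    using approximation by blast
  have lim: "(\<lambda>n. inner (X n f) f) \<longlonglongrightarrow> Re (s f f)" if "f \<in> lineal M \<phi>" for f
    using that lim unfolding lineal_iff by blast
  have "phi_Cauchy M \<phi> X" unfolding phi_Cauchy_def
  proof (intro allI impI)
    fix e :: real assume e: "e > 0"
    obtain N where N: "1 / real (Suc N) < e / 6" using nat_approx_posE[of "e / 6"] e by auto
    have "phi_norm M \<phi> (X m - X n) < e" if mn: "m \<ge> N" "n \<ge> N" for m n
    proof -
      have le: "1 / real (Suc k) \<le> 1 / real (Suc N)" if "k \<ge> N" for k using that by (intro divide_left_mono) auto
      obtain x1 x2 where x: "x1 \<in> M" "x2 \<in> M" "psd x1" "psd x2" "X m - X n = x1 - x2" "Re (\<phi> (x1 + x2)) \<le> 3 / real (Suc m) + 3 / real (Suc n)"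
        using cau by blast
      have "phi_norm M \<phi> (X m - X n) \<le> 3 * (1 / real (Suc m)) + 3 * (1 / real (Suc n))"
        using phi_norm_le[OF x(1-4)] x(5,6) by simp
      then show ?thesis using le[OF mn(1)] le[OF mn(2)] N by linarith
    qed
    then show "\<exists>N. \<forall>m\<ge>N. \<forall>n\<ge>N. phi_norm M \<phi> (X m - X n) < e" by blast
  qed
  moreover have "(\<lambda>n. cinner (X n f) g) \<longlonglongrightarrow> s f g" if fg: "f \<in> lineal M \<phi>" "g \<in> lineal M \<phi>" for f g
  proof -
    have ig: "\<i> *\<^sub>C g \<in> lineal M \<phi>" using fg(2) by (rule lineal_scaleC)
    show ?thesis
      unfolding polarization[OF s fg] polarization[OF sesquilinear_op[OF X(1)] hermitian_op[OF X] fg] Re_cinner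
      by (intro tendsto_Complex tendsto_divide tendsto_diff tendsto_const lim lineal_add lineal_diff fg ig) simp_all
  qed
  ultimately show ?thesis using s X unfolding L1_sa_def mem_Collect_eq by (intro conjI exI[of _ X]) (auto simp: sa_part_iff)
qed

text \<open>A decomposition \<open>x m - x n = x1 - x2\<close> of small \<phi>-value bounds the
  difference of every finite sum, uniformly in the finite set and in the representation. So the
  limits in \<open>n\<close> and over finite sets interchange, and the sum is the limit
  \<open>c\<close> of \<open>\<phi> (x n)\<close>, in which no representation occurs.\<close>

lemma L1_sa_sum:
  assumes a: "a \<in> L1_sa M \<phi>"
  shows "\<exists>c. \<forall>(I :: 'i set) f. represents M \<phi> I f \<longrightarrow> ((\<lambda>i. a (f i) (f i)) has_sum c) I"
proof -
  obtain x where x: "\<And>n. x n \<in> M" "\<And>n. symm (x n)" and cau: "phi_Cauchy M \<phi> x"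
    and lim: "\<And>f g. f \<in> lineal M \<phi> \<Longrightarrow> g \<in> lineal M \<phi> \<Longrightarrow> (\<lambda>n. cinner (x n f) g) \<longlonglongrightarrow> a f g"
    using a unfolding L1_sa_def by (auto simp: sa_part_iff)
  have split: "\<exists>N. \<forall>m\<ge>N. \<forall>n\<ge>N. \<exists>x1\<in>M. \<exists>x2\<in>M. psd x1 \<and> psd x2 \<and> x m - x n = x1 - x2 \<and> Re (\<phi> x1) + Re (\<phi> x2) < e"
    if e: "e > 0" for e
  proof -
    obtain N where N: "\<And>m n. m \<ge> N \<Longrightarrow> n \<ge> N \<Longrightarrow> phi_norm M \<phi> (x m - x n) < e"
      using cau e unfolding phi_Cauchy_def by blast
    have "\<exists>x1\<in>M. \<exists>x2\<in>M. psd x1 \<and> psd x2 \<and> x m - x n = x1 - x2 \<and> Re (\<phi> x1) + Re (\<phi> x2) < e" if mn: "m \<ge> N" "n \<ge> N" for m n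
    proof -
      have "x m - x n \<in> M" "symm (x m - x n)" using x by (auto intro: M_diff)
      then obtain x1 x2 where x12: "x1 \<in> M" "x2 \<in> M" "psd x1" "psd x2" "x m - x n = x1 - x2" "Re (\<phi> (x1 + x2)) < e"
        using phi_norm_lessD[OF _ _ N[OF mn]] by blast
      then show ?thesis using \<phi>_add[OF x12(1,2)] by (intro bexI[of _ x1] bexI[of _ x2]) auto
    qed
    then show ?thesis by blast
  qed
  have "Cauchy (\<lambda>n. \<phi> (x n))"
  proof (rule CauchyI)
    fix e :: real assume "e > 0"
    from split[OF this] obtain N where N: "\<And>m n. m \<ge> N \<Longrightarrow> n \<ge> N \<Longrightarrow>
      \<exists>x1\<in>M. \<exists>x2\<in>M. psd x1 \<and> psd x2 \<and> x m - x n = x1 - x2 \<and> Re (\<phi> x1) + Re (\<phi> x2) < e" by blast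
    have "norm (\<phi> (x m) - \<phi> (x n)) < e" if mn: "m \<ge> N" "n \<ge> N" for m n
    proof -
      obtain x1 x2 where x12: "x1 \<in> M" "x2 \<in> M" "psd x1" "psd x2" "x m - x n = x1 - x2" "Re (\<phi> x1) + Re (\<phi> x2) < e"
        using N[OF mn] by blast
      have "\<phi> (x m) - \<phi> (x n) = of_real (Re (\<phi> x1)) - of_real (Re (\<phi> x2))"
        using \<phi>_diff[OF x(1) x(1), of m n] x12 \<phi>_diff[OF x12(1,2)] \<phi>_pos_real(1) by metis
      then have "norm (\<phi> (x m) - \<phi> (x n)) = \<bar>Re (\<phi> x1) - Re (\<phi> x2)\<bar>" by (simp flip: of_real_diff)
      then show ?thesis using x12(6) \<phi>_pos_real(2)[OF x12(1,3)] \<phi>_pos_real(2)[OF x12(2,4)] by linarith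
    qed
    then show "\<exists>N. \<forall>m\<ge>N. \<forall>n\<ge>N. norm (\<phi> (x m) - \<phi> (x n)) < e" by blast
  qed
  then obtain c where c: "(\<lambda>n. \<phi> (x n)) \<longlonglongrightarrow> c" using Cauchy_convergent_iff convergent_def by blast
  have "((\<lambda>i. a (f i) (f i)) has_sum c) I" if rep: "represents M \<phi> I f" for I :: "'i set" and f
  proof -
    have fD: "f i \<in> lineal M \<phi>" if "i \<in> I" for i using lineal_represents[OF rep that] .
    have hs_pos: "((\<lambda>i. cinner (z (f i)) (f i)) has_sum \<phi> z) I" if "z \<in> M" "psd z" for z
      using rep that by (simp add: represents_def pos_part_iff)
    \<comment> \<open>Representations speak of positive operators; the shift by the norm reduces a
      symmetric \<open>x n\<close> to them.\<close>
    have hs_x: "((\<lambda>i. cinner (x n (f i)) (f i)) has_sum \<phi> (x n)) I" for n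
    proof -
      let ?u = "norm (x n) *\<^sub>R id_blinfun + x n" and ?v = "norm (x n) *\<^sub>R id_blinfun :: 'h \<Rightarrow>\<^sub>L 'h"
      have u: "?u \<in> M" "psd ?u" using x[of n] psd_norm_minus(2)[OF x(2)] by (auto intro: M_intros)
      have v: "?v \<in> M" "psd ?v" by (auto intro: M_intros)
      have "((\<lambda>i. cinner (?u (f i)) (f i) - cinner (?v (f i)) (f i)) has_sum \<phi> ?u - \<phi> ?v) I"
        using has_sum_add[OF hs_pos[OF u] has_sum_uminusI[OF hs_pos[OF v]]] by simp
      moreover have "cinner (?u (f i)) (f i) - cinner (?v (f i)) (f i) = cinner (x n (f i)) (f i)" for i
        by (simp add: blinfun.add_left cinner_add_left)
      moreover have "\<phi> ?u - \<phi> ?v = \<phi> (x n)" using \<phi>_add[OF v(1) x(1)[of n]] by simp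
      ultimately show ?thesis by simp
    qed
    \<comment> \<open>One \<open>n\<close> serves \<open>\<phi> (x n)\<close> and all finite sums at
      once; the bound is shown with \<open>x (m + N)\<close> in place of the form and then passed to
      the limit in \<open>m\<close>.\<close>
    have unif: "\<exists>n. cmod (\<phi> (x n) - c) < e \<and> (\<forall>F. finite F \<longrightarrow> F \<subseteq> I \<longrightarrow> cmod ((\<Sum>i\<in>F. a (f i) (f i)) - (\<Sum>i\<in>F. cinner (x n (f i)) (f i))) \<le> e)"
      if e: "e > 0" for e
    proof -
      from split[OF e] obtain N where N: "\<And>m n. m \<ge> N \<Longrightarrow> n \<ge> N \<Longrightarrow>
        \<exists>x1\<in>M. \<exists>x2\<in>M. psd x1 \<and> psd x2 \<and> x m - x n = x1 - x2 \<and> Re (\<phi> x1) + Re (\<phi> x2) < e" by blast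
      obtain N' where N': "\<And>n. n \<ge> N' \<Longrightarrow> cmod (\<phi> (x n) - c) < e" using LIMSEQ_D[OF c e] by blast
      define n where "n = max N N'"
      have "cmod ((\<Sum>i\<in>F. a (f i) (f i)) - (\<Sum>i\<in>F. cinner (x n (f i)) (f i))) \<le> e" if F: "finite F" "F \<subseteq> I" for F
      proof (rule lim_le)
        show "(\<lambda>m. cmod ((\<Sum>i\<in>F. cinner (x (m + N) (f i)) (f i)) - (\<Sum>i\<in>F. cinner (x n (f i)) (f i))))
          \<longlonglongrightarrow> cmod ((\<Sum>i\<in>F. a (f i) (f i)) - (\<Sum>i\<in>F. cinner (x n (f i)) (f i)))"
          by (intro tendsto_norm tendsto_diff tendsto_const tendsto_sum LIMSEQ_ignore_initial_segment[OF lim] fD subsetD[OF F(2)])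
        fix m
        obtain x1 x2 where x12: "x1 \<in> M" "x2 \<in> M" "psd x1" "psd x2" "x (m + N) - x n = x1 - x2" "Re (\<phi> x1) + Re (\<phi> x2) < e"
          using N[of "m + N" n] by (auto simp: n_def)
        have r: "cinner (z (f i)) (f i) = of_real (inner (z (f i)) (f i))" if "z \<in> M" "psd z" for z i
          using positive_iff_psd[of z] that M_cbounded by (auto simp: complex_nonneg_Reals_iff complex_eq_iff Re_cinner)
        have s: "(\<Sum>i\<in>F. inner (z (f i)) (f i)) \<le> Re (\<phi> z)" if "z \<in> M" "psd z" for z
          using rep that F by (intro finite_sum_le_has_sum) (auto simp: represents_iff rep_def psd_def)
        have d: "cinner (x (m + N) (f i)) (f i) - cinner (x n (f i)) (f i) = of_real (inner (x1 (f i)) (f i) - inner (x2 (f i)) (f i))" for i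
          using r[OF x12(1,3), of i] r[OF x12(2,4), of i] arg_cong[OF x12(5), of "\<lambda>z. cinner (z (f i)) (f i)"]
          by (simp add: blinfun.diff_left cinner_diff)
        have "cmod ((\<Sum>i\<in>F. cinner (x (m + N) (f i)) (f i)) - (\<Sum>i\<in>F. cinner (x n (f i)) (f i)))
          = \<bar>(\<Sum>i\<in>F. inner (x1 (f i)) (f i)) - (\<Sum>i\<in>F. inner (x2 (f i)) (f i))\<bar>"
          unfolding sum_subtractf[symmetric] d of_real_sum[symmetric] norm_of_real by simp
        moreover have "(\<Sum>i\<in>F. inner (x1 (f i)) (f i)) \<ge> 0" "(\<Sum>i\<in>F. inner (x2 (f i)) (f i)) \<ge> 0"
          using x12(3,4) by (auto simp: psd_def intro: sum_nonneg)
        ultimately show "cmod ((\<Sum>i\<in>F. cinner (x (m + N) (f i)) (f i)) - (\<Sum>i\<in>F. cinner (x n (f i)) (f i))) \<le> e"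
          using s[OF x12(1,3)] s[OF x12(2,4)] x12(6) by linarith
      qed
      then show ?thesis using N'[of n] by (intro exI[of _ n]) (auto simp: n_def)
    qed
    show ?thesis unfolding has_sum_def tendsto_iff eventually_finite_subsets_at_top
    proof (intro allI impI)
      fix e :: real assume "e > 0"
      then have e3: "e / 3 > 0" by simp
      obtain n where n: "cmod (\<phi> (x n) - c) < e / 3"
        "\<And>F. finite F \<Longrightarrow> F \<subseteq> I \<Longrightarrow> cmod ((\<Sum>i\<in>F. a (f i) (f i)) - (\<Sum>i\<in>F. cinner (x n (f i)) (f i))) \<le> e / 3"
        using unif[OF e3] by blast
      obtain F0 where F0: "finite F0" "F0 \<subseteq> I"
        "\<And>F. finite F \<Longrightarrow> F0 \<subseteq> F \<Longrightarrow> F \<subseteq> I \<Longrightarrow> dist (\<Sum>i\<in>F. cinner (x n (f i)) (f i)) (\<phi> (x n)) < e / 3"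
        using tendstoD[OF hs_x[of n, unfolded has_sum_def] e3] unfolding eventually_finite_subsets_at_top
        by (elim exE conjE) (rule that, auto)
      have "dist (\<Sum>i\<in>F. a (f i) (f i)) c < e" if F: "finite F" "F0 \<subseteq> F" "F \<subseteq> I" for F
      proof -
        let ?s = "\<Sum>i\<in>F. cinner (x n (f i)) (f i)"
        have "dist (\<Sum>i\<in>F. a (f i) (f i)) c \<le> dist (\<Sum>i\<in>F. a (f i) (f i)) ?s + (dist ?s (\<phi> (x n)) + dist (\<phi> (x n)) c)"
          using dist_triangle dist_triangle[of ?s c "\<phi> (x n)"] by (meson add_left_mono order_trans)
        then show ?thesis using n(1) n(2)[OF F(1,3)] F0(3)[OF F] by (simp add: dist_norm)
      qed
      then show "\<exists>F0. finite F0 \<and> F0 \<subseteq> I \<and> (\<forall>F. finite F \<and> F0 \<subseteq> F \<and> F \<subseteq> I \<longrightarrow> dist (\<Sum>i\<in>F. a (f i) (f i)) c < e)"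
        using F0(1,2) by blast
    qed
  qed
  then show ?thesis by blast
qed

end

theorem theorem2:
  fixes M :: "('h::chilbert_space \<Rightarrow>\<^sub>L 'h) set"
    and \<phi> :: "'h \<Rightarrow>\<^sub>L 'h \<Rightarrow> complex"
    and a :: "'h \<Rightarrow> 'h \<Rightarrow> complex"
  assumes "von_neumann_algebra M"
    and "state_on M \<phi>" and "faithful_on M \<phi>" and "normal_on M \<phi>"
    and "sesquilinear_on (lineal M \<phi>) a"
  shows "a \<in> L1 M \<phi> \<longleftrightarrow>
    (\<forall>(I :: 'i::infinite set) f. represents M \<phi> I f \<longrightarrow>
      (\<lambda>i. cmod (a (f i) (f i))) summable_on I) \<and>
    (\<forall>(I :: 'i set) f (J :: 'i set) g. represents M \<phi> I f \<longrightarrow> represents M \<phi> J g \<longrightarrow>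
      (\<Sum>\<^sub>\<infinity>i\<in>I. a (f i) (f i)) = (\<Sum>\<^sub>\<infinity>j\<in>J. a (g j) (g j)))"
proof -
  interpret faithful_normal_state M \<phi> using assms by unfold_locales
  show ?thesis
  proof
    assume "a \<in> L1 M \<phi>"
    then obtain a1 a2 where a12: "a1 \<in> L1_sa M \<phi>" "a2 \<in> L1_sa M \<phi>"
      "\<And>f g. f \<in> lineal M \<phi> \<Longrightarrow> g \<in> lineal M \<phi> \<Longrightarrow> a f g = a1 f g + \<i> * a2 f g" by (auto simp: L1_def)
    obtain c1 where c1: "\<And>(I :: 'i set) f. represents M \<phi> I f \<Longrightarrow> ((\<lambda>i. a1 (f i) (f i)) has_sum c1) I"
      using L1_sa_sum[OF a12(1)] by blast
    obtain c2 where c2: "\<And>(I :: 'i set) f. represents M \<phi> I f \<Longrightarrow> ((\<lambda>i. a2 (f i) (f i)) has_sum c2) I"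
      using L1_sa_sum[OF a12(2)] by blast
    have "((\<lambda>i. a (f i) (f i)) has_sum c1 + \<i> * c2) I" if rep: "represents M \<phi> I f" for I :: "'i set" and f
    proof -
      have "((\<lambda>i. a1 (f i) (f i) + \<i> * a2 (f i) (f i)) has_sum c1 + \<i> * c2) I"
        by (intro has_sum_add has_sum_cmult_right c1 c2 rep)
      then show ?thesis using a12(3) lineal_represents[OF rep] by (simp cong: has_sum_cong)
    qed
    then show "(\<forall>(I :: 'i set) f. represents M \<phi> I f \<longrightarrow> (\<lambda>i. cmod (a (f i) (f i))) summable_on I) \<and>
      (\<forall>(I :: 'i set) f (J :: 'i set) g. represents M \<phi> I f \<longrightarrow> represents M \<phi> J g \<longrightarrow>
      (\<Sum>\<^sub>\<infinity>i\<in>I. a (f i) (f i)) = (\<Sum>\<^sub>\<infinity>j\<in>J. a (g j) (g j)))"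
      \<comment> \<open>For complex families, unconditional and absolute summability
        coincide.\<close>
      using infsumI summable_on_iff_abs_summable_on_complex by (metis has_sum_imp_summable)
  next
    assume ii: "(\<forall>(I :: 'i set) f. represents M \<phi> I f \<longrightarrow> (\<lambda>i. cmod (a (f i) (f i))) summable_on I) \<and>
      (\<forall>(I :: 'i set) f (J :: 'i set) g. represents M \<phi> I f \<longrightarrow> represents M \<phi> J g \<longrightarrow>
      (\<Sum>\<^sub>\<infinity>i\<in>I. a (f i) (f i)) = (\<Sum>\<^sub>\<infinity>j\<in>J. a (g j) (g j)))"
    \<comment> \<open>An infinite index type contains a copy of \<open>nat\<close>, so
      representations over sets of naturals are covered by (ii).\<close>
    obtain e :: "nat \<Rightarrow> 'i" where e: "inj e"
    proof -
      have "infinite (UNIV :: 'i set)" by (rule infinite_UNIV)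
      from infinite_countable_subset[OF this] that show ?thesis by blast
    qed
    have "\<exists>c. \<forall>(I :: 'i set) f. represents M \<phi> I f \<longrightarrow> (\<Sum>\<^sub>\<infinity>i\<in>I. a (f i) (f i)) = c" using ii by metis
    then obtain c where c: "\<And>(I :: 'i set) f. represents M \<phi> I f \<Longrightarrow> (\<Sum>\<^sub>\<infinity>i\<in>I. a (f i) (f i)) = c" by blast
    have hs: "((\<lambda>n. a (g n) (g n)) has_sum c) I" if rep: "represents M \<phi> I g" for I :: "nat set" and g
    proof -
      have inj: "inj_on e I" by (rule inj_on_subset[OF e]) simp
      have "represents M \<phi> (e ` I) (\<lambda>i. g (inv e i))"
        using rep unfolding represents_def by (simp add: has_sum_reindex[OF inj] o_def inv_f_f[OF e])
      then have "((\<lambda>i. a (g (inv e i)) (g (inv e i))) has_sum c) (e ` I)"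
        using ii c summable_on_iff_abs_summable_on_complex has_sum_infsum by metis
      then show ?thesis by (simp add: has_sum_reindex[OF inj] o_def inv_f_f[OF e])
    qed
    \<comment> \<open>Cartesian decomposition: on the diagonal \<open>a1\<close> and
      \<open>a2\<close> are the real and imaginary parts of \<open>a\<close>, with sums
      \<open>Re c\<close> and \<open>Im c\<close>.\<close>
    define a1 where "a1 f g = (a f g + cnj (a g f)) / 2" for f g
    define a2 where "a2 f g = (a f g - cnj (a g f)) / (2 * \<i>)" for f g
    have sesq: "sesquilinear_on (lineal M \<phi>) a1" "sesquilinear_on (lineal M \<phi>) a2"
      using assms(5) unfolding sesquilinear_on_def a1_def a2_def by (auto simp: field_simps)
    have herm: "hermitian_on (lineal M \<phi>) a1" "hermitian_on (lineal M \<phi>) a2"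
      unfolding hermitian_on_def a1_def a2_def by (auto simp: field_simps)
    have "a1 \<in> L1_sa M \<phi>"
    proof (rule L1_sa_intro[OF sesq(1) herm(1)])
      show "((\<lambda>i. Re (a1 (g i) (g i))) has_sum Re c) I" if "represents M \<phi> I g" for I :: "nat set" and g
        using has_sum_Re[OF hs[OF that]] by (simp add: a1_def)
    qed
    moreover have "a2 \<in> L1_sa M \<phi>"
    proof (rule L1_sa_intro[OF sesq(2) herm(2)])
      have "Re (a2 f f) = Im (a f f)" for f by (simp add: a2_def Re_divide power2_eq_square)
      then show "((\<lambda>i. Re (a2 (g i) (g i))) has_sum Im c) I" if "represents M \<phi> I g" for I :: "nat set" and g
        using has_sum_Im[OF hs[OF that]] by simp
    qed
    moreover have "a f g = a1 f g + \<i> * a2 f g" for f g by (simp add: a1_def a2_def field_simps)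
    ultimately show "a \<in> L1 M \<phi>" using assms(5) unfolding L1_def by blast
  qed
qed

end
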